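(* Let $x,y,z$ be non-negative integers and let $\mathbf a=(a_1,\dots,a_m)$, $\mathbf b=(b_1,\dots,b_n)$ be two (possibly empty) sequences of non-negative integers. Put $\mu=2\lfloor\frac{m+1}{2}\rfloor$, $\mu'=2\lceil\frac{m-1}{2}\rceil$, $\nu=2\lfloor\frac{n+1}{2}\rfloor$, $\nu'=2\lceil\frac{n-1}{2}\rceil$, and $$\mathbf t^{+}=(0,a_1,\dots,a_{\mu-1},\,a_{\mu}+x+y+b_{\nu},\,b_{\nu-1},\dots,b_1),\qquad \mathbf t^{-}=(a_1,\dots,a_{\mu'},\,a_{\mu'+1}+x+y+b_{\nu'+1},\,b_{\nu'},\dots,b_1,z).$$ Then $$M(H^{(1)}_{x,y,z}(\mathbf a;\mathbf b))=\frac{M(H^{(1)}_{x+y,0,z}(\mathbf a;\mathbf b))\,M(H^{(1)}_{0,y,z}(\mathbf a;\mathbf b))}{M(H^{(1)}_{y,0,z}(\mathbf a;\mathbf b))}\cdot\frac{T(x+1,2a+b+2y+z,y)\,V(2x+2a+3,b+2y+z-1,y)}{T(1,2a+b+2y+z,y)\,V(2a+3,b+2y+z-1,y)}$$ $$=2^{-y}\,Q(\mathbf t^{+})\,Q(\mathbf t^{-})\cdot\frac{H_2(2o_a+2o_b+1)\,H_2(2e_a+2e_b+2z+1)}{H_2(2o_a+2o_b+2y+1)\,H_2(2e_a+2e_b+2y+2z+1)}\cdot\frac{H(2a+b+2y+z+1)\,H(b+y+z)}{H(2a+b+y+z+1)\,H(b+z)}$$ $$\cdot\frac{T(x+1,2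a+b+2y+z,y)\,V(2x+2a+3,b+2y+z-1,y)}{T(1,2a+b+2y+z,y)\,V(2a+3,b+2y+z-1,y)}.$$
   Context: Lattice and tilings. For real $u,k$ let $[u;k]$ be the point of the plane with Cartesian coordinates $(u,\frac{\sqrt3}{2}k)$. The triangular lattice has as vertices all $[u;k]$ with $k\in\mathbb Z$, $u-k/2\in\mathbb Z$; its faces are unit equilateral triangles, up-pointing or down-pointing. A region is a finite union of unit triangles. A lozenge is the union of two unit triangles sharing an edge; it is vertical if that edge is horizontal. A tiling of a region is a covering of it by lozenges contained in it, without gaps or overlaps. $M(R)$ is the number of tilings of $R$; $M(\emptyset)=1$. Sequences. $a=\sum a_i$, $b=\sum b_j$; $o_a,e_a$ are the sums of the $a_i$ with $i$ odd, resp. even; $o_b,e_b$ likewise. $a_i=0$ for $i>m$, $b_j=0$ for $j>n$; an empty sequence is treated as the one-term sequence $(0)$. Functions. $H(n)=\prod_{i=0}^{n-1}i!$; $H_2(n)=\prod_{i=1}^{\lfloor n/2\rfloor}(n-2i)!$; for $n\ge0$, $(x)_n=x(x+1)\cdots(x+n-1)$ and $[x]_n=x(x+2)\cdots(x+2n-2)$ (both $1$ for $n=0$); $T(x,n,m)=\prod_{i=0}^{m-1}(x+i)_{n-2i}$, $V(x,n,m)=\prod_{i=0}^{m-1}[x+2i]_{n-2i}$. Empty products are $1$. Quartered hexagons. For a sequence $\mathbf t=(t_1,\dots,t_{2l})$ of non-negative integers let $s_k=t_1+\dots+t_k$, $o_t=\sum_{i\text{ odd}}t_i$, $e_t=\sum_{i\text{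 even}}t_i$. Take the region bounded by the base from $[0;0]$ to $[o_t+e_t;0]$, the segment from $[o_t+e_t;0]$ to $[o_t;2e_t]$, the north side from $[o_t;2e_t]$ to $[0;2e_t]$, and the west zigzag through $[0;0],[-\frac12;1],[0;2],[-\frac12;3],\dots,[0;2e_t]$; remove from it, for each $1\le i\le l$, the up-pointing triangle with base from $[s_{2i-1};0]$ to $[s_{2i};0]$. $Q(\mathbf t)$ is the number of tilings of the resulting region. The region $H^{(1)}_{x,y,z}(\mathbf a;\mathbf b)$. Let $L=x+y+a+b$, $A=2(y+o_a+o_b)$, $B=2(y+z+e_a+e_b)$, and let $\ell$ be the line $k=0$. Upper part: bounded by $\ell$ between $[0;0]$ and $[L;0]$, the segment from $[L;0]$ to $[L-\frac A2;A]$, the horizontal north side at height $k=A$, and the west zigzag through the points $[\alpha(k);k]$, $0\le k\le A$, with $\alpha(k)=0$ for $k$ even and $-\frac12$ for $k$ odd. Lower part: bounded by $\ell$ between $[0;0]$ and $[L;0]$, the segments from $[L;0]$ to $[L+\frac z2;-z]$ and from there to $[L+z-\frac B2;-B]$, the horizontal south side at $k=-B$, and the west zigzag through $[\beta(k);-k]$, $0\le k\le B$, with $\beta(k)=0$ for $k$ even and $-\frac12$ for $k$ odd. The region is the union of the two parts (lozenges may cross $\ell$) after removing: (i) from the upper part, everything at points $[u;k]$ with $u<a_1-k/2$ (an up-pointing half triangle of side $2a_1$); (ii) for $2\le i\le m$, the triangle of side $a_i$ having a side on $\ell$ from $[a_1+\dots+a_{i-1};0]$ to $[a_1+\dots+a_i;0]$,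 down-pointing (below $\ell$) if $i$ is even, up-pointing (above $\ell$) if $i$ is odd; (iii) for $1\le j\le n$, the triangle of side $b_j$ having a side on $\ell$ from $[L-b_1-\dots-b_j;0]$ to $[L-b_1-\dots-b_{j-1};0]$, up-pointing (above $\ell$) if $j$ is odd, down-pointing (below $\ell$) if $j$ is even. (The underlying halved hexagon has north, northeast, southeast, south sides $x+e_a+e_b$, $2y+z+2o_a+2o_b$, $2y+z+2e_a+2e_b$, $x+o_a+o_b$.) *)

theory Defs
  imports Complex_Main "HOL-Library.Disjoint_Sets"
begin

section \<open>The triangular lattice, regions and lozenge tilings\<close>

text \<open>
  The pair \<open>(u, k)\<close> stands for the point \<open>[u;k]\<close> of the plane, whose Cartesian coordinates are
  \<open>(u, (sqrt 3 / 2) * k)\<close>.  Only points on the horizontal lattice lines (integral \<open>k\<close>) are needed.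
  A unit triangle is represented by the set of its three vertices, and a region, being a finite
  union of unit triangles, by the set of the unit triangles it consists of.
\<close>

type_synonym point = "real \<times> int"
type_synonym triangle = "point set"
type_synonym region = "triangle set"

definition lattice :: "point set" where
  "lattice = {(u, k). u - of_int k / 2 \<in> \<int>}"

definition up_unit :: "point \<Rightarrow> triangle" where
  "up_unit = (\<lambda>(u, k). {(u, k), (u + 1, k), (u + 1 / 2, k + 1)})"

definition down_unit :: "point \<Rightarrow> triangle" where
  "down_unit = (\<lambda>(u, k). {(u, k), (u + 1, k), (u + 1 / 2, k - 1)})"

definition unit_triangles :: "triangle set" where
  "unit_triangles = up_unit ` lattice \<union> down_unit ` lattice"

text \<open>
  Two distinct unit triangles share an edge iff they have two vertices in common.  A lozenge is
  represented by the set of its two unit triangles; covering a region without gaps or overlaps by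
  lozenges contained in it means partitioning its set of unit triangles into lozenges.
\<close>

definition lozenges :: "triangle set set" where
  "lozenges = {{s, t} | s t. s \<in> unit_triangles \<and> t \<in> unit_triangles \<and> card (s \<inter> t) = 2}"

definition tilings :: "region \<Rightarrow> triangle set set set" where
  "tilings R = {P. partition_on R P \<and> P \<subseteq> lozenges}"

definition M :: "region \<Rightarrow> nat" where
  "M R = card (tilings R)"

text \<open>
  \<open>cells X\<close> is the union of the unit triangles all of whose vertices lie in \<open>X\<close>.  It is applied to
  sets \<open>X\<close> (the points on lattice lines of a closed polygon) that are bounded by lattice lines and
  are convex within each strip between two consecutive horizontal lattice lines; for these, a unit
  triangle lies in the polygon iff its vertices do.
\<close>

definition cells :: "point set \<Rightarrow> region" where
  "cells X = {t \<in> unit_triangles. t \<subseteq> X}"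

definition up_triangle :: "nat \<Rightarrow> nat \<Rightarrow> region" where  \<comment> \<open>base from \<open>[p;0]\<close> to \<open>[p+s;0]\<close>\<close>
  "up_triangle p s =
     cells {(u, k). 0 \<le> k \<and> k \<le> int s \<and> real p + of_int k / 2 \<le> u \<and> u \<le> real (p + s) - of_int k / 2}"

definition down_triangle :: "nat \<Rightarrow> nat \<Rightarrow> region" where  \<comment> \<open>top side from \<open>[p;0]\<close> to \<open>[p+s;0]\<close>\<close>
  "down_triangle p s =
     cells {(u, k). - int s \<le> k \<and> k \<le> 0 \<and> real p - of_int k / 2 \<le> u \<and> u \<le> real (p + s) + of_int k / 2}"

definition zigzag :: "int \<Rightarrow> real" where  \<comment> \<open>the west boundary, above and below the line \<open>k = 0\<close>\<close>
  "zigzag k = (if even k then 0 else - 1 / 2)"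


section \<open>Sequences\<close>

text \<open>
  Sequences are lists; \<open>entry t i\<close> is the term \<open>t\<^sub>i\<close>, with indices starting at 1 and value 0 beyond
  the end.  As an empty sequence is treated as the sequence \<open>(0)\<close>, \<open>len\<close> is at least 1.
\<close>

definition entry :: "nat list \<Rightarrow> nat \<Rightarrow> nat" where
  "entry t i = (if 1 \<le> i \<and> i \<le> length t then t ! (i - 1) else 0)"

definition len :: "nat list \<Rightarrow> nat" where
  "len t = max 1 (length t)"

definition osum :: "nat list \<Rightarrow> nat" where
  "osum t = (\<Sum>i | i \<in> {1..length t} \<and> odd i. entry t i)"

definition esum :: "nat list \<Rightarrow> nat" where
  "esum t = (\<Sum>i | i \<in> {1..length t} \<and> even i. entry t i)"

definition psum :: "nat list \<Rightarrow> nat \<Rightarrow> nat" where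
  "psum t k = (\<Sum>i = 1..k. entry t i)"


section \<open>Quartered hexagons with dents\<close>

definition quartered_hexagon :: "nat list \<Rightarrow> region" where
  "quartered_hexagon t =
     cells {(u, k). 0 \<le> k \<and> k \<le> int (2 * esum t) \<and> zigzag k \<le> u
                    \<and> u \<le> real (osum t + esum t) - of_int k / 2}
     - (\<Union>i \<in> {1..length t div 2}. up_triangle (psum t (2 * i - 1)) (entry t (2 * i)))"

definition Q :: "nat list \<Rightarrow> nat" where
  "Q t = M (quartered_hexagon t)"

definition tplus :: "nat \<Rightarrow> nat \<Rightarrow> nat list \<Rightarrow> nat list \<Rightarrow> nat list" where
  "tplus x y as bs =
     (let \<mu> = 2 * ((len as + 1) div 2); \<nu> = 2 * ((len bs + 1) div 2)
      in [0] @ map (entry as) [1..<\<mu>] @ [entry as \<mu> + x + y + entry bs \<nu>]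
         @ map (entry bs) (rev [1..<\<nu>]))"

text \<open>For a natural number \<open>m\<close>, the ceiling of \<open>(m - 1) / 2\<close> is \<open>m div 2\<close>.\<close>

definition tminus :: "nat \<Rightarrow> nat \<Rightarrow> nat \<Rightarrow> nat list \<Rightarrow> nat list \<Rightarrow> nat list" where
  "tminus x y z as bs =
     (let \<mu>' = 2 * (len as div 2); \<nu>' = 2 * (len bs div 2)
      in map (entry as) [1..<\<mu>' + 1] @ [entry as (\<mu>' + 1) + x + y + entry bs (\<nu>' + 1)]
         @ map (entry bs) (rev [1..<\<nu>' + 1]) @ [z])"


section \<open>The halved hexagons with an array of triangles removed\<close>

context
  fixes x y z :: nat and as bs :: "nat list"
begin

definition base_length :: nat where
  "base_length = x + y + sum_list as + sum_list bs"

definition upper_height :: nat where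
  "upper_height = 2 * (y + osum as + osum bs)"

definition lower_height :: nat where
  "lower_height = 2 * (y + z + esum as + esum bs)"

definition upper_part :: region where
  "upper_part =
     cells {(u, k). 0 \<le> k \<and> k \<le> int upper_height \<and> zigzag k \<le> u
                    \<and> u \<le> real base_length - of_int k / 2}"

text \<open>
  The two upper bounds on \<open>u\<close> are the lines carrying the east sides that leave \<open>[base_length;0]\<close>
  and \<open>[base_length + z/2; -z]\<close> downwards.
\<close>

definition lower_part :: region where
  "lower_part =
     cells {(u, k). - int lower_height \<le> k \<and> k \<le> 0 \<and> zigzag k \<le> u
                    \<and> u \<le> real base_length - of_int k / 2
                    \<and> u \<le> real base_length + real z + of_int k / 2}"

definition left_dent :: region where
  "left_dent = cells {(u, k). 0 \<le> k \<and> u \<le> real (entry as 1) - of_int k / 2}"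

definition a_dents :: region where
  "a_dents = (\<Union>i \<in> {2..length as}.
     (if even i then down_triangle else up_triangle) (psum as (i - 1)) (entry as i))"

definition b_dents :: region where
  "b_dents = (\<Union>j \<in> {1..length bs}.
     (if odd j then up_triangle else down_triangle) (base_length - psum bs j) (entry bs j))"

definition H1_region :: region where
  "H1_region = (upper_part \<union> lower_part) - (left_dent \<union> a_dents \<union> b_dents)"

end


section \<open>Product functions\<close>

definition H :: "nat \<Rightarrow> real" where
  "H n = (\<Prod>i<n. fact i)"

definition H2 :: "nat \<Rightarrow> real" where
  "H2 n = (\<Prod>i = 1..n div 2. fact (n - 2 * i))"

text \<open>The symbol \<open>(x)\<^sub>n\<close> is \<^const>\<open>pochhammer\<close>; \<open>skip_pochhammer x n\<close> is \<open>[x]\<^sub>n = x (x+2) \<dots> (x+2n-2)\<close>.\<close>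

definition skip_pochhammer :: "real \<Rightarrow> nat \<Rightarrow> real" where
  "skip_pochhammer x n = (\<Prod>i<n. x + 2 * real i)"

text \<open>
  In \<open>T x n m\<close> and \<open>V x n m\<close> the truncated subtraction \<open>n - 2 * i\<close> is exact as soon as
  \<open>2 * (m - 1) \<le> n\<close>.
\<close>

definition T :: "real \<Rightarrow> nat \<Rightarrow> nat \<Rightarrow> real" where
  "T x n m = (\<Prod>i<m. pochhammer (x + real i) (n - 2 * i))"

definition V :: "real \<Rightarrow> nat \<Rightarrow> nat \<Rightarrow> real" where
  "V x n m = (\<Prod>i<m. skip_pochhammer (x + 2 * real i) (n - 2 * i))"

end

theory Submission
  imports Defs "Jordan_Normal_Form.Determinant"
begin

text \<open>
  Cut the region along the line \<open>k = 0\<close>.  The vertical lozenges crossing it occupy a \<open>y\<close>-element set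
  \<open>S\<close> of positions between the two arrays of dents, and for given \<open>S\<close> the two halves are quartered
  hexagons with dents \<open>A \<union> S\<close> and \<open>B \<union> S\<close>.  Slicing a quartered hexagon into horizontal strips gives
  interlacing sequences of sets of positions, which are counted by determinants of binomial
  coefficients, so that a quartered hexagon with dents \<open>X\<close> has as many tilings as the dimension of
  a representation of a symplectic group,
  namely the product of all \<open>x + 1\<close> with \<open>x \<in> X\<close> and of all \<open>(x + 1)\<^sup>2 - (y + 1)\<^sup>2\<close> with \<open>x, y \<in> X\<close>
  and \<open>y < x\<close>, divided by \<open>1! * 3! * \<dots> * (2 * card X - 1)!\<close>.

  In the sum over \<open>S\<close> the arrays enter only through \<open>A \<union> B\<close>, which consists of the two intervals to the
  left and to the right of the free positions.  Hence the sum is a discrete Selberg integral for the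
  weight of the Racah polynomials.  By Cauchy-Binet it is a determinant of moments; taken in
  suitable bases the moments are products, and the determinant is found by eliminating with
  alternating binomial sums.  It depends on \<open>x\<close> exactly as the factor \<open>T V\<close> does, and for \<open>x = 0\<close> the sum
  has a single term.
\<close>

section \<open>Splitting tilings\<close>

lemma finite_tilings: "finite R \<Longrightarrow> finite (tilings R)"
  by (rule finite_subset[of _ "Pow (Pow R)"]) (auto simp: tilings_def partition_on_def)

lemma M_empty [simp]: "M {} = 1"
proof -
  have "tilings {} = {{}}"
    by (auto simp: tilings_def partition_on_empty)
  then show ?thesis by (simp add: M_def)
qed

lemma tilingsD:
  assumes "P \<in> tilings R"
  shows "\<Union>P = R" "\<And>p q. p \<in> P \<Longrightarrow> q \<in> P \<Longrightarrow> p \<noteq> q \<Longrightarrow> p \<inter> q = {}" "P \<subseteq> lozenges"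
  using assms by (auto simp: tilings_def partition_on_def disjoint_def)

lemma lozenge_nonempty: "p \<in> lozenges \<Longrightarrow> p \<noteq> {}"
  by (auto simp: lozenges_def)

lemma tilingsI:
  assumes "\<Union>P = R" "\<And>p q. p \<in> P \<Longrightarrow> q \<in> P \<Longrightarrow> p \<noteq> q \<Longrightarrow> p \<inter> q = {}" "P \<subseteq> lozenges"
  shows "P \<in> tilings R"
proof -
  have "{} \<notin> P" using assms(3) lozenge_nonempty by blast
  then show ?thesis using assms by (simp add: tilings_def partition_on_def disjoint_def)
qed

lemma lozengeE:
  assumes "p \<in> lozenges"
  obtains s t where "p = {s, t}"
  using assms by (auto simp: lozenges_def)

lemma M_split:
  assumes fin: "finite R1" "finite R2" and dj: "R1 \<inter> R2 = {}" and I: "finite I"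
    and inj: "inj_on f I" "inj_on g I" and sub: "f ` I \<subseteq> R1" "g ` I \<subseteq> R2"
    and cross: "\<And>s t. s \<in> R1 \<Longrightarrow> t \<in> R2 \<Longrightarrow> {s, t} \<in> lozenges \<longleftrightarrow> (\<exists>i\<in>I. s = f i \<and> t = g i)"
  shows "M (R1 \<union> R2) = (\<Sum>S\<in>Pow I. M (R1 - f ` S) * M (R2 - g ` S))"
proof -
  define L where "L i = {f i, g i}" for i
  define sel where "sel P = {i \<in> I. L i \<in> P}" for P
  have LI: "L i \<in> lozenges" if "i \<in> I" for i
    using cross[of "f i" "g i"] sub that by (auto simp: L_def)
  have fR2: "f i \<notin> R2" and gR1: "g i \<notin> R1" if "i \<in> I" for i
    using that sub dj by auto
  have fib: "card {P \<in> tilings (R1 \<union> R2). sel P = S} = M (R1 - f ` S) * M (R2 - g ` S)"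
    if S: "S \<subseteq> I" for S
  proof -
    define d where "d P = ({p\<in>P. p \<subseteq> R1}, {p\<in>P. p \<subseteq> R2})" for P
    define c where "c Q = fst Q \<union> snd Q \<union> L ` S" for Q
    have "bij_betw d {P \<in> tilings (R1 \<union> R2). sel P = S}
            (tilings (R1 - f ` S) \<times> tilings (R2 - g ` S))"
    proof (rule bij_betw_byWitness[where f' = c])
      have kind: "p \<subseteq> R1 \<or> p \<subseteq> R2 \<or> p \<in> L ` S"
        if P: "P \<in> tilings (R1 \<union> R2)" "sel P = S" and p: "p \<in> P" for P p
      proof -
        obtain s t where st: "p = {s, t}"
          using tilingsD(3)[OF P(1)] p lozengeE by blast
        have mem: "s \<in> R1 \<union> R2" "t \<in> R1 \<union> R2"
          using tilingsD(1)[OF P(1)] p st by auto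
        have loz: "{s, t} \<in> lozenges" "{t, s} \<in> lozenges"
          using tilingsD(3)[OF P(1)] p st by (auto simp: insert_commute)
        have *: "p \<in> L ` S" if "i \<in> I" "p = L i" for i
          using that P p by (auto simp: sel_def)
        show ?thesis
        proof (cases "s \<in> R1 \<longleftrightarrow> t \<in> R1")
          case True then show ?thesis using mem st dj by auto
        next
          case False
          then show ?thesis using mem loz cross[of s t] cross[of t s] * st
            by (auto simp: L_def insert_commute)
        qed
      qed
      have Sin: "L i \<in> P" if "sel P = S" "i \<in> S" for P i
        using that by (auto simp: sel_def)
      show "\<forall>P\<in>{P \<in> tilings (R1 \<union> R2). sel P = S}. c (d P) = P"
      proof safe
        fix P p assume P: "P \<in> tilings (R1 \<union> R2)" "S = sel P" and "p \<in> c (d P)"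
        then show "p \<in> P" 
          using Sin[OF P(2)[symmetric]] P(2) unfolding c_def d_def by auto
      next
        fix P p assume P: "P \<in> tilings (R1 \<union> R2)" "S = sel P" and "p \<in> P"
        then show "p \<in> c (d P)"
          using kind[OF P(1) P(2)[symmetric]] P(2) unfolding c_def d_def by auto
      qed
      show "d ` {P \<in> tilings (R1 \<union> R2). sel P = S} \<subseteq> tilings (R1 - f ` S) \<times> tilings (R2 - g ` S)"
      proof (rule image_subsetI)
        fix P assume "P \<in> {P \<in> tilings (R1 \<union> R2). sel P = S}"
        then have P: "P \<in> tilings (R1 \<union> R2)" and s: "S = sel P" by auto
        note t = tilingsD[OF P]
        have ne: "p \<noteq> {}" if "p \<in> P" for p using t(3) lozenge_nonempty that by auto
        have noS: "p = L i" if "p \<in> P" "i \<in> S" "f i \<in> p \<or> g i \<in> p" for p i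
          using t(2)[of p "L i"] that Sin[OF s[symmetric] that(2)] by (auto simp: L_def)
        have a1: "\<Union>{p\<in>P. p \<subseteq> R1} = R1 - f ` S"
        proof safe
          fix p v assume "p \<in> P" "v \<in> p" "p \<subseteq> R1" then show "v \<in> R1" by auto
        next
          fix p i assume "p \<in> P" "f i \<in> p" "p \<subseteq> R1" "i \<in> S"
          then show False using noS[of p i] gR1[of i] S by (auto simp: L_def)
        next
          fix v assume v: "v \<in> R1" "v \<notin> f ` S"
          then obtain p where p: "p \<in> P" "v \<in> p" using t(1) by auto
          with kind[OF P s[symmetric] p(1)] v dj gR1 S have "p \<subseteq> R1" by (auto simp: L_def)
          then show "v \<in> \<Union>{p\<in>P. p \<subseteq> R1}" using p by auto
        qed
        have a2: "\<Union>{p\<in>P. p \<subseteq> R2} = R2 - g ` S"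
        proof safe
          fix p v assume "p \<in> P" "v \<in> p" "p \<subseteq> R2" then show "v \<in> R2" by auto
        next
          fix p i assume "p \<in> P" "g i \<in> p" "p \<subseteq> R2" "i \<in> S"
          then show False using noS[of p i] fR2[of i] S by (auto simp: L_def)
        next
          fix v assume v: "v \<in> R2" "v \<notin> g ` S"
          then obtain p where p: "p \<in> P" "v \<in> p" using t(1) by auto
          with kind[OF P s[symmetric] p(1)] v dj fR2 S have "p \<subseteq> R2" by (auto simp: L_def)
          then show "v \<in> \<Union>{p\<in>P. p \<subseteq> R2}" using p by auto
        qed
        have "{p\<in>P. p \<subseteq> R1} \<in> tilings (R1 - f ` S)"
          by (rule tilingsI[OF a1]) (use t(2,3) in blast)+
        moreover have "{p\<in>P. p \<subseteq> R2} \<in> tilings (R2 - g ` S)"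
          by (rule tilingsI[OF a2]) (use t(2,3) in blast)+
        ultimately show "d P \<in> tilings (R1 - f ` S) \<times> tilings (R2 - g ` S)"
          by (simp add: d_def)
      qed
      have key: "c (P1, P2) \<in> tilings (R1 \<union> R2) \<and> sel (c (P1, P2)) = S \<and> d (c (P1, P2)) = (P1, P2)"
        if P1: "P1 \<in> tilings (R1 - f ` S)" and P2: "P2 \<in> tilings (R2 - g ` S)" for P1 P2
      proof (intro conjI)
        note t1 = tilingsD[OF P1] and t2 = tilingsD[OF P2]
        have s1: "p \<subseteq> R1 - f ` S" if "p \<in> P1" for p using t1(1) that by auto
        have s2: "p \<subseteq> R2 - g ` S" if "p \<in> P2" for p using t2(1) that by auto
        have n1: "p \<noteq> {}" if "p \<in> P1" for p using t1(3) lozenge_nonempty that by auto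
        have n2: "p \<noteq> {}" if "p \<in> P2" for p using t2(3) lozenge_nonempty that by auto
        have fS: "f i \<in> R1" "g i \<in> R2" if "i \<in> S" for i using sub S that by blast+
        have u: "\<Union>(c (P1, P2)) = R1 \<union> R2"
          using t1(1) t2(1) fS by (auto simp: c_def L_def)
        have e1: "p \<inter> L i = {}" if "p \<in> P1" "i \<in> S" for p i
          using s1[OF that(1)] fS[OF that(2)] that(2) dj by (auto simp: L_def)
        have e2: "p \<inter> L i = {}" if "p \<in> P2" "i \<in> S" for p i
          using s2[OF that(1)] fS[OF that(2)] that(2) dj by (auto simp: L_def)
        have e3: "p \<inter> q = {}" "q \<inter> p = {}" if "p \<in> P1" "q \<in> P2" for p q
          using s1[OF that(1)] s2[OF that(2)] dj by auto
        have e4: "L i \<inter> L j = {}" if "i \<in> S" "j \<in> S" "i \<noteq> j" for i j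
        proof -
          have "i \<in> I" "j \<in> I" using that S by auto
          then have "f i \<noteq> f j" "g i \<noteq> g j" using inj that(3) by (auto dest: inj_onD)
          then show ?thesis using fS[OF that(1)] fS[OF that(2)] dj by (auto simp: L_def)
        qed
        have dis: "p \<inter> q = {}" if "p \<in> c (P1, P2)" "q \<in> c (P1, P2)" "p \<noteq> q" for p q
        proof -
          have pq: "p \<in> P1 \<or> p \<in> P2 \<or> (\<exists>i\<in>S. p = L i)" "q \<in> P1 \<or> q \<in> P2 \<or> (\<exists>i\<in>S. q = L i)"
            using that by (auto simp: c_def)
          show ?thesis
          proof (cases "p \<in> P1 \<or> p \<in> P2")
            case True
            then show ?thesis
              using pq(2) that(3) t1(2) t2(2) e1 e2 e3 by (elim disjE bexE) simp_all
          next
            case False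
            then obtain i where i: "i \<in> S" "p = L i" using pq(1) by blast
            consider "q \<in> P1" | "q \<in> P2" | j where "j \<in> S" "q = L j" using pq(2) by blast
            then show ?thesis
              using i that(3) e1[of q i] e2[of q i] e4[of i] by cases (auto simp: Int_commute)
          qed
        qed
        show "c (P1, P2) \<in> tilings (R1 \<union> R2)"
          by (rule tilingsI[OF u dis]) (use t1(3) t2(3) LI S in \<open>auto simp: c_def\<close>)
        have "i \<in> S" if i: "i \<in> I" "L i \<in> c (P1, P2)" for i
        proof -
          have "L i \<notin> P1" "L i \<notin> P2" using s1 s2 fR2[OF i(1)] gR1[OF i(1)] by (auto simp: L_def)
          then obtain j where "j \<in> S" "L i = L j" using i by (auto simp: c_def)
          moreover from this have "f i = f j" using fS[of j] fR2[of i] gR1[of i] i(1) by (auto simp: L_def doubleton_eq_iff)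
          ultimately show ?thesis using inj(1) i(1) S by (metis inj_onD subsetD)
        qed
        then show "sel (c (P1, P2)) = S" using S by (auto simp: sel_def c_def)
        have "\<not> L i \<subseteq> R1" "\<not> L i \<subseteq> R2" if "i \<in> S" for i
          using that fR2 gR1 S by (auto simp: L_def)
        moreover have "\<not> p \<subseteq> R2" if "p \<in> P1" for p using s1[OF that] n1[OF that] dj by blast
        moreover have "\<not> p \<subseteq> R1" if "p \<in> P2" for p using s2[OF that] n2[OF that] dj by blast
        moreover have "p \<subseteq> R1" if "p \<in> P1" for p using s1[OF that] by blast
        moreover have "p \<subseteq> R2" if "p \<in> P2" for p using s2[OF that] by blast
        ultimately have "{p \<in> P1 \<union> P2 \<union> L ` S. p \<subseteq> R1} = P1" "{p \<in> P1 \<union> P2 \<union> L ` S. p \<subseteq> R2} = P2"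
          by blast+
        then show "d (c (P1, P2)) = (P1, P2)" by (simp add: d_def c_def)
      qed
      show "\<forall>Q\<in>tilings (R1 - f ` S) \<times> tilings (R2 - g ` S). d (c Q) = Q"
        using key by auto
      show "c ` (tilings (R1 - f ` S) \<times> tilings (R2 - g ` S)) \<subseteq> {P \<in> tilings (R1 \<union> R2). sel P = S}"
        using key by auto
    qed
    from bij_betw_same_card[OF this] show ?thesis by (simp add: M_def card_cartesian_product)
  qed
  have "M (R1 \<union> R2) = card (\<Union>S\<in>Pow I. {P \<in> tilings (R1 \<union> R2). sel P = S})"
  proof -
    have "sel P \<in> Pow I" for P by (simp add: sel_def)
    then have "tilings (R1 \<union> R2) = (\<Union>S\<in>Pow I. {P \<in> tilings (R1 \<union> R2). sel P = S})" by blast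
    then show ?thesis unfolding M_def by (rule arg_cong)
  qed
  also have "\<dots> = (\<Sum>S\<in>Pow I. card {P \<in> tilings (R1 \<union> R2). sel P = S})"
    using I fin finite_tilings[of "R1 \<union> R2"] by (intro card_UN_disjoint) auto
  also have "\<dots> = (\<Sum>S\<in>Pow I. M (R1 - f ` S) * M (R2 - g ` S))"
    using fib by (intro sum.cong) auto
  finally show ?thesis .
qed

lemma lozenge_neq: "{s, t} \<in> lozenges \<Longrightarrow> s \<noteq> t"
proof
  assume "{s, t} \<in> lozenges" "s = t"
  then obtain u v where "{s} = {u, v}" "u \<in> unit_triangles" "card (u \<inter> v) = 2"
    by (auto simp: lozenges_def)
  then have "u \<in> unit_triangles" "card u = 2" by (auto simp: doubleton_eq_iff singleton_insert_inj_eq)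
  then show False by (auto simp: unit_triangles_def up_unit_def down_unit_def)
qed

lemma M_single: "M {t} = 0"
proof -
  have "P \<notin> tilings {t}" for P
  proof
    assume P: "P \<in> tilings {t}"
    note d = tilingsD[OF P]
    obtain p where p: "p \<in> P" "t \<in> p" using d(1) by auto
    then have "p = {t}" using d(1) by auto
    moreover have "p \<in> lozenges" using p d by auto
    ultimately show False using lozenge_neq[of t t] by simp
  qed
  then have "tilings {t} = {}" by blast
  then show ?thesis by (simp add: M_def)
qed

lemma M_isolated:
  assumes "finite R" "t \<in> R" "\<And>s. s \<in> R \<Longrightarrow> {t, s} \<notin> lozenges"
  shows "M R = 0"
proof -
  have "M ({t} \<union> (R - {t})) = (\<Sum>S\<in>Pow {}. M ({t} - (\<lambda>_. t) ` S) * M (R - {t} - (\<lambda>_. t) ` S))"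
    using assms by (intro M_split) auto
  then show ?thesis using assms by (simp add: M_single insert_absorb)
qed

lemma M_leaf:
  assumes "finite R" "t \<in> R" "t' \<in> R" "{t, t'} \<in> lozenges"
    and "\<And>s. s \<in> R \<Longrightarrow> {t, s} \<in> lozenges \<Longrightarrow> s = t'"
  shows "M R = M (R - {t, t'})"
proof -
  have ne: "t \<noteq> t'" using assms(4) lozenge_neq by blast
  have "M ({t} \<union> (R - {t})) = (\<Sum>S\<in>Pow {()}. M ({t} - (\<lambda>_. t) ` S) * M (R - {t} - (\<lambda>_. t') ` S))"
  proof (rule M_split)
    fix s u assume "s \<in> {t}" "u \<in> R - {t}"
    then show "{s, u} \<in> lozenges \<longleftrightarrow> (\<exists>i\<in>{()}. s = t \<and> u = t')"
      using assms(4) assms(5)[of u] by blast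
  qed (use assms(1,3) ne in simp_all)
  also have "\<dots> = M (R - {t, t'})"
  proof -
    have "Pow {()} = {{}, {()}}" "R - {t} - {t'} = R - {t, t'}" by auto
    then show ?thesis by (simp add: M_single)
  qed
  also have "{t} \<union> (R - {t}) = R" using assms(2) by blast
  finally show ?thesis .
qed

lemma M_forced:
  assumes "finite R" and F: "\<And>P. P \<in> tilings R \<Longrightarrow> F \<subseteq> P"
    and FR: "\<Union>F \<subseteq> R" "F \<subseteq> lozenges" "\<And>p q. p \<in> F \<Longrightarrow> q \<in> F \<Longrightarrow> p \<noteq> q \<Longrightarrow> p \<inter> q = {}"
  shows "M R = M (R - \<Union>F)"
proof -
  have "bij_betw (\<lambda>P. P - F) (tilings R) (tilings (R - \<Union>F))"
  proof (rule bij_betw_byWitness[where f' = "\<lambda>P. P \<union> F"])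
    show "\<forall>P\<in>tilings R. P - F \<union> F = P" using F by blast
    show "(\<lambda>P. P - F) ` tilings R \<subseteq> tilings (R - \<Union> F)"
    proof (rule image_subsetI)
      fix P assume P: "P \<in> tilings R"
      note d = tilingsD[OF P]
      have "p \<inter> q = {}" if "p \<in> P - F" "q \<in> F" for p q using F[OF P] d(2)[of p q] that by blast
      then have "\<Union>(P - F) = R - \<Union>F" using d(1) by blast
      then show "P - F \<in> tilings (R - \<Union>F)" using d by (intro tilingsI) auto
    qed
    have ne: "p \<noteq> {}" if "p \<in> F" for p using FR(2) that lozenge_nonempty by auto
    have *: "P \<inter> F = {}" if "P \<in> tilings (R - \<Union>F)" for P
      using tilingsD(1)[OF that] ne by blast
    then show "\<forall>P\<in>tilings (R - \<Union>F). P \<union> F - F = P" by blast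
    show "(\<lambda>P. P \<union> F) ` tilings (R - \<Union> F) \<subseteq> tilings R"
    proof (rule image_subsetI)
      fix P assume P: "P \<in> tilings (R - \<Union>F)"
      note d = tilingsD[OF P]
      have x: "p \<inter> q = {}" "q \<inter> p = {}" if "p \<in> P" "q \<in> F" for p q using d(1) that by blast+
      show "P \<union> F \<in> tilings R"
      proof (rule tilingsI)
        show "\<Union>(P \<union> F) = R" using d(1) FR(1) by blast
        show "P \<union> F \<subseteq> lozenges" using d(3) FR(2) by blast
        show "p \<inter> q = {}" if "p \<in> P \<union> F" "q \<in> P \<union> F" "p \<noteq> q" for p q
          using that d(2) FR(3) x by (elim UnE) simp_all
      qed
    qed
  qed
  then show ?thesis unfolding M_def by (rule bij_betw_same_card)
qed

section \<open>Interlacing sets and determinants\<close>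

definition enum :: "nat set \<Rightarrow> nat \<Rightarrow> nat" where
  "enum X i = sorted_list_of_set X ! i"

lemma enum_less:
  assumes "i < j" "j < card X"
  shows "enum X i < enum X j"
  using sorted_wrt_nth_less[OF sorted_list_of_set.strict_sorted_key_list_of_set[of X] assms(1)] assms(2)
  by (simp add: enum_def)

lemma enum_image: "finite X \<Longrightarrow> enum X ` {0..<card X} = X"
  using nth_image[of "card X" "sorted_list_of_set X"] by (simp add: enum_def[abs_def])

lemma enum_le: "i \<le> j \<Longrightarrow> j < card X \<Longrightarrow> enum X i \<le> enum X j"
  using enum_less[of i j X] by (cases "i = j") auto

lemma enum_less_iff: "i < card X \<Longrightarrow> j < card X \<Longrightarrow> enum X i < enum X j \<longleftrightarrow> i < j"
  by (metis enum_less linorder_neqE_nat order_less_asym)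

lemma enum_inj: "inj_on (enum X) {0..<card X}"
  by (intro linorder_inj_onI) (auto dest: enum_less[of _ _ X])

lemma enum_bij: "finite X \<Longrightarrow> bij_betw (enum X) {0..<card X} X"
  by (simp add: bij_betw_def enum_inj enum_image)

lemma enum_unique:
  assumes "\<And>i j. i < j \<Longrightarrow> j < n \<Longrightarrow> f i < f j" "i < n"
  shows "enum (f ` {0..<n}) i = f i"
proof -
  have "sorted_wrt (<) (map f [0..<n])" using assms(1) by (simp add: sorted_wrt_iff_nth_less)
  then have "sorted_list_of_set (set (map f [0..<n])) = map f [0..<n]"
    using sorted_list_of_set.idem_if_sorted_distinct strict_sorted_iff by blast
  then show ?thesis using assms(2) by (simp add: enum_def)
qed

lemma enum_below:
  assumes "finite X" "i < card X"
  shows "{x \<in> X. x < enum X i} = enum X ` {0..<i}"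
proof -
  have "{x \<in> enum X ` {0..<card X}. x < enum X i} = enum X ` {0..<i}"
    using assms by (auto simp: enum_less_iff)
  then show ?thesis using enum_image[OF assms(1)] by simp
qed

lemma card_below:
  assumes "finite X"
  shows "{x \<in> X. x < e} = enum X ` {i \<in> {0..<card X}. enum X i < e}"
    and "card {x \<in> X. x < e} = card {i \<in> {0..<card X}. enum X i < e}"
proof -
  show *: "{x \<in> X. x < e} = enum X ` {i \<in> {0..<card X}. enum X i < e}"
  proof -
    have "{x \<in> enum X ` {0..<card X}. x < e} = enum X ` {i \<in> {0..<card X}. enum X i < e}" by blast
    then show ?thesis by (simp only: enum_image[OF assms])
  qed
  show "card {x \<in> X. x < e} = card {i \<in> {0..<card X}. enum X i < e}"
    unfolding * by (intro card_image inj_on_subset[OF enum_inj]) auto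
qed

definition interlace :: "nat set \<Rightarrow> nat set \<Rightarrow> bool" where
  "interlace X Y \<longleftrightarrow> finite Y \<and> card X = card Y \<and>
     (\<forall>y\<in>Y. card {x \<in> X. x < y} = card {y' \<in> Y. y' < y})"

definition gap :: "nat set \<Rightarrow> nat \<Rightarrow> nat set" where
  "gap X i = {(if i = 0 then 0 else Suc (enum X (i - 1)))..enum X i}"

lemma interlace_gap:
  assumes X: "finite X" and n: "n = card X"
  shows gap_enum: "\<And>f i. f \<in> PiE {0..<n} (gap X) \<Longrightarrow> i < n \<Longrightarrow> enum (f ` {0..<n}) i = f i"
    and gap_card: "\<And>f. f \<in> PiE {0..<n} (gap X) \<Longrightarrow> card (f ` {0..<n}) = n"
    and gap_bij: "bij_betw (\<lambda>f. f ` {0..<n}) (PiE {0..<n} (gap X)) {Y. interlace X Y}"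
proof -
  have mem: "f i \<le> enum X i" "0 < i \<Longrightarrow> enum X (i - 1) < f i"
    if "f \<in> PiE {0..<n} (gap X)" "i < n" for f i
    using PiE_mem[OF that(1), of i] that(2) by (auto simp: gap_def split: if_splits)
  have mono: "f i < f j" if f: "f \<in> PiE {0..<n} (gap X)" and ij: "i < j" "j < n" for f i j
  proof -
    have "f i \<le> enum X i" using mem(1)[OF f] ij by simp
    also have "\<dots> \<le> enum X (j - 1)"
      using enum_le[of i "j - 1" X] ij n by auto
    also have "\<dots> < f j" using mem(2)[OF f] ij by simp
    finally show ?thesis .
  qed
  show en: "enum (f ` {0..<n}) i = f i" if "f \<in> PiE {0..<n} (gap X)" "i < n" for f i
    using mono[OF that(1)] that(2) by (intro enum_unique) auto
  have injf: "inj_on f {0..<n}" if f: "f \<in> PiE {0..<n} (gap X)" for f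
  proof (rule linorder_inj_onI)
    fix i j assume "i < j" "i \<in> {0..<n}" "j \<in> {0..<n}"
    then show "f i \<noteq> f j" using mono[OF f, of i j] by simp
  qed auto
  show cf: "card (f ` {0..<n}) = n" if f: "f \<in> PiE {0..<n} (gap X)" for f
    using card_image[OF injf[OF f]] by simp
  show "bij_betw (\<lambda>f. f ` {0..<n}) (PiE {0..<n} (gap X)) {Y. interlace X Y}"
  proof (rule bij_betw_byWitness[where f' = "\<lambda>Y. restrict (enum Y) {0..<n}"])
    show "\<forall>f\<in>PiE {0..<n} (gap X). restrict (enum (f ` {0..<n})) {0..<n} = f"
    proof (intro ballI ext)
      fix f i assume f: "f \<in> PiE {0..<n} (gap X)"
      show "restrict (enum (f ` {0..<n})) {0..<n} i = f i"
        using en[OF f, of i] PiE_arb[OF f, of i] by (cases "i < n") simp_all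
    qed
    show "\<forall>Y\<in>{Y. interlace X Y}. restrict (enum Y) {0..<n} ` {0..<n} = Y"
    proof
      fix Y assume "Y \<in> {Y. interlace X Y}"
      then have "finite Y" "n = card Y" using n by (simp_all add: interlace_def)
      then show "restrict (enum Y) {0..<n} ` {0..<n} = Y" using enum_image[of Y] by simp
    qed
    show "(\<lambda>f. f ` {0..<n}) ` PiE {0..<n} (gap X) \<subseteq> {Y. interlace X Y}"
    proof (rule image_subsetI, rule CollectI)
      fix f assume f: "f \<in> PiE {0..<n} (gap X)"
      have "card {x \<in> X. x < f i} = card {y' \<in> f ` {0..<n}. y' < f i}" if i: "i < n" for i
      proof -
        have "f j < f i \<longleftrightarrow> j < i" if "j < n" for j
          using mono[OF f, of i j] mono[OF f, of j i] i that by (cases i j rule: linorder_cases) auto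
        then have "{y' \<in> f ` {0..<n}. y' < f i} = f ` {0..<i}" using i by auto
        moreover have "card (f ` {0..<i}) = i"
          using card_image[OF inj_on_subset[OF injf[OF f], of "{0..<i}"]] i by simp
        moreover have "enum X j < f i \<longleftrightarrow> j < i" if j: "j < n" for j
        proof (cases "j < i")
          case True
          then have "enum X j \<le> enum X (i - 1)"
            using enum_le[of j "i - 1" X] i n by auto
          then show ?thesis using mem(2)[OF f i] True by simp
        next
          case False
          then have "enum X i \<le> enum X j" using enum_le[of i j X] j n by auto
          then show ?thesis using mem(1)[OF f i] False by simp
        qed
        then have "{j \<in> {0..<n}. enum X j < f i} = {0..<i}" using i by auto
        then have "card {x \<in> X. x < f i} = i" using card_below(2)[OF X] n by simp
        ultimately show ?thesis by simp
      qed
      then show "interlace X (f ` {0..<n})" using cf[OF f] n by (auto simp: interlace_def)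
    qed
    show "(\<lambda>Y. restrict (enum Y) {0..<n}) ` {Y. interlace X Y} \<subseteq> PiE {0..<n} (gap X)"
    proof (rule image_subsetI)
      fix Y assume "Y \<in> {Y. interlace X Y}"
      then have Y: "finite Y" "card Y = n" "\<And>y. y \<in> Y \<Longrightarrow> card {x \<in> X. x < y} = card {y' \<in> Y. y' < y}"
        using n by (auto simp: interlace_def)
      have "enum Y i \<in> gap X i" if i: "i < n" for i
      proof -
        have "enum Y i \<in> Y" using enum_image[OF Y(1)] Y(2) i by auto
        then have "card {x \<in> X. x < enum Y i} = card (enum Y ` {0..<i})"
          using Y(3) enum_below[OF Y(1), of i] i Y(2) by simp
        also have "\<dots> = i"
          using card_image[OF inj_on_subset[OF enum_inj[of Y], of "{0..<i}"]] i Y(2) by simp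
        finally have c: "card {j \<in> {0..<n}. enum X j < enum Y i} = i"
          using card_below(2)[OF X] n by simp
        have "enum Y i \<le> enum X i"
        proof (rule ccontr)
          assume "\<not> enum Y i \<le> enum X i"
          have "{0..<Suc i} \<subseteq> {j \<in> {0..<n}. enum X j < enum Y i}"
          proof (rule subsetI)
            fix j assume "j \<in> {0..<Suc i}"
            then have "enum X j \<le> enum X i" "j < n" using enum_le[of j i X] i n by auto
            then show "j \<in> {j \<in> {0..<n}. enum X j < enum Y i}"
              using \<open>\<not> enum Y i \<le> enum X i\<close> by simp
          qed
          from card_mono[OF _ this] show False using c by simp
        qed
        moreover have "enum X (i - 1) < enum Y i" if "0 < i"
        proof (rule ccontr)
          assume "\<not> enum X (i - 1) < enum Y i"
          have "{j \<in> {0..<n}. enum X j < enum Y i} \<subseteq> {0..<i - 1}"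
          proof (rule subsetI)
            fix j assume j: "j \<in> {j \<in> {0..<n}. enum X j < enum Y i}"
            then have "\<not> i - 1 \<le> j"
              using enum_le[of "i - 1" j X] n \<open>\<not> enum X (i - 1) < enum Y i\<close> by auto
            then show "j \<in> {0..<i - 1}" by simp
          qed
          from card_mono[OF _ this] show False using c that by simp
        qed
        ultimately show ?thesis by (auto simp: gap_def)
      qed
      then show "restrict (enum Y) {0..<n} \<in> PiE {0..<n} (gap X)" by auto
    qed
  qed
qed

lemma det_Leibniz:
  "det (mat n n (\<lambda>(i, j). F i j)) = (\<Sum>p | p permutes {0..<n}. signof p * (\<Prod>i = 0..<n. F i (p i)))"
  by (subst det_def'[of _ n]) (auto intro!: sum.cong prod.cong simp: permutes_in_image)

lemma det_cong:
  assumes "\<And>i j. i < n \<Longrightarrow> j < n \<Longrightarrow> F i j = G i j"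
  shows "det (mat n n (\<lambda>(i, j). F i j)) = det (mat n n (\<lambda>(i, j). G i j))"
  using assms by (intro arg_cong[where f = det] eq_matI) auto

lemma det_rows_sum:
  fixes F :: "nat \<Rightarrow> nat \<Rightarrow> 'b \<Rightarrow> real"
  assumes "\<And>i. i < n \<Longrightarrow> finite (A i)"
  shows "det (mat n n (\<lambda>(i, j). \<Sum>y\<in>A i. F i j y))
    = (\<Sum>f\<in>PiE {0..<n} A. det (mat n n (\<lambda>(i, j). F i j (f i))))"
proof -
  have "(\<Prod>i = 0..<n. \<Sum>y\<in>A i. F i (p i) y) = (\<Sum>f\<in>PiE {0..<n} A. \<Prod>i = 0..<n. F i (p i) (f i))" for p
    using assms by (intro prod_sum_PiE) auto
  then show ?thesis
    unfolding det_Leibniz by (simp add: sum_distrib_left sum.swap[of _ "{p. p permutes {0..<n}}"])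
qed

lemma det_scale:
  fixes F :: "nat \<Rightarrow> nat \<Rightarrow> real"
  shows "det (mat n n (\<lambda>(i, j). a i * b j * F i j))
    = (\<Prod>i = 0..<n. a i) * (\<Prod>j = 0..<n. b j) * det (mat n n (\<lambda>(i, j). F i j))"
proof -
  have "(\<Prod>i = 0..<n. b (p i)) = (\<Prod>j = 0..<n. b j)" if "p permutes {0..<n}" for p
    using prod.permute[OF that, of b] by (simp add: o_def)
  then show ?thesis
    unfolding det_Leibniz sum_distrib_left
    by (intro sum.cong) (auto simp: prod.distrib)
qed

lemma det_row_differences:
  fixes F :: "nat \<Rightarrow> nat \<Rightarrow> real"
  shows "det (mat n n (\<lambda>(i, j). if i = 0 then F i j else F i j - F (i - 1) j))
    = det (mat n n (\<lambda>(i, j). F i j))"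
proof -
  define L where "L = mat n n (\<lambda>(i, k). if k = i then 1 else if Suc k = i then -1 else (0::real))"
  have 1: "det L = 1"
  proof -
    have "det L = prod_list (diag_mat L)"
      by (rule det_lower_triangular[of n]) (auto simp: L_def)
    also have "diag_mat L = map (\<lambda>i. 1) [0..<n]" by (auto simp: diag_mat_def L_def)
    finally show ?thesis by (simp add: map_replicate_const)
  qed
  have "mat n n (\<lambda>(i, j). if i = 0 then F i j else F i j - F (i - 1) j) = L * mat n n (\<lambda>(i, j). F i j)"
  proof (rule eq_matI)
    fix i j assume ij: "i < dim_row (L * mat n n (\<lambda>(i, j). F i j))" "j < dim_col (L * mat n n (\<lambda>(i, j). F i j))"
    then have ij: "i < n" "j < n" by (auto simp: L_def)
    have "(L * mat n n (\<lambda>(i, j). F i j)) $$ (i, j)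
        = (\<Sum>k = 0..<n. (if k = i then 1 else if Suc k = i then -1 else 0) * F k j)"
      using ij by (simp add: L_def scalar_prod_def)
    also have "\<dots> = (\<Sum>k = 0..<n. (if k = i then F k j else 0) - (if Suc k = i then F k j else 0))"
      by (intro sum.cong) auto
    also have "\<dots> = F i j - (if i = 0 then 0 else F (i - 1) j)"
    proof (cases i)
      case (Suc i')
      then show ?thesis using ij by (simp add: sum_subtractf sum.delta')
    qed (use ij in \<open>simp add: sum_subtractf sum.delta'\<close>)
    finally show "mat n n (\<lambda>(i, j). if i = 0 then F i j else F i j - F (i - 1) j) $$ (i, j)
        = (L * mat n n (\<lambda>(i, j). F i j)) $$ (i, j)"
      using ij by simp
  qed (auto simp: L_def)
  then show ?thesis using 1 det_mult[of L n "mat n n (\<lambda>(i, j). F i j)"] by (simp add: L_def)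
qed

definition detS :: "(nat \<Rightarrow> nat \<Rightarrow> real) \<Rightarrow> nat set \<Rightarrow> real" where
  "detS r X = det (mat (card X) (card X) (\<lambda>(i, j). r j (enum X i)))"

lemma detS_cong:
  assumes "finite X" "\<And>j x. j < card X \<Longrightarrow> x \<in> X \<Longrightarrow> r j x = r' j x"
  shows "detS r X = detS r' X"
proof -
  have "enum X i \<in> X" if "i < card X" for i using enum_image[OF assms(1)] that by auto
  then show ?thesis unfolding detS_def by (intro det_cong) (simp add: assms(2))
qed

lemma sum_interlace_detS:
  assumes X: "finite X"
  shows "(\<Sum>Y | interlace X Y. detS r Y) = detS (\<lambda>j x. \<Sum>y\<le>x. r j y) X"
proof -
  define n where "n = card X"
  define R where "R j x = (\<Sum>y\<le>x. r j y)" for j x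
  have "(\<Sum>Y | interlace X Y. detS r Y) = (\<Sum>f\<in>PiE {0..<n} (gap X). detS r (f ` {0..<n}))"
    by (rule sum.reindex_bij_betw[OF gap_bij[OF X n_def], symmetric])
  also have "\<dots> = (\<Sum>f\<in>PiE {0..<n} (gap X). det (mat n n (\<lambda>(i, j). r j (f i))))"
  proof (intro sum.cong refl)
    fix f assume f: "f \<in> PiE {0..<n} (gap X)"
    show "detS r (f ` {0..<n}) = det (mat n n (\<lambda>(i, j). r j (f i)))"
      unfolding detS_def gap_card[OF X n_def f] by (intro det_cong) (simp add: gap_enum[OF X n_def f])
  qed
  also have "\<dots> = det (mat n n (\<lambda>(i, j). \<Sum>y\<in>gap X i. r j y))"
    by (rule det_rows_sum[symmetric]) (simp add: gap_def)
  also have "\<dots> = det (mat n n (\<lambda>(i, j). if i = 0 then R j (enum X i) else R j (enum X i) - R j (enum X (i - 1))))"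
  proof (rule det_cong)
    fix i j assume "i < n"
    show "(\<Sum>y\<in>gap X i. r j y) = (if i = 0 then R j (enum X i) else R j (enum X i) - R j (enum X (i - 1)))"
    proof (cases "i = 0")
      case True then show ?thesis by (simp add: gap_def R_def atLeast0AtMost)
    next
      case False
      then have l: "enum X (i - 1) < enum X i" using enum_less[of "i - 1" i X] \<open>i < n\<close> n_def by simp
      then have "{..enum X i} = {..enum X (i - 1)} \<union> gap X i" "{..enum X (i - 1)} \<inter> gap X i = {}"
        using False by (auto simp: gap_def)
      then have "R j (enum X i) = R j (enum X (i - 1)) + (\<Sum>y\<in>gap X i. r j y)"
        unfolding R_def by (simp add: sum.union_disjoint gap_def)
      then show ?thesis using False by simp
    qed
  qed
  also have "\<dots> = det (mat n n (\<lambda>(i, j). R j (enum X i)))" by (rule det_row_differences)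
  finally show ?thesis by (simp add: detS_def n_def R_def)
qed

lemma newton_expansion:
  fixes \<alpha> t :: "nat \<Rightarrow> real"
  shows "\<exists>c. (\<forall>k>j. c k = 0) \<and> c j = 1 \<and>
    (\<forall>x. (\<Prod>r<j. x - \<alpha> r) = (\<Sum>k\<le>j. c k * (\<Prod>r<k. x - t r)))"
proof (induction j)
  case 0
  show ?case by (rule exI[of _ "\<lambda>k. if k = 0 then 1 else 0"]) auto
next
  case (Suc j)
  then obtain c where c: "\<And>k. k > j \<Longrightarrow> c k = 0" "c j = 1"
    "\<And>x. (\<Prod>r<j. x - \<alpha> r) = (\<Sum>k\<le>j. c k * (\<Prod>r<k. x - t r))" by blast
  define d where "d k = (if k = 0 then 0 else c (k - 1)) + (t k - \<alpha> j) * c k" for k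
  have "(\<Prod>r<Suc j. x - \<alpha> r) = (\<Sum>k\<le>Suc j. d k * (\<Prod>r<k. x - t r))" for x
  proof -
    define q where "q k = (\<Prod>r<k. x - t r)" for k
    have "(\<Sum>k\<le>Suc j. d k * q k)
      = (\<Sum>k\<le>Suc j. (if k = 0 then 0 else c (k - 1)) * q k) + (\<Sum>k\<le>Suc j. (t k - \<alpha> j) * c k * q k)"
      by (simp only: d_def distrib_right sum.distrib)
    also have "(\<Sum>k\<le>Suc j. (if k = 0 then 0 else c (k - 1)) * q k) = (\<Sum>k\<le>j. c k * q (Suc k))"
      by (subst sum.atMost_Suc_shift) simp
    also have "(\<Sum>k\<le>Suc j. (t k - \<alpha> j) * c k * q k) = (\<Sum>k\<le>j. (t k - \<alpha> j) * c k * q k)"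
      using c(1)[of "Suc j"] by simp
    also have "(\<Sum>k\<le>j. c k * q (Suc k)) + (\<Sum>k\<le>j. (t k - \<alpha> j) * c k * q k)
      = (\<Sum>k\<le>j. (x - \<alpha> j) * (c k * q k))"
      unfolding sum.distrib[symmetric] by (intro sum.cong refl) (simp add: q_def algebra_simps)
    also have "\<dots> = (\<Prod>r<Suc j. x - \<alpha> r)"
      using c(3)[of x] by (simp add: q_def sum_distrib_left mult.commute)
    finally show ?thesis by (simp add: q_def)
  qed
  moreover have "d (Suc j) = 1" "\<forall>k>Suc j. d k = 0" using c(1,2) by (auto simp: d_def)
  ultimately show ?case by blast
qed

lemma det_vandermonde:
  fixes \<alpha> t :: "nat \<Rightarrow> real"
  shows "det (mat n n (\<lambda>(i, j). \<Prod>r<j. t i - \<alpha> r)) = (\<Prod>i = 0..<n. \<Prod>k = 0..<i. t i - t k)"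
proof -
  obtain c where c: "\<And>j k. k > j \<Longrightarrow> c j k = 0" "\<And>j. c j j = 1"
    "\<And>j x. (\<Prod>r<j. x - \<alpha> r) = (\<Sum>k\<le>j. c j k * (\<Prod>r<k. x - t r))"
    using newton_expansion[of _ \<alpha> t] by metis
  define P where "P = mat n n (\<lambda>(i, k). \<Prod>r<k. t i - t r)"
  define C where "C = mat n n (\<lambda>(k, j). c j k)"
  have car: "P \<in> carrier_mat n n" "C \<in> carrier_mat n n" by (simp_all add: P_def C_def)
  have "mat n n (\<lambda>(i, j). \<Prod>r<j. t i - \<alpha> r) = P * C"
  proof (rule eq_matI)
    fix i j assume "i < dim_row (P * C)" "j < dim_col (P * C)"
    then have ij: "i < n" "j < n" using car by auto
    have "(P * C) $$ (i, j) = (\<Sum>k = 0..<n. (\<Prod>r<k. t i - t r) * c j k)"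
      using ij by (simp add: P_def C_def scalar_prod_def)
    also have "\<dots> = (\<Sum>k\<le>j. (\<Prod>r<k. t i - t r) * c j k)"
      using ij c(1) by (intro sum.mono_neutral_right) auto
    also have "\<dots> = (\<Prod>r<j. t i - \<alpha> r)" by (simp add: c(3) mult.commute)
    finally show "mat n n (\<lambda>(i, j). \<Prod>r<j. t i - \<alpha> r) $$ (i, j) = (P * C) $$ (i, j)"
      using ij by simp
  qed (use car in auto)
  moreover have "det C = 1"
  proof -
    have "upper_triangular C" by (auto simp: upper_triangular_def C_def c(1))
    then have "det C = prod_list (diag_mat C)" using car(2) by (rule det_upper_triangular)
    also have "diag_mat C = map (\<lambda>i. 1) [0..<n]" by (auto simp: diag_mat_def C_def c(2))
    finally show ?thesis by (simp add: map_replicate_const)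
  qed
  moreover have "det P = (\<Prod>i = 0..<n. \<Prod>k = 0..<i. t i - t k)"
  proof -
    have "det P = prod_list (diag_mat P)"
    proof (rule det_lower_triangular[OF _ car(1)])
      fix i j assume "i < j" "j < n"
      then show "P $$ (i, j) = 0" by (auto simp: P_def intro!: prod_zero bexI[of _ i])
    qed
    also have "diag_mat P = map (\<lambda>i. \<Prod>k = 0..<i. t i - t k) [0..<n]"
      by (auto simp: diag_mat_def P_def lessThan_atLeast0)
    finally show ?thesis
      using prod.distinct_set_conv_list[of "[0..<n]" "\<lambda>i. \<Prod>k = 0..<i. t i - t k"] by simp
  qed
  ultimately show ?thesis using det_mult[OF car] by simp
qed

definition vdm :: "(nat \<Rightarrow> real) \<Rightarrow> nat set \<Rightarrow> real" where
  "vdm u X = (\<Prod>x\<in>X. \<Prod>y\<in>{y \<in> X. y < x}. u x - u y)"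

lemma prod_enum:
  assumes "finite X"
  shows "(\<Prod>i = 0..<card X. g (enum X i)) = (\<Prod>x\<in>X. g x)"
  by (rule prod.reindex_bij_betw[OF enum_bij[OF assms]])

lemma detS_vandermonde:
  assumes X: "finite X"
  shows "detS (\<lambda>j x. \<Prod>r<j. u x - \<alpha> r) X = vdm u X"
proof -
  have "detS (\<lambda>j x. \<Prod>r<j. u x - \<alpha> r) X
      = (\<Prod>i = 0..<card X. \<Prod>k = 0..<i. u (enum X i) - u (enum X k))"
    unfolding detS_def by (rule det_vandermonde)
  also have "\<dots> = (\<Prod>i = 0..<card X. \<Prod>y\<in>{y \<in> X. y < enum X i}. u (enum X i) - u y)"
  proof (rule prod.cong[OF refl])
    fix i assume "i \<in> {0..<card X}"
    then have i: "i < card X" by simp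
    have "inj_on (enum X) {0..<i}" by (rule inj_on_subset[OF enum_inj[of X]]) (use i in auto)
    then show "(\<Prod>k = 0..<i. u (enum X i) - u (enum X k))
      = (\<Prod>y\<in>{y \<in> X. y < enum X i}. u (enum X i) - u y)"
      unfolding enum_below[OF X i] by (simp add: prod.reindex)
  qed
  also have "\<dots> = vdm u X" unfolding vdm_def by (rule prod_enum[OF X])
  finally show ?thesis .
qed

lemma detS_scale:
  assumes "finite X"
  shows "detS (\<lambda>j x. a x * b j * r j x) X = (\<Prod>x\<in>X. a x) * (\<Prod>j<card X. b j) * detS r X"
  unfolding detS_def
  by (subst det_scale) (simp add: prod_enum[OF assms] lessThan_atLeast0)

lemma det_rows_permuted:
  fixes F :: "nat \<Rightarrow> nat \<Rightarrow> real"
  assumes p: "p permutes {0..<n}"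
  shows "det (mat n n (\<lambda>(i, j). F (p i) j)) = signof p * det (mat n n (\<lambda>(i, j). F i j))"
proof -
  have "det (mat n n (\<lambda>(i, j). mat n n (\<lambda>(i, j). F i j) $$ (p i, j)))
      = signof p * det (mat n n (\<lambda>(i, j). F i j))"
    by (rule det_permute_rows[OF _ p]) simp
  moreover have "mat n n (\<lambda>(i, j). mat n n (\<lambda>(i, j). F i j) $$ (p i, j)) = mat n n (\<lambda>(i, j). F (p i) j)"
    using permutes_in_image[OF p] by (intro eq_matI) auto
  ultimately show ?thesis by simp
qed

lemma enumerations_permutes:
  assumes S: "finite S" "card S = n"
  shows "bij_betw (\<lambda>p. restrict (\<lambda>i. enum S (p i)) {0..<n}) {p. p permutes {0..<n}}
    {f \<in> PiE {0..<n} (\<lambda>_. S). f ` {0..<n} = S}"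
proof -
  define e where "e = inv_into {0..<n} (enum S)"
  have e: "e s < n" "enum S (e s) = s" if "s \<in> S" for s
    using inv_into_into[of s "enum S" "{0..<n}"] f_inv_into_f[of s "enum S" "{0..<n}"] that
      enum_image[OF S(1)] S(2) by (simp_all add: e_def)
  have ee: "e (enum S i) = i" if "i < n" for i
    using inv_into_f_f[of "enum S" "{0..<n}" i] enum_inj[of S] S(2) that by (simp add: e_def)
  have en: "enum S i \<in> S" if "i < n" for i using enum_image[OF S(1)] S(2) that by auto
  show ?thesis
  proof (rule bij_betw_byWitness[where f' = "\<lambda>f i. if i < n then e (f i) else i"])
    show "\<forall>p\<in>{p. p permutes {0..<n}}. (\<lambda>i. if i < n then e (restrict (\<lambda>i. enum S (p i)) {0..<n} i) else i) = p"
    proof (intro ballI ext)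
      fix p i assume "p \<in> {p. p permutes {0..<n}}"
      then have p: "p permutes {0..<n}" by simp
      show "(if i < n then e (restrict (\<lambda>i. enum S (p i)) {0..<n} i) else i) = p i"
        using ee[of "p i"] permutes_in_image[OF p, of i] permutes_not_in[OF p, of i]
        by (cases "i < n") simp_all
    qed
    show "\<forall>f\<in>{f \<in> PiE {0..<n} (\<lambda>_. S). f ` {0..<n} = S}.
       restrict (\<lambda>i. enum S (if i < n then e (f i) else i)) {0..<n} = f"
    proof (intro ballI ext)
      fix f i assume "f \<in> {f \<in> PiE {0..<n} (\<lambda>_. S). f ` {0..<n} = S}"
      then have f: "f \<in> PiE {0..<n} (\<lambda>_. S)" by simp
      show "restrict (\<lambda>i. enum S (if i < n then e (f i) else i)) {0..<n} i = f i"
        using e(2)[of "f i"] PiE_mem[OF f, of i] PiE_arb[OF f, of i] by (cases "i < n") simp_all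
    qed
    show "(\<lambda>p. restrict (\<lambda>i. enum S (p i)) {0..<n}) ` {p. p permutes {0..<n}}
        \<subseteq> {f \<in> PiE {0..<n} (\<lambda>_. S). f ` {0..<n} = S}"
    proof (rule image_subsetI)
      fix p assume "p \<in> {p. p permutes {0..<n}}"
      then have p: "p permutes {0..<n}" by simp
      have "restrict (\<lambda>i. enum S (p i)) {0..<n} ` {0..<n} = enum S ` p ` {0..<n}"
        by (simp add: image_image)
      also have "\<dots> = S" using permutes_image[OF p] enum_image[OF S(1)] S(2) by simp
      finally show "restrict (\<lambda>i. enum S (p i)) {0..<n} \<in> {f \<in> PiE {0..<n} (\<lambda>_. S). f ` {0..<n} = S}"
        using en permutes_in_image[OF p] by auto
    qed
    show "(\<lambda>f i. if i < n then e (f i) else i) ` {f \<in> PiE {0..<n} (\<lambda>_. S). f ` {0..<n} = S}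
       \<subseteq> {p. p permutes {0..<n}}"
    proof (rule image_subsetI, rule CollectI)
      fix f assume "f \<in> {f \<in> PiE {0..<n} (\<lambda>_. S). f ` {0..<n} = S}"
      then have f: "f \<in> PiE {0..<n} (\<lambda>_. S)" "f ` {0..<n} = S" by simp_all
      let ?p = "\<lambda>i. if i < n then e (f i) else i"
      have "?p ` {0..<n} = e ` f ` {0..<n}" by (simp add: image_image)
      also have "\<dots> = e ` enum S ` {0..<n}" using f(2) enum_image[OF S(1)] S(2) by simp
      also have "\<dots> = {0..<n}" using ee by (simp add: image_image)
      finally have im: "?p ` {0..<n} = {0..<n}" .
      then have "inj_on ?p {0..<n}" by (intro eq_card_imp_inj_on) simp_all
      with im have "bij_betw ?p {0..<n} {0..<n}" by (simp add: bij_betw_def)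
      then show "?p permutes {0..<n}" by (rule bij_imp_permutes) simp
    qed
  qed
qed

lemma cauchy_binet:
  assumes I: "finite I"
  shows "(\<Sum>S | S \<subseteq> I \<and> card S = n. (\<Prod>s\<in>S. w s) * detS \<phi> S * detS \<psi> S)
    = det (mat n n (\<lambda>(i, j). \<Sum>l\<in>I. w l * \<phi> i l * \<psi> j l))"
proof -
  define g where "g f = (\<Prod>i = 0..<n. w (f i) * \<phi> i (f i)) * det (mat n n (\<lambda>(i, j). \<psi> j (f i)))" for f
  have "det (mat n n (\<lambda>(i, j). \<Sum>l\<in>I. w l * \<phi> i l * \<psi> j l))
      = (\<Sum>f\<in>PiE {0..<n} (\<lambda>_. I). det (mat n n (\<lambda>(i, j). w (f i) * \<phi> i (f i) * \<psi> j (f i))))"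
    by (rule det_rows_sum) (rule I)
  also have "\<dots> = (\<Sum>f\<in>PiE {0..<n} (\<lambda>_. I). g f)"
    using det_scale[where b = "\<lambda>_. 1" and n = n] by (intro sum.cong refl) (simp add: g_def)
  also have "\<dots> = (\<Sum>f | f \<in> PiE {0..<n} (\<lambda>_. I) \<and> inj_on f {0..<n}. g f)"
  proof (rule sum.mono_neutral_right)
    show "\<forall>f\<in>PiE {0..<n} (\<lambda>_. I) - {f \<in> PiE {0..<n} (\<lambda>_. I). inj_on f {0..<n}}. g f = 0"
    proof
      fix f assume "f \<in> PiE {0..<n} (\<lambda>_. I) - {f \<in> PiE {0..<n} (\<lambda>_. I). inj_on f {0..<n}}"
      then obtain i j where ij: "i < n" "j < n" "i \<noteq> j" "f i = f j" by (auto simp: inj_on_def)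
      have "det (mat n n (\<lambda>(i, j). \<psi> j (f i))) = 0"
        using ij by (intro det_identical_rows[of _ n i j]) auto
      then show "g f = 0" by (simp add: g_def)
    qed
  qed (auto simp: I finite_PiE)
  also have "\<dots> = (\<Sum>S | S \<subseteq> I \<and> card S = n.
      \<Sum>f | f \<in> {f. f \<in> PiE {0..<n} (\<lambda>_. I) \<and> inj_on f {0..<n}} \<and> f ` {0..<n} = S. g f)"
    using I by (intro sum.group[symmetric])
      (auto simp: card_image finite_PiE intro: finite_subset[of _ "Pow I"])
  also have "\<dots> = (\<Sum>S | S \<subseteq> I \<and> card S = n. (\<Prod>s\<in>S. w s) * detS \<phi> S * detS \<psi> S)"
  proof (rule sum.cong[OF refl])
    fix S assume "S \<in> {S. S \<subseteq> I \<and> card S = n}"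
    then have S: "S \<subseteq> I" "card S = n" "finite S" using I finite_subset by auto
    have "{f. f \<in> {f. f \<in> PiE {0..<n} (\<lambda>_. I) \<and> inj_on f {0..<n}} \<and> f ` {0..<n} = S}
        = {f \<in> PiE {0..<n} (\<lambda>_. S). f ` {0..<n} = S}"
    proof (intro equalityI subsetI)
      fix f assume "f \<in> {f \<in> PiE {0..<n} (\<lambda>_. S). f ` {0..<n} = S}"
      then have f: "f \<in> PiE {0..<n} (\<lambda>_. S)" "f ` {0..<n} = S" by simp_all
      have "f \<in> PiE {0..<n} (\<lambda>_. I)"
        using f(1) PiE_mono[of "{0..<n}" "\<lambda>_. S" "\<lambda>_. I"] S(1) by blast
      moreover have "inj_on f {0..<n}" by (rule eq_card_imp_inj_on) (simp_all add: f(2) S(2))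
      ultimately show "f \<in> {f. f \<in> {f. f \<in> PiE {0..<n} (\<lambda>_. I) \<and> inj_on f {0..<n}} \<and> f ` {0..<n} = S}"
        using f(2) by simp
    next
      fix f assume "f \<in> {f. f \<in> {f. f \<in> PiE {0..<n} (\<lambda>_. I) \<and> inj_on f {0..<n}} \<and> f ` {0..<n} = S}"
      then have "f \<in> PiE {0..<n} (\<lambda>_. I)" "f ` {0..<n} = S" by simp_all
      then show "f \<in> {f \<in> PiE {0..<n} (\<lambda>_. S). f ` {0..<n} = S}"
        by (auto simp: PiE_iff)
    qed
    then have "(\<Sum>f | f \<in> {f. f \<in> PiE {0..<n} (\<lambda>_. I) \<and> inj_on f {0..<n}} \<and> f ` {0..<n} = S. g f)
        = (\<Sum>f | f \<in> PiE {0..<n} (\<lambda>_. S) \<and> f ` {0..<n} = S. g f)" by simp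
    also have "\<dots> = (\<Sum>p | p permutes {0..<n}. g (restrict (\<lambda>i. enum S (p i)) {0..<n}))"
      by (rule sum.reindex_bij_betw[OF enumerations_permutes[OF S(3,2)], symmetric])
    also have "\<dots> = (\<Sum>p | p permutes {0..<n}.
        (\<Prod>s\<in>S. w s) * (signof p * (\<Prod>i = 0..<n. \<phi> i (enum S (p i)))) * detS \<psi> S)"
    proof (rule sum.cong[OF refl])
      fix p assume "p \<in> {p. p permutes {0..<n}}"
      then have p: "p permutes {0..<n}" by simp
      have "det (mat n n (\<lambda>(i, j). \<psi> j (restrict (\<lambda>i. enum S (p i)) {0..<n} i)))
          = det (mat n n (\<lambda>(i, j). \<psi> j (enum S (p i))))"
        by (rule det_cong) simp
      also have "\<dots> = signof p * detS \<psi> S"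
        using det_rows_permuted[OF p, of "\<lambda>i j. \<psi> j (enum S i)"] by (simp add: detS_def S(2))
      finally have d: "det (mat n n (\<lambda>(i, j). \<psi> j (restrict (\<lambda>i. enum S (p i)) {0..<n} i)))
          = signof p * detS \<psi> S" .
      have "(\<Prod>i = 0..<n. w (enum S (p i))) = (\<Prod>i = 0..<n. w (enum S i))"
        using prod.permute[OF p, of "\<lambda>i. w (enum S i)"] by (simp add: o_def)
      also have "\<dots> = (\<Prod>s\<in>S. w s)" using prod_enum[OF S(3), of w] S(2) by simp
      finally show "g (restrict (\<lambda>i. enum S (p i)) {0..<n})
        = (\<Prod>s\<in>S. w s) * (signof p * (\<Prod>i = 0..<n. \<phi> i (enum S (p i)))) * detS \<psi> S"
        unfolding g_def d by (simp add: prod.distrib)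
    qed
    also have "\<dots> = (\<Prod>s\<in>S. w s) * det (mat n n (\<lambda>(i, j). \<phi> i (enum S j))) * detS \<psi> S"
      unfolding det_Leibniz by (simp add: sum_distrib_left sum_distrib_right)
    also have "det (mat n n (\<lambda>(i, j). \<phi> i (enum S j))) = detS \<phi> S"
    proof -
      have "detS \<phi> S = det (transpose_mat (mat n n (\<lambda>(i, j). \<phi> j (enum S i))))"
        unfolding detS_def S(2) by (rule det_transpose[symmetric, where n = n]) simp
      also have "transpose_mat (mat n n (\<lambda>(i, j). \<phi> j (enum S i))) = mat n n (\<lambda>(i, j). \<phi> i (enum S j))"
        by (rule eq_matI) auto
      finally show ?thesis by simp
    qed
    finally show "(\<Sum>f | f \<in> {f. f \<in> PiE {0..<n} (\<lambda>_. I) \<and> inj_on f {0..<n}} \<and> f ` {0..<n} = S. g f)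
      = (\<Prod>s\<in>S. w s) * detS \<phi> S * detS \<psi> S" .
  qed
  finally show ?thesis by simp
qed

lemma sum_vdm_square:
  assumes I: "finite I"
  shows "(\<Sum>S | S \<subseteq> I \<and> card S = n. (\<Prod>s\<in>S. w s) * vdm u S ^ 2)
    = det (mat n n (\<lambda>(i, j). \<Sum>l\<in>I. w l * (\<Prod>r<i. u l - \<alpha> r) * (\<Prod>r<j. u l - \<beta> r)))"
proof -
  have "(\<Sum>S | S \<subseteq> I \<and> card S = n. (\<Prod>s\<in>S. w s) * vdm u S ^ 2) = (\<Sum>S | S \<subseteq> I \<and> card S = n.
      (\<Prod>s\<in>S. w s) * detS (\<lambda>j l. \<Prod>r<j. u l - \<alpha> r) S * detS (\<lambda>j l. \<Prod>r<j. u l - \<beta> r) S)"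
  proof (rule sum.cong[OF refl])
    fix S assume "S \<in> {S. S \<subseteq> I \<and> card S = n}"
    then have "finite S" using I finite_subset by auto
    then show "(\<Prod>s\<in>S. w s) * vdm u S ^ 2
      = (\<Prod>s\<in>S. w s) * detS (\<lambda>j l. \<Prod>r<j. u l - \<alpha> r) S * detS (\<lambda>j l. \<Prod>r<j. u l - \<beta> r) S"
      by (simp add: detS_vandermonde power2_eq_square)
  qed
  then show ?thesis by (simp only: cauchy_binet[OF I])
qed

section \<open>Determinants of a quartered hexagon\<close>

definition even_rows :: "nat set \<Rightarrow> real" where
  "even_rows X = detS (\<lambda>j x. real ((x + 1 + j) choose (2 * j + 1))) X"

definition odd_rows :: "nat set \<Rightarrow> real" where
  "odd_rows X = detS (\<lambda>j x. real ((x + j) choose (2 * j))) X"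

lemma finite_interlace: "finite X \<Longrightarrow> finite {Y. interlace X Y}"
  using bij_betw_finite[OF gap_bij[OF _ refl]] by (simp add: finite_PiE gap_def)

lemma sum_interlace_odd_rows:
  assumes "finite X"
  shows "(\<Sum>Y | interlace X Y. odd_rows Y) = even_rows X"
proof -
  have "(\<Sum>y\<le>x. real ((y + j) choose (2 * j))) = real ((x + 1 + j) choose (2 * j + 1))" for x j
  proof (induction x)
    case 0 show ?case by (cases "j = 0") (simp_all add: binomial_eq_0)
  qed simp
  then show ?thesis unfolding odd_rows_def even_rows_def sum_interlace_detS[OF assms] by simp
qed

lemma detS_unit:
  assumes Z: "finite Z" and r: "\<And>j. r j 0 = (if j = 0 then 1 else 0)"
  shows "detS r (insert 0 (Suc ` Z)) = detS (\<lambda>j z. r (Suc j) (Suc z)) Z"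
proof -
  define n where "n = card Z"
  define Y where "Y = insert 0 (Suc ` Z)"
  have c: "card Y = Suc n" using Z by (simp add: Y_def n_def card_image)
  define f where "f i = (case i of 0 \<Rightarrow> 0 | Suc k \<Rightarrow> Suc (enum Z k))" for i
  have "f ` {0..<Suc n} = insert 0 (Suc ` enum Z ` {0..<n})"
    by (auto simp: f_def image_iff atLeast0LessThan lessThan_Suc_eq_insert_0 split: nat.splits)
  then have im: "f ` {0..<Suc n} = Y" using enum_image[OF Z] by (simp add: Y_def n_def)
  have "enum Y i = f i" if "i < Suc n" for i
    unfolding im[symmetric]
  proof (rule enum_unique[OF _ that])
    fix i j assume "i < j" "j < Suc n"
    then show "f i < f j" using enum_less[of "i - 1" "j - 1" Z] n_def
      by (cases i; cases j) (simp_all add: f_def)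
  qed
  then have "detS r Y = det (mat (Suc n) (Suc n) (\<lambda>(i, j). r j (f i)))" (is "_ = det ?A")
    unfolding detS_def c by (intro det_cong) simp
  also have "\<dots> = (\<Sum>j<Suc n. ?A $$ (0, j) * cofactor ?A 0 j)"
    by (rule laplace_expansion_row) auto
  also have "\<dots> = (\<Sum>j<Suc n. if j = 0 then cofactor ?A 0 0 else 0)"
    by (intro sum.cong refl) (simp add: f_def r)
  also have "\<dots> = det (mat_delete ?A 0 0)" by (simp add: cofactor_def)
  also have "mat_delete ?A 0 0 = mat n n (\<lambda>(i, j). r (Suc j) (Suc (enum Z i)))"
    by (rule eq_matI) (auto simp: mat_delete_def f_def)
  finally show ?thesis by (simp add: detS_def Y_def n_def)
qed

lemma detS_zero_column:
  assumes "finite Y" "Y \<noteq> {}" "\<And>y. y \<in> Y \<Longrightarrow> r 0 y = 0"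
  shows "detS r Y = 0"
proof -
  have n: "0 < card Y" using assms by (simp add: card_gt_0_iff)
  let ?A = "mat (card Y) (card Y) (\<lambda>(i, j). r j (enum Y i))"
  have "det ?A = (\<Sum>i<card Y. ?A $$ (i, 0) * cofactor ?A i 0)"
    by (rule laplace_expansion_column) (use n in auto)
  also have "\<dots> = 0"
  proof (rule sum.neutral, rule ballI)
    fix i assume "i \<in> {..<card Y}"
    then have "i < card Y" "enum Y i \<in> Y" using enum_image[OF assms(1)] by auto
    then show "?A $$ (i, 0) * cofactor ?A i 0 = 0" using n assms(3) by simp
  qed
  finally show ?thesis by (simp add: detS_def)
qed

lemma sum_interlace_even_rows:
  assumes X: "finite X" "X \<noteq> {}"
  shows "(\<Sum>Z | finite Z \<and> interlace X (insert 0 (Suc ` Z)). even_rows Z) = odd_rows X"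
proof -
  define r :: "nat \<Rightarrow> nat \<Rightarrow> real" where
    "r j l = (if l = 0 then if j = 0 then 1 else 0
      else if j = 0 then 0 else real ((l + j - 1) choose (2 * j - 1)))" for j l
  have r: "(\<Sum>l\<le>x. r j l) = real ((x + j) choose (2 * j))" for j x
  proof (induction x)
    case 0 show ?case by (cases "j = 0") (simp_all add: r_def binomial_eq_0)
  next
    case (Suc x)
    then show ?case by (cases j) (simp_all add: r_def)
  qed
  have "odd_rows X = (\<Sum>Y | interlace X Y. detS r Y)"
    unfolding odd_rows_def sum_interlace_detS[OF X(1)] r ..
  also have "\<dots> = (\<Sum>Y | interlace X Y \<and> 0 \<in> Y. detS r Y)"
  proof (rule sum.mono_neutral_right)
    show "\<forall>Y\<in>{Y. interlace X Y} - {Y. interlace X Y \<and> 0 \<in> Y}. detS r Y = 0"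
    proof
      fix Y assume "Y \<in> {Y. interlace X Y} - {Y. interlace X Y \<and> 0 \<in> Y}"
      then have "interlace X Y" "0 \<notin> Y" by auto
      then have Y: "finite Y" "card X = card Y" "0 \<notin> Y" by (simp_all add: interlace_def)
      then have "Y \<noteq> {}" using X by auto
      moreover have "r 0 y = 0" if "y \<in> Y" for y using that Y(3) by (cases y) (auto simp: r_def)
      ultimately show "detS r Y = 0" using Y(1) detS_zero_column by blast
    qed
  qed (use finite_interlace[OF X(1)] in auto)
  also have "{Y. interlace X Y \<and> 0 \<in> Y}
      = (\<lambda>Z. insert 0 (Suc ` Z)) ` {Z. finite Z \<and> interlace X (insert 0 (Suc ` Z))}"
  proof (intro equalityI subsetI)
    fix Y assume Y: "Y \<in> {Y. interlace X Y \<and> 0 \<in> Y}"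
    define Z where "Z = {z. Suc z \<in> Y}"
    have "y \<in> insert 0 (Suc ` Z)" if "y \<in> Y" for y using that by (cases y) (auto simp: Z_def)
    then have YZ: "Y = insert 0 (Suc ` Z)" using Y by (auto simp: Z_def)
    have "finite (Suc ` Z)" using Y YZ by (simp add: interlace_def)
    then have "finite Z" by (rule finite_imageD) simp
    then show "Y \<in> (\<lambda>Z. insert 0 (Suc ` Z)) ` {Z. finite Z \<and> interlace X (insert 0 (Suc ` Z))}"
      using Y YZ by auto
  qed auto
  also have "(\<Sum>Y\<in>(\<lambda>Z. insert 0 (Suc ` Z)) ` {Z. finite Z \<and> interlace X (insert 0 (Suc ` Z))}. detS r Y)
      = (\<Sum>Z | finite Z \<and> interlace X (insert 0 (Suc ` Z)). detS r (insert 0 (Suc ` Z)))"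
  proof (subst sum.reindex)
    have "{y. Suc y \<in> insert 0 (Suc ` Z)} = Z" for Z by auto
    then have "inj (\<lambda>Z. insert 0 (Suc ` Z))" by (intro inj_on_inverseI[where g = "\<lambda>Y. {y. Suc y \<in> Y}"]) simp
    then show "inj_on (\<lambda>Z. insert 0 (Suc ` Z)) {Z. finite Z \<and> interlace X (insert 0 (Suc ` Z))}"
      by (rule inj_on_subset) simp
  qed simp
  also have "\<dots> = (\<Sum>Z | finite Z \<and> interlace X (insert 0 (Suc ` Z)). even_rows Z)"
  proof (rule sum.cong[OF refl])
    fix Z assume "Z \<in> {Z. finite Z \<and> interlace X (insert 0 (Suc ` Z))}"
    then have Z: "finite Z" by simp
    have "detS r (insert 0 (Suc ` Z)) = detS (\<lambda>j z. r (Suc j) (Suc z)) Z"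
      by (rule detS_unit[OF Z]) (simp add: r_def)
    also have "\<dots> = even_rows Z" unfolding even_rows_def by (rule detS_cong[OF Z]) (simp add: r_def)
    finally show "detS r (insert 0 (Suc ` Z)) = even_rows Z" .
  qed
  finally show ?thesis by simp
qed

definition weyl :: "nat set \<Rightarrow> real" where
  "weyl X = (\<Prod>x\<in>X. real x + 1) * vdm (\<lambda>x. (real x + 1)\<^sup>2) X"

lemma fact_binomial: "fact k * real (n choose k) = (\<Prod>i<k. real n - real i)"
  by (simp add: binomial_gbinomial gbinomial_prod_rev lessThan_atLeast0)

lemma fact_binomial_odd:
  "fact (2 * j + 1) * real ((x + 1 + j) choose (2 * j + 1))
    = (real x + 1) * (\<Prod>r<j. (real x + 1)\<^sup>2 - (real r + 1)\<^sup>2)"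
proof -
  have "fact (2 * j + 1) * real ((x + 1 + j) choose (2 * j + 1)) = (\<Prod>i<2 * j + 1. real (x + 1 + j) - real i)"
    by (rule fact_binomial)
  also have "\<dots> = (real x + 1) * (\<Prod>r<j. (real x + 1)\<^sup>2 - (real r + 1)\<^sup>2)"
  proof (induction j)
    case (Suc j)
    have "(\<Prod>i<2 * Suc j + 1. real (x + 1 + Suc j) - real i)
        = real (x + 1 + Suc j) * (\<Prod>i<2 * j + 1. real (x + 1 + Suc j) - real (Suc i))
          * (real (x + 1 + Suc j) - real (2 * j + 2))"
    proof -
      have sh: "(\<Prod>i<2 * Suc j + 1. f i) = f 0 * (\<Prod>i<2 * j + 1. f (Suc i)) * f (2 * j + 2)" for f :: "nat \<Rightarrow> real"
      proof -
        have "(\<Prod>i<2 * Suc j + 1. f i) = (\<Prod>i<Suc (2 * j + 1). f i) * f (2 * j + 2)" by simp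
        then show ?thesis by (simp only: prod.lessThan_Suc_shift)
      qed
      show ?thesis
        unfolding sh[of "\<lambda>i. real (x + 1 + Suc j) - real i"] by (simp only: of_nat_0 diff_0_right)
    qed
    also have "(\<Prod>i<2 * j + 1. real (x + 1 + Suc j) - real (Suc i)) = (\<Prod>i<2 * j + 1. real (x + 1 + j) - real i)"
      by (intro prod.cong) auto
    finally show ?case unfolding Suc.IH by (simp add: power2_eq_square algebra_simps)
  qed simp
  finally show ?thesis .
qed

lemma prod_fact_odd: "(\<Prod>j<n. fact (2 * j + 1)) = H2 (2 * n + 1)"
proof -
  have "H2 (2 * n + 1) = (\<Prod>i = 1..n. fact (2 * (n - i) + 1))"
    unfolding H2_def by (intro prod.cong) (auto simp: algebra_simps diff_mult_distrib2 Suc_diff_le)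
  also have "\<dots> = (\<Prod>j<n. fact (2 * j + 1))"
    by (rule prod.reindex_bij_witness[of _ "\<lambda>j. n - j" "\<lambda>i. n - i"]) auto
  finally show ?thesis by simp
qed

lemma H2_pos: "H2 n > 0"
  unfolding H2_def by (intro prod_pos) simp

lemma even_rows_eq:
  assumes X: "finite X"
  shows "even_rows X = weyl X / H2 (2 * card X + 1)"
proof -
  have "even_rows X = detS (\<lambda>j x. (real x + 1) * inverse (fact (2 * j + 1))
      * (\<Prod>r<j. (real x + 1)\<^sup>2 - (real r + 1)\<^sup>2)) X"
    unfolding even_rows_def
  proof (rule detS_cong[OF X])
    fix j x
    show "real ((x + 1 + j) choose (2 * j + 1))
      = (real x + 1) * inverse (fact (2 * j + 1)) * (\<Prod>r<j. (real x + 1)\<^sup>2 - (real r + 1)\<^sup>2)"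
      using fact_binomial_odd[of j x] fact_nonzero[of "2 * j + 1", where 'a = real]
      by (simp add: field_simps del: fact_Suc)
  qed
  also have "\<dots> = (\<Prod>x\<in>X. real x + 1) * (\<Prod>j<card X. inverse (fact (2 * j + 1)))
      * vdm (\<lambda>x. (real x + 1)\<^sup>2) X"
    by (simp only: detS_scale[OF X] detS_vandermonde[OF X])
  also have "(\<Prod>j<card X. inverse (fact (2 * j + 1))) = inverse (H2 (2 * card X + 1))"
    unfolding prod_fact_odd[symmetric] by (simp only: prod_inversef[symmetric] o_def)
  finally show ?thesis by (simp add: weyl_def divide_inverse)
qed

section \<open>Coordinates and strips\<close>

definition vertex :: "int \<times> int \<Rightarrow> point" where
  "vertex = (\<lambda>(i, k). (of_int i + of_int k / 2, k))"

definition Ut :: "int \<Rightarrow> int \<Rightarrow> triangle" where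
  "Ut i k = up_unit (of_int i + of_int k / 2, k)"

definition Dt :: "int \<Rightarrow> int \<Rightarrow> triangle" where
  "Dt i k = down_unit (of_int i + of_int k / 2, k)"

lemma vertex_inj: "inj vertex"
  by (auto simp: inj_def vertex_def)

lemma Ut_vertex: "Ut i k = vertex ` {(i, k), (i + 1, k), (i, k + 1)}"
  by (simp add: Ut_def up_unit_def vertex_def add_divide_distrib algebra_simps)

lemma Dt_vertex: "Dt i k = vertex ` {(i, k), (i + 1, k), (i + 1, k - 1)}"
  by (simp add: Dt_def down_unit_def vertex_def add_divide_distrib diff_divide_distrib algebra_simps)

lemma unit_triangles_eq: "unit_triangles = range (case_prod Ut) \<union> range (case_prod Dt)"
proof -
  have lat: "Defs.lattice = range vertex"
  proof (intro equalityI subsetI)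
    fix p assume "p \<in> Defs.lattice"
    then obtain u k where p: "p = (u, k)" "u - of_int k / 2 \<in> \<int>" by (auto simp: Defs.lattice_def)
    then obtain i where "u - of_int k / 2 = of_int i" by (auto elim: Ints_cases)
    then have "p = vertex (i, k)" using p(1) by (simp add: vertex_def)
    then show "p \<in> range vertex" by simp
  qed (auto simp: Defs.lattice_def vertex_def)
  have ud: "case_prod Ut = up_unit \<circ> vertex" "case_prod Dt = down_unit \<circ> vertex"
    by (auto simp: fun_eq_iff Ut_def Dt_def vertex_def)
  show ?thesis unfolding unit_triangles_def lat ud by (simp only: image_comp)
qed

lemma Ut_Dt_unit [simp]: "Ut i k \<in> unit_triangles" "Dt i k \<in> unit_triangles"
  by (auto simp: unit_triangles_eq)

lemma unit_triangle_cases: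
  assumes "t \<in> unit_triangles"
  obtains i k where "t = Ut i k" | i k where "t = Dt i k"
  using assms by (auto simp: unit_triangles_eq)

lemma Ut_eq_iff [simp]: "Ut i k = Ut i' k' \<longleftrightarrow> i = i' \<and> k = k'"
proof
  assume "Ut i k = Ut i' k'"
  then have e: "{(i, k), (i + 1, k), (i, k + 1)} = {(i', k'), (i' + 1, k'), (i', k' + 1)}"
    unfolding Ut_vertex by (rule inj_image_eq_iff[OF vertex_inj, THEN iffD1])
  have "(i, k) \<in> {(i', k'), (i' + 1, k'), (i', k' + 1)}" unfolding e[symmetric] by simp
  moreover have "(i', k') \<in> {(i, k), (i + 1, k), (i, k + 1)}" unfolding e by simp
  ultimately show "i = i' \<and> k = k'" by auto
qed simp

lemma Dt_eq_iff [simp]: "Dt i k = Dt i' k' \<longleftrightarrow> i = i' \<and> k = k'"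
proof
  assume "Dt i k = Dt i' k'"
  then have e: "{(i, k), (i + 1, k), (i + 1, k - 1)} = {(i', k'), (i' + 1, k'), (i' + 1, k' - 1)}"
    unfolding Dt_vertex by (rule inj_image_eq_iff[OF vertex_inj, THEN iffD1])
  have "(i, k) \<in> {(i', k'), (i' + 1, k'), (i' + 1, k' - 1)}" unfolding e[symmetric] by simp
  moreover have "(i', k') \<in> {(i, k), (i + 1, k), (i + 1, k - 1)}" unfolding e by simp
  ultimately show "i = i' \<and> k = k'" by auto
qed simp

lemma Ut_neq_Dt [simp]: "Ut i k \<noteq> Dt i' k'" "Dt i' k' \<noteq> Ut i k"
proof -
  show "Ut i k \<noteq> Dt i' k'"
  proof
    assume "Ut i k = Dt i' k'"
    then have e: "{(i, k), (i + 1, k), (i, k + 1)} = {(i', k'), (i' + 1, k'), (i' + 1, k' - 1)}"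
      unfolding Ut_vertex Dt_vertex by (rule inj_image_eq_iff[OF vertex_inj, THEN iffD1])
    have "(i, k + 1) \<in> {(i', k'), (i' + 1, k'), (i' + 1, k' - 1)}"
      "(i, k) \<in> {(i', k'), (i' + 1, k'), (i' + 1, k' - 1)}"
      "(i + 1, k) \<in> {(i', k'), (i' + 1, k'), (i' + 1, k' - 1)}" unfolding e[symmetric] by simp_all
    then show False by auto
  qed
  then show "Dt i' k' \<noteq> Ut i k" by simp
qed

lemma lozenge_iff:
  "{s, t} \<in> lozenges \<longleftrightarrow> s \<in> unit_triangles \<and> t \<in> unit_triangles \<and> card (s \<inter> t) = 2"
  by (auto simp: lozenges_def doubleton_eq_iff Int_commute)

lemma card_vertex_Int: "card (vertex ` A \<inter> vertex ` B) = card (A \<inter> B)"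
  by (metis card_image image_Int inj_on_subset subset_UNIV vertex_inj)

lemma Ut_Dt_lozenge:
  "{Ut i k, Dt i' k'} \<in> lozenges \<longleftrightarrow> i' = i \<and> k' = k \<or> k' = k + 1 \<and> (i' = i \<or> i' = i - 1)"
  unfolding lozenge_iff Ut_vertex[of i k] Dt_vertex[of i' k'] card_vertex_Int
  unfolding Ut_vertex[symmetric] Dt_vertex[symmetric]
  by (auto simp: Int_insert_left card_insert_if split: if_splits)

lemma Ut_Ut_lozenge: "{Ut i k, Ut i' k'} \<notin> lozenges"
  unfolding lozenge_iff Ut_vertex card_vertex_Int by (auto simp: Int_insert_left card_insert_if split: if_splits)

lemma Dt_Dt_lozenge: "{Dt i k, Dt i' k'} \<notin> lozenges"
  unfolding lozenge_iff Dt_vertex card_vertex_Int by (auto simp: Int_insert_left card_insert_if split: if_splits)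

text \<open>In the strip between the lines \<open>k\<close> and \<open>k + 1\<close> of a quartered hexagon the unit triangles occur
  from west to east in the order \<open>DN 0 k\<close>, \<open>UP 0 k\<close>, \<open>DN 1 k\<close>, \<open>UP 1 k\<close> and so on, the first one being
  outside of the zigzag if \<open>k\<close> is odd.\<close>

definition UP :: "nat \<Rightarrow> nat \<Rightarrow> triangle" where
  "UP e k = Ut (int e - int ((k + 1) div 2)) (int k)"

definition DN :: "nat \<Rightarrow> nat \<Rightarrow> triangle" where
  "DN e k = Dt (int e - int ((k + 1) div 2) - 1) (int k + 1)"

lemma UP_eq_iff [simp]: "UP e k = UP e' k' \<longleftrightarrow> e = e' \<and> k = k'"
  by (auto simp: UP_def)

lemma DN_eq_iff [simp]: "DN e k = DN e' k' \<longleftrightarrow> e = e' \<and> k = k'"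
  by (auto simp: DN_def)

lemma UP_neq_DN [simp]: "UP e k \<noteq> DN e' k'" "DN e' k' \<noteq> UP e k"
  by (simp_all add: UP_def DN_def)

definition below :: "nat \<Rightarrow> nat \<Rightarrow> nat" where
  "below k e = (if even k then e else Suc e)"

lemma UP_DN_lozenge:
  "{UP e k, DN e' k'} \<in> lozenges \<longleftrightarrow> k' = k \<and> (e' = e \<or> e' = Suc e) \<or> k = Suc k' \<and> e' = below k' e"
  unfolding UP_def DN_def Ut_Dt_lozenge below_def by (auto elim!: evenE oddE)

lemma DN_UP_lozenge:
  "{DN e' k', UP e k} \<in> lozenges \<longleftrightarrow> k' = k \<and> (e' = e \<or> e' = Suc e) \<or> k = Suc k' \<and> e' = below k' e"
  using UP_DN_lozenge by (simp add: insert_commute)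

lemma UP_UP_lozenge: "{UP e k, UP e' k'} \<notin> lozenges"
  by (simp add: UP_def Ut_Ut_lozenge)

lemma DN_DN_lozenge: "{DN e k, DN e' k'} \<notin> lozenges"
  by (simp add: DN_def Dt_Dt_lozenge)

definition strip :: "nat \<Rightarrow> nat \<Rightarrow> nat set \<Rightarrow> nat set \<Rightarrow> region" where
  "strip k W X Y = (\<lambda>e. UP e k) ` ({..<W} - X) \<union> (\<lambda>e. DN e k) ` ({..<W} - Y)"

definition cnt :: "nat set \<Rightarrow> nat \<Rightarrow> nat" where
  "cnt X e = card {x \<in> X. x < e}"

lemma cnt_Suc: "cnt X (Suc e) = cnt X e + (if e \<in> X then 1 else 0)"
proof -
  have "{x \<in> X. x < Suc e} = {x \<in> X. x < e} \<union> (if e \<in> X then {e} else {})"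
    by (auto simp: less_Suc_eq)
  then show ?thesis by (simp add: cnt_def)
qed

lemma cnt_0 [simp]: "cnt X 0 = 0"
  by (simp add: cnt_def)

lemma cnt_mono: "e \<le> e' \<Longrightarrow> cnt X e \<le> cnt X e'"
  unfolding cnt_def by (rule card_mono) auto

definition tileable :: "nat \<Rightarrow> nat set \<Rightarrow> nat set \<Rightarrow> bool" where
  "tileable W X Y \<longleftrightarrow> (\<forall>e<W. cnt X e \<le> cnt Y e \<and> cnt Y e \<le> cnt X e + 1 \<and> (e \<in> Y \<longrightarrow> cnt Y e = cnt X e))"

lemma tileable_Suc:
  "tileable (Suc W) X Y \<longleftrightarrow> tileable W X Y \<and> cnt X W \<le> cnt Y W \<and> cnt Y W \<le> cnt X W + 1
    \<and> (W \<in> Y \<longrightarrow> cnt Y W = cnt X W)"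
  by (auto simp: tileable_def less_Suc_eq)

lemma finite_strip [simp]: "finite (strip k W X Y)"
  by (simp add: strip_def)

lemma strip_mem [simp]:
  "UP e l \<in> strip k W X Y \<longleftrightarrow> l = k \<and> e < W \<and> e \<notin> X"
  "DN e l \<in> strip k W X Y \<longleftrightarrow> l = k \<and> e < W \<and> e \<notin> Y"
  by (auto simp: strip_def)

lemma strip_cases:
  assumes "t \<in> strip k W X Y"
  obtains e where "t = UP e k" "e < W" "e \<notin> X" | e where "t = DN e k" "e < W" "e \<notin> Y"
  using assms by (auto simp: strip_def)

lemma strip_Suc:
  "strip k (Suc W) X Y = strip k W X Y \<union> (if W \<in> X then {} else {UP W k}) \<union> (if W \<in> Y then {} else {DN W k})"
  by (auto simp: strip_def lessThan_Suc)

text \<open>Reading a strip from west to east, the position at which a lozenge covers \<open>UP (e - 1) k\<close> and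
  \<open>DN e k\<close> is determined by the number of removed triangles to the west of it.\<close>

lemma M_strip_aux:
  "M (strip k W X Y) = (if tileable W X Y \<and> cnt Y W = cnt X W then 1 else 0)
   \<and> M (insert (DN W k) (strip k W X Y)) = (if tileable W X Y \<and> cnt Y W = cnt X W + 1 then 1 else 0)"
proof (induction W)
  case 0
  have "strip k 0 X Y = {}" by (simp add: strip_def)
  then show ?case by (simp add: M_single tileable_def)
next
  case (Suc W)
  note IH1 = Suc[THEN conjunct1] and IH2 = Suc[THEN conjunct2]
  have notin: "UP W k \<notin> strip k W X Y" "DN W k \<notin> strip k W X Y" "DN (Suc W) k \<notin> strip k W X Y"
    by simp_all
  show ?case
  proof
    show "M (strip k (Suc W) X Y) = (if tileable (Suc W) X Y \<and> cnt Y (Suc W) = cnt X (Suc W) then 1 else 0)"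
    proof (cases "W \<in> X")
      case True
      show ?thesis
      proof (cases "W \<in> Y")
        case Y: True
        have "strip k (Suc W) X Y = strip k W X Y" using True Y by (simp add: strip_Suc)
        then show ?thesis using IH1 True Y by (auto simp: tileable_Suc cnt_Suc)
      next
        case Y: False
        have "strip k (Suc W) X Y = insert (DN W k) (strip k W X Y)" using True Y by (simp add: strip_Suc)
        then show ?thesis using IH2 True Y by (auto simp: tileable_Suc cnt_Suc)
      qed
    next
      case False
      show ?thesis
      proof (cases "W \<in> Y")
        case Y: True
        have "M (strip k (Suc W) X Y) = 0"
        proof (rule M_isolated[where t = "UP W k"])
          fix s assume "s \<in> strip k (Suc W) X Y"
          then show "{UP W k, s} \<notin> lozenges"
            by (cases rule: strip_cases) (use Y in \<open>auto simp: UP_UP_lozenge UP_DN_lozenge\<close>)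
        qed (use False in simp_all)
        then show ?thesis using False Y by (auto simp: tileable_Suc cnt_Suc)
      next
        case Y: False
        have "M (strip k (Suc W) X Y) = M (strip k (Suc W) X Y - {UP W k, DN W k})"
        proof (rule M_leaf)
          fix s assume "s \<in> strip k (Suc W) X Y" "{UP W k, s} \<in> lozenges"
          then show "s = DN W k"
            by (cases rule: strip_cases) (auto simp: UP_UP_lozenge UP_DN_lozenge)
        qed (use False Y in \<open>simp_all add: UP_DN_lozenge\<close>)
        also have "strip k (Suc W) X Y - {UP W k, DN W k} = strip k W X Y"
          using False Y notin by (auto simp: strip_Suc)
        finally show ?thesis using IH1 False Y by (auto simp: tileable_Suc cnt_Suc)
      qed
    qed
  next
    let ?R = "insert (DN (Suc W) k) (strip k (Suc W) X Y)"
    show "M ?R = (if tileable (Suc W) X Y \<and> cnt Y (Suc W) = cnt X (Suc W) + 1 then 1 else 0)"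
    proof (cases "W \<in> X")
      case True
      have "M ?R = 0"
      proof (rule M_isolated[where t = "DN (Suc W) k"])
        fix s assume "s \<in> ?R"
        then consider "s = DN (Suc W) k" | "s \<in> strip k (Suc W) X Y" by blast
        then show "{DN (Suc W) k, s} \<notin> lozenges"
        proof cases
          case 1 then show ?thesis using DN_DN_lozenge by metis
        next
          case 2 then show ?thesis
            by (cases rule: strip_cases) (use True in \<open>auto simp: DN_DN_lozenge DN_UP_lozenge\<close>)
        qed
      qed simp_all
      then show ?thesis using True by (auto simp: tileable_Suc cnt_Suc)
    next
      case False
      have "M ?R = M (?R - {DN (Suc W) k, UP W k})"
      proof (rule M_leaf)
        fix s assume s: "s \<in> ?R" and l: "{DN (Suc W) k, s} \<in> lozenges"
        have "s \<noteq> DN (Suc W) k" using l DN_DN_lozenge by metis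
        then have "s \<in> strip k (Suc W) X Y" using s by blast
        then show "s = UP W k" using l
          by (cases rule: strip_cases) (auto simp: DN_DN_lozenge DN_UP_lozenge)
      qed (use False in \<open>simp_all add: DN_UP_lozenge\<close>)
      also have "?R - {DN (Suc W) k, UP W k} = strip k W X Y \<union> (if W \<in> Y then {} else {DN W k})"
        using False notin by (auto simp: strip_Suc)
      finally show ?thesis using IH1 IH2 False by (auto simp: tileable_Suc cnt_Suc)
    qed
  qed
qed

lemma cnt_all: "X \<subseteq> {..<e} \<Longrightarrow> cnt X e = card X"
  unfolding cnt_def by (rule arg_cong[where f = card]) auto

lemma cnt_le: "finite X \<Longrightarrow> cnt X e \<le> card X"
  unfolding cnt_def by (rule card_mono) auto

lemma interlace_iff: "interlace X Y \<longleftrightarrow> finite Y \<and> card X = card Y \<and> (\<forall>y\<in>Y. cnt X y = cnt Y y)"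
  by (simp add: interlace_def cnt_def)

lemma interlace_tileable:
  assumes "X \<subseteq> {..<W}" "Y \<subseteq> {..<W}"
  shows "tileable W X Y \<and> cnt Y W = cnt X W \<longleftrightarrow> interlace X Y"
proof
  assume "tileable W X Y \<and> cnt Y W = cnt X W"
  then show "interlace X Y"
    using assms finite_subset[OF assms(2)] by (auto simp: interlace_iff tileable_def cnt_all)
next
  assume i: "interlace X Y"
  then have Y: "finite Y" "card X = card Y" "\<And>y. y \<in> Y \<Longrightarrow> cnt X y = cnt Y y" by (auto simp: interlace_iff)
  have X: "finite X" using finite_subset[OF assms(1)] by simp
  have "cnt Y e \<le> cnt X e + 1" for e
  proof (cases "{y \<in> Y. y < e} = {}")
    case True
    have "cnt Y e = 0" unfolding cnt_def True by simp
    then show ?thesis by simp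
  next
    case False
    define m where "m = Max {y \<in> Y. y < e}"
    have f: "finite {y \<in> Y. y < e}" using Y by simp
    have m: "m \<in> Y" "m < e" using Max_in[OF f False] by (auto simp: m_def)
    have "{y \<in> Y. y < e} \<subseteq> insert m {y \<in> Y. y < m}"
      using Max_ge[OF f] unfolding m_def[symmetric] by (fastforce simp: order_le_less)
    from card_mono[OF _ this] have "cnt Y e \<le> Suc (cnt Y m)"
      using Y(1) m by (simp add: cnt_def)
    also have "cnt Y m \<le> cnt X e" using Y(3)[OF m(1)] cnt_mono[of m e X] m by simp
    finally show ?thesis by simp
  qed
  moreover have "cnt X e \<le> cnt Y e" for e
  proof (cases "{y \<in> Y. e \<le> y} = {}")
    case True
    then have "{y \<in> Y. y < e} = Y" by auto
    then have "cnt Y e = card Y" by (simp add: cnt_def)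
    then show ?thesis using cnt_le[OF X, of e] Y by simp
  next
    case False
    define m where "m = Min {y \<in> Y. e \<le> y}"
    have f: "finite {y \<in> Y. e \<le> y}" using Y by simp
    have m: "m \<in> Y" "e \<le> m" using Min_in[OF f False] by (auto simp: m_def)
    have "{y \<in> Y. y < m} \<subseteq> {y \<in> Y. y < e}"
    proof (rule subsetI)
      fix y assume y: "y \<in> {y \<in> Y. y < m}"
      have "\<not> e \<le> y" using Min_le[OF f, of y] y unfolding m_def[symmetric] by auto
      then show "y \<in> {y \<in> Y. y < e}" using y by simp
    qed
    from card_mono[OF _ this] have "cnt Y m \<le> cnt Y e" using Y(1) by (simp add: cnt_def)
    then show ?thesis using Y(3)[OF m(1)] cnt_mono[OF m(2), of X] by simp
  qed
  ultimately show "tileable W X Y \<and> cnt Y W = cnt X W"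
    using Y(2,3) assms by (auto simp: tileable_def cnt_all)
qed

lemma interlace_bound:
  assumes "interlace X Y" "X \<subseteq> {..<W}"
  shows "Y \<subseteq> {..<W}"
proof (rule subsetI, rule ccontr)
  fix y assume y: "y \<in> Y" "y \<notin> {..<W}"
  then have "cnt X y = card X" using assms(2) by (intro cnt_all) auto
  then have "card {y' \<in> Y. y' < y} = card Y" using assms(1) y(1) by (auto simp: interlace_iff cnt_def)
  then have "{y' \<in> Y. y' < y} = Y" using assms(1) by (intro card_subset_eq) (auto simp: interlace_iff)
  then show False using y(1) by auto
qed

lemma M_strip:
  assumes "X \<subseteq> {..<W}"
  shows "M (strip k W X Y) = (if interlace X (Y \<inter> {..<W}) then 1 else 0)"
proof -
  have "strip k W X Y = strip k W X (Y \<inter> {..<W})" by (auto simp: strip_def)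
  then show ?thesis
    using M_strip_aux[of k W X "Y \<inter> {..<W}"] interlace_tileable[OF assms, of "Y \<inter> {..<W}"] by simp
qed

section \<open>Quartered hexagons with unit dents\<close>

definition rows :: "nat \<Rightarrow> nat \<Rightarrow> nat \<Rightarrow> region" where
  "rows W n k = {UP e l | e l. k \<le> l \<and> l < 2 * n \<and> e + l div 2 < W}
     \<union> {DN e l | e l. k \<le> l \<and> l < 2 * n \<and> e + l div 2 < W \<and> (odd l \<longrightarrow> 0 < e)}"

lemma rows_mem [simp]:
  "UP e l \<in> rows W n k \<longleftrightarrow> k \<le> l \<and> l < 2 * n \<and> e + l div 2 < W"
  "DN e l \<in> rows W n k \<longleftrightarrow> k \<le> l \<and> l < 2 * n \<and> e + l div 2 < W \<and> (odd l \<longrightarrow> 0 < e)"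
  by (auto simp: rows_def)

lemma rows_cases:
  assumes "t \<in> rows W n k"
  obtains e l where "t = UP e l" "k \<le> l" "l < 2 * n" "e + l div 2 < W"
    | e l where "t = DN e l" "k \<le> l" "l < 2 * n" "e + l div 2 < W" "odd l \<longrightarrow> 0 < e"
  using assms by (auto simp: rows_def)

lemma finite_rows [simp]: "finite (rows W n k)"
proof (rule finite_subset)
  show "rows W n k \<subseteq> case_prod UP ` ({..<W} \<times> {..<2 * n}) \<union> case_prod DN ` ({..<W} \<times> {..<2 * n})"
    by (rule subsetI, erule rows_cases) (auto simp: image_iff)
qed simp

lemma rows_top: "rows W n (2 * n) = {}"
  by (auto elim: rows_cases)

abbreviation ups :: "nat \<Rightarrow> nat set \<Rightarrow> region" where
  "ups k X \<equiv> (\<lambda>e. UP e k) ` X"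

lemma rows_step:
  assumes k: "k < 2 * n"
  shows "rows W n k - ups k X
    = strip k (W - k div 2) X (if even k then {} else {0}) \<union> rows W n (Suc k)" (is "?L = ?R")
proof (intro equalityI subsetI)
  fix t assume "t \<in> ?L"
  then have "t \<in> rows W n k" "t \<notin> ups k X" by auto
  then show "t \<in> ?R"
    by (cases rule: rows_cases) (use k in \<open>auto simp: Suc_le_eq order_le_less\<close>)
next
  fix t assume "t \<in> ?R"
  then consider "t \<in> strip k (W - k div 2) X (if even k then {} else {0})" | "t \<in> rows W n (Suc k)"
    by blast
  then show "t \<in> ?L"
  proof cases
    case 1 then show ?thesis by (cases rule: strip_cases) (use k in \<open>auto split: if_splits\<close>)
  next
    case 2 then show ?thesis by (cases rule: rows_cases) auto
  qed
qed

lemma below_inj: "inj (below k)"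
  by (auto simp: inj_def below_def)

lemma M_rows_step:
  fixes k n W :: nat
  assumes k: "k < 2 * n"
  defines "I \<equiv> if Suc k < 2 * n then {..<W - Suc k div 2} else {}"
  shows "M (rows W n k - ups k X)
    = (\<Sum>S\<in>Pow I. M (strip k (W - k div 2) X ((if even k then {} else {0}) \<union> below k ` S))
        * M (rows W n (Suc k) - ups (Suc k) S))"
proof -
  define Y0 where "Y0 = (if even k then {} else {0 :: nat})"
  let ?W = "W - k div 2"
  have I: "e < ?W" "Suc k < 2 * n" "e + Suc k div 2 < W" "below k e < ?W" "below k e \<notin> Y0"
    if "e \<in> I" for e
    using that k by (auto simp: I_def Y0_def below_def elim!: oddE evenE split: if_splits)
  have "M (strip k ?W X Y0 \<union> rows W n (Suc k))
    = (\<Sum>S\<in>Pow I. M (strip k ?W X Y0 - (\<lambda>e. DN (below k e) k) ` S) * M (rows W n (Suc k) - ups (Suc k) S))"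
  proof (rule M_split)
    show "strip k ?W X Y0 \<inter> rows W n (Suc k) = {}" by (auto elim!: strip_cases)
    show "finite I" by (simp add: I_def)
    show "inj_on (\<lambda>e. DN (below k e) k) I" using below_inj[of k] by (auto simp: inj_on_def)
    show "inj_on (\<lambda>e. UP e (Suc k)) I" by (auto simp: inj_on_def)
    show "(\<lambda>e. DN (below k e) k) ` I \<subseteq> strip k ?W X Y0" using I by auto
    show "ups (Suc k) I \<subseteq> rows W n (Suc k)" using I by auto
    fix s t assume s: "s \<in> strip k ?W X Y0" and t: "t \<in> rows W n (Suc k)"
    have "t = UP e (Suc k) \<Longrightarrow> e \<in> I" for e using t by (auto simp: I_def)
    then show "{s, t} \<in> lozenges \<longleftrightarrow> (\<exists>e\<in>I. s = DN (below k e) k \<and> t = UP e (Suc k))"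
      using s t by (elim strip_cases rows_cases)
        (auto simp: UP_UP_lozenge DN_DN_lozenge UP_DN_lozenge DN_UP_lozenge)
  qed simp_all
  moreover have "strip k ?W X Y0 - (\<lambda>e. DN (below k e) k) ` S = strip k ?W X (Y0 \<union> below k ` S)" for S
    by (auto simp: strip_def)
  ultimately show ?thesis using rows_step[OF k, of W X] by (simp add: Y0_def)
qed

lemma even_rows_empty [simp]: "even_rows {} = 1"
  by (simp add: even_rows_def detS_def)

lemma M_rows:
  assumes "n \<le> W" and "k \<le> 2 * n" "X \<subseteq> {..<W - k div 2}" "k = 2 * n \<Longrightarrow> X = {}"
  shows "real (M (rows W n k - ups k X))
    = (if card X = n - k div 2 then if even k then even_rows X else odd_rows X else 0)"
  using assms(2-)
proof (induction k arbitrary: X rule: inc_induct)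
  case base
  then show ?case by (simp add: rows_top)
next
  case (step k)
  note k = \<open>k < 2 * n\<close>
  let ?W = "W - k div 2"
  define I where "I = (if Suc k < 2 * n then {..<W - Suc k div 2} else {})"
  have X: "finite X" "X \<subseteq> {..<?W}" using step.prems(1) finite_subset by auto
  have finI: "finite I" by (simp add: I_def)
  define sh where "sh S = (if even k then {} else {0}) \<union> below k ` S" for S
  have sub: "sh S \<subseteq> {..<?W}" if "S \<subseteq> I" for S
  proof -
    have "0 < ?W" using k assms(1) by (auto simp: less_mult_imp_div_less mult.commute)
    moreover have "below k e < ?W" if "e \<in> I" for e
      using that k by (auto simp: I_def below_def elim!: oddE evenE split: if_splits)
    ultimately show ?thesis using that by (auto simp: sh_def)
  qed
  have IH: "real (M (rows W n (Suc k) - ups (Suc k) S))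
      = (if card S = n - Suc k div 2 then if even k then odd_rows S else even_rows S else 0)"
    if "S \<subseteq> I" for S
    using that step.IH[of S] by (auto simp: I_def split: if_splits)
  have "real (M (rows W n k - ups k X))
    = (\<Sum>S\<in>Pow I. (if interlace X (sh S) then 1 else 0)
        * (if card S = n - Suc k div 2 then if even k then odd_rows S else even_rows S else 0))"
    unfolding M_rows_step[OF k, of W X, folded I_def] of_nat_sum of_nat_mult
  proof (rule sum.cong[OF refl])
    fix S assume "S \<in> Pow I"
    then have S: "S \<subseteq> I" by simp
    then have "sh S \<inter> {..<?W} = sh S" using sub by blast
    then show "real (M (strip k ?W X ((if even k then {} else {0}) \<union> below k ` S)))
          * real (M (rows W n (Suc k) - ups (Suc k) S))
        = (if interlace X (sh S) then 1 else 0)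
        * (if card S = n - Suc k div 2 then if even k then odd_rows S else even_rows S else 0)"
      using IH[OF S] M_strip[OF X(2), of k "sh S"] by (simp add: sh_def)
  qed
  also have "\<dots> = (\<Sum>S | S \<subseteq> I \<and> interlace X (sh S).
      if card S = n - Suc k div 2 then if even k then odd_rows S else even_rows S else 0)"
    using finI by (intro sum.mono_neutral_cong_right) auto
  also have "\<dots> = (if card X = n - k div 2 then if even k then even_rows X else odd_rows X else 0)"
  proof (cases "even k")
    case True
    then have sh: "sh S = S" for S by (simp add: sh_def below_def)
    have k': "Suc k < 2 * n" "Suc k div 2 = k div 2" using True k by (auto elim!: evenE)
    have "{S. S \<subseteq> I \<and> interlace X (sh S)} = {S. interlace X S}"
      using interlace_bound[OF _ X(2)] k' by (auto simp: I_def sh)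
    then have "(\<Sum>S | S \<subseteq> I \<and> interlace X (sh S).
        if card S = n - Suc k div 2 then if even k then odd_rows S else even_rows S else 0)
      = (\<Sum>S | interlace X S. if card X = n - k div 2 then odd_rows S else 0)"
      using True k' by (intro sum.cong) (auto simp: interlace_def)
    also have "\<dots> = (if card X = n - k div 2 then \<Sum>S | interlace X S. odd_rows S else 0)"
      by simp
    finally show ?thesis using True sum_interlace_odd_rows[OF X(1)] by simp
  next
    case False
    then have sh: "sh S = insert 0 (Suc ` S)" for S by (auto simp: sh_def below_def)
    have k': "Suc k div 2 = Suc (k div 2)" "k div 2 < n" using False k by (auto elim!: oddE)
    have cS: "card X = Suc (card S)" if "finite S" "interlace X (sh S)" for S
      using that by (simp add: interlace_def sh card_image)
    show ?thesis
    proof (cases "card X = n - k div 2")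
      case cX: True
      then have ne: "X \<noteq> {}" using k' by auto
      have "S \<subseteq> I" if S: "finite S" "interlace X (sh S)" for S
      proof (cases "Suc k < 2 * n")
        case True
        have "Suc ` S \<subseteq> {..<?W}" using interlace_bound[OF S(2) X(2)] by (simp add: sh)
        then show ?thesis using True k' by (auto simp: I_def)
      next
        case False
        then have "card S = 0" using cS[OF S] cX k k' by (auto elim!: oddE evenE)
        then show ?thesis using S(1) by simp
      qed
      then have "{S. S \<subseteq> I \<and> interlace X (sh S)} = {S. finite S \<and> interlace X (insert 0 (Suc ` S))}"
        using finI finite_subset unfolding sh by blast
      then have "(\<Sum>S | S \<subseteq> I \<and> interlace X (sh S).
          if card S = n - Suc k div 2 then if even k then odd_rows S else even_rows S else 0)
        = (\<Sum>S | finite S \<and> interlace X (insert 0 (Suc ` S)).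
          if card S = n - Suc k div 2 then if even k then odd_rows S else even_rows S else 0)"
        by simp
      also have "\<dots> = (\<Sum>S | finite S \<and> interlace X (insert 0 (Suc ` S)). even_rows S)"
      proof (rule sum.cong[OF refl])
        fix S assume "S \<in> {S. finite S \<and> interlace X (insert 0 (Suc ` S))}"
        then have "card X = Suc (card S)" using cS[of S] by (simp add: sh)
        then show "(if card S = n - Suc k div 2 then if even k then odd_rows S else even_rows S else 0)
          = even_rows S" using False k' cX by simp
      qed
      finally have "(\<Sum>S | S \<subseteq> I \<and> interlace X (sh S).
          if card S = n - Suc k div 2 then if even k then odd_rows S else even_rows S else 0)
        = (\<Sum>S | finite S \<and> interlace X (insert 0 (Suc ` S)). even_rows S)" .
      then show ?thesis using sum_interlace_even_rows[OF X(1) ne] cX False by simp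
    next
      case cX: False
      have "(\<Sum>S | S \<subseteq> I \<and> interlace X (sh S).
          if card S = n - Suc k div 2 then if even k then odd_rows S else even_rows S else 0) = 0"
      proof (rule sum.neutral, rule ballI)
        fix S assume "S \<in> {S. S \<subseteq> I \<and> interlace X (sh S)}"
        then have "finite S" "interlace X (sh S)" using finI finite_subset by auto
        then have "card X = Suc (card S)" by (rule cS)
        then show "(if card S = n - Suc k div 2 then if even k then odd_rows S else even_rows S else 0) = 0"
          using cX k' by auto
      qed
      then show ?thesis using cX by simp
    qed
  qed
  finally show ?case .
qed

lemma M_rows_dented:
  assumes "X \<subseteq> {..<W}" "card X = n"
  shows "real (M (rows W n 0 - ups 0 X)) = weyl X / H2 (2 * n + 1)"
proof -
  have "finite X" using assms(1) finite_subset by auto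
  moreover have "n \<le> W" using card_mono[OF _ assms(1)] assms(2) by simp
  ultimately show ?thesis using M_rows[of n W 0 X] assms even_rows_eq[of X] by auto
qed

lemma M_rows_unbalanced:
  assumes "X \<subseteq> {..<W}" "card X \<noteq> n" "0 < n" "n \<le> W"
  shows "M (rows W n 0 - ups 0 X) = 0"
  using M_rows[of n W 0 X] assms by simp

section \<open>Dents and gluing\<close>

lemma cells_mem:
  "Ut i k \<in> cells X \<longleftrightarrow> vertex (i, k) \<in> X \<and> vertex (i + 1, k) \<in> X \<and> vertex (i, k + 1) \<in> X"
  "Dt i k \<in> cells X \<longleftrightarrow> vertex (i, k) \<in> X \<and> vertex (i + 1, k) \<in> X \<and> vertex (i + 1, k - 1) \<in> X"
  by (simp_all add: cells_def) (simp_all add: Ut_vertex Dt_vertex)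

lemma region_eqI:
  assumes "R \<subseteq> unit_triangles" "R' \<subseteq> unit_triangles"
    and "\<And>i k. Ut i k \<in> R \<longleftrightarrow> Ut i k \<in> R'" "\<And>i k. Dt i k \<in> R \<longleftrightarrow> Dt i k \<in> R'"
  shows "R = R'"
proof (intro equalityI subsetI)
  fix t assume t: "t \<in> R"
  then have "t \<in> unit_triangles" using assms(1) by blast
  then show "t \<in> R'" by (cases rule: unit_triangle_cases) (use t assms(3,4) in auto)
next
  fix t assume t: "t \<in> R'"
  then have "t \<in> unit_triangles" using assms(2) by blast
  then show "t \<in> R" by (cases rule: unit_triangle_cases) (use t assms(3,4) in auto)
qed

lemma cells_unit: "cells X \<subseteq> unit_triangles"
  by (auto simp: cells_def)

lemma rows_unit: "rows W n k \<subseteq> unit_triangles"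
  by (auto simp: rows_def UP_def DN_def)

lemma zigzag_le: "zigzag k \<le> of_int i + of_int k / 2 \<longleftrightarrow> 0 \<le> i + (k + 1) div 2"
proof (cases "even k")
  case True
  then obtain r where k: "k = 2 * r" by (elim evenE)
  have "zigzag k \<le> of_int i + of_int k / 2 \<longleftrightarrow> (0 :: real) \<le> of_int (i + r)" by (simp add: zigzag_def k)
  also have "\<dots> \<longleftrightarrow> 0 \<le> i + r" by (simp only: of_int_0_le_iff)
  finally show ?thesis by (simp add: k)
next
  case False
  then obtain r where k: "k = 2 * r + 1" by (elim oddE)
  have "zigzag k \<le> of_int i + of_int k / 2 \<longleftrightarrow> (0 :: real) \<le> of_int (i + r + 1)"
    by (simp add: zigzag_def k add_divide_distrib algebra_simps)
  also have "\<dots> \<longleftrightarrow> 0 \<le> i + r + 1" by (simp only: of_int_0_le_iff)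
  finally show ?thesis by (simp add: k algebra_simps)
qed

lemma east_le:
  "of_int i + of_int k / 2 \<le> real W - of_int k / 2 \<longleftrightarrow> i + k \<le> int W"
  "of_int i + of_int k / 2 \<le> real W + of_int k / 2 \<longleftrightarrow> i \<le> int W"
  "real W + of_int k / 2 \<le> of_int i + of_int k / 2 \<longleftrightarrow> int W \<le> i"
proof -
  have "of_int i + of_int k / 2 \<le> real W - of_int k / 2 \<longleftrightarrow> (of_int (i + k) :: real) \<le> of_int (int W)"
    unfolding of_int_add of_int_of_nat_eq by (rule iffI) linarith+
  also have "\<dots> \<longleftrightarrow> i + k \<le> int W" by (simp only: of_int_le_iff)
  finally show "of_int i + of_int k / 2 \<le> real W - of_int k / 2 \<longleftrightarrow> i + k \<le> int W" .
  have "of_int i + of_int k / 2 \<le> real W + of_int k / 2 \<longleftrightarrow> (of_int i :: real) \<le> of_int (int W)" by simp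
  also have "\<dots> \<longleftrightarrow> i \<le> int W" by (simp only: of_int_le_iff)
  finally show "of_int i + of_int k / 2 \<le> real W + of_int k / 2 \<longleftrightarrow> i \<le> int W" .
  have "real W + of_int k / 2 \<le> of_int i + of_int k / 2 \<longleftrightarrow> (of_int (int W) :: real) \<le> of_int i" by simp
  also have "\<dots> \<longleftrightarrow> int W \<le> i" by (simp only: of_int_le_iff)
  finally show "real W + of_int k / 2 \<le> of_int i + of_int k / 2 \<longleftrightarrow> int W \<le> i" .
qed

lemma Ut_rows:
  "Ut i k \<in> rows W n 0 \<longleftrightarrow> 0 \<le> k \<and> k < 2 * int n \<and> 0 \<le> i + (k + 1) div 2 \<and> i + k + 1 \<le> int W"
proof
  assume "Ut i k \<in> rows W n 0"
  then show "0 \<le> k \<and> k < 2 * int n \<and> 0 \<le> i + (k + 1) div 2 \<and> i + k + 1 \<le> int W"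
    by (cases rule: rows_cases) (auto simp: UP_def DN_def zdiv_int)
next
  assume *: "0 \<le> k \<and> k < 2 * int n \<and> 0 \<le> i + (k + 1) div 2 \<and> i + k + 1 \<le> int W"
  define e l where "e = nat (i + (k + 1) div 2)" and "l = nat k"
  have "Ut i k = UP e l" using * by (simp add: UP_def e_def l_def zdiv_int)
  moreover have "UP e l \<in> rows W n 0" using * by (simp add: e_def l_def) linarith
  ultimately show "Ut i k \<in> rows W n 0" by simp
qed

lemma Dt_rows:
  "Dt i k \<in> rows W n 0 \<longleftrightarrow> 1 \<le> k \<and> k \<le> 2 * int n \<and> 0 \<le> i + (k + 1) div 2 \<and> i + k + 1 \<le> int W"
proof
  assume "Dt i k \<in> rows W n 0"
  then show "1 \<le> k \<and> k \<le> 2 * int n \<and> 0 \<le> i + (k + 1) div 2 \<and> i + k + 1 \<le> int W"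
    by (cases rule: rows_cases) (auto simp: UP_def DN_def zdiv_int elim!: evenE oddE)
next
  assume *: "1 \<le> k \<and> k \<le> 2 * int n \<and> 0 \<le> i + (k + 1) div 2 \<and> i + k + 1 \<le> int W"
  define e l where "e = nat (i + 1 + k div 2)" and "l = nat (k - 1)"
  have k: "k = int l + 1" using * by (simp add: l_def)
  have e: "int e = i + 1 + k div 2" using * by (simp add: e_def) linarith
  have "Dt i k = DN e l" unfolding DN_def e by (simp add: k zdiv_int)
  moreover have "DN e l \<in> rows W n 0"
  proof -
    have "int (e + l div 2) < int W" using * e by (simp add: k zdiv_int) linarith
    moreover have "0 < e" if "odd l"
    proof -
      have "even k" using that k by simp
      then have "(k + 1) div 2 = k div 2" by (elim evenE) simp
      then show ?thesis using * e by linarith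
    qed
    moreover have "l < 2 * n" using * k by linarith
    ultimately show ?thesis by simp
  qed
  ultimately show "Dt i k \<in> rows W n 0" by simp
qed

lemma quarter_cells:
  "cells {(u, k). 0 \<le> k \<and> k \<le> int (2 * n) \<and> zigzag k \<le> u \<and> u \<le> real W - of_int k / 2} = rows W n 0"
proof (rule region_eqI[OF cells_unit rows_unit])
  fix i k
  show "Ut i k \<in> cells {(u, k). 0 \<le> k \<and> k \<le> int (2 * n) \<and> zigzag k \<le> u \<and> u \<le> real W - of_int k / 2}
      \<longleftrightarrow> Ut i k \<in> rows W n 0"
    unfolding cells_mem Ut_rows vertex_def mem_Collect_eq case_prod_conv zigzag_le east_le(1)
    by (simp add: algebra_simps) linarith
  show "Dt i k \<in> cells {(u, k). 0 \<le> k \<and> k \<le> int (2 * n) \<and> zigzag k \<le> u \<and> u \<le> real W - of_int k / 2}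
      \<longleftrightarrow> Dt i k \<in> rows W n 0"
    unfolding cells_mem Dt_rows vertex_def mem_Collect_eq case_prod_conv zigzag_le east_le(1)
    by (simp add: algebra_simps) linarith
qed

lemma up_triangle_mem:
  "Ut i k \<in> up_triangle p s \<longleftrightarrow> 0 \<le> k \<and> int p \<le> i \<and> i + k + 1 \<le> int (p + s)"
  "Dt i k \<in> up_triangle p s \<longleftrightarrow> 1 \<le> k \<and> int p \<le> i \<and> i + k + 1 \<le> int (p + s)"
  unfolding up_triangle_def cells_mem vertex_def mem_Collect_eq case_prod_conv east_le by auto

lemma left_dent_mem:
  "Ut i k \<in> left_dent as \<longleftrightarrow> 0 \<le> k \<and> i + k + 1 \<le> int (entry as 1)"
  "Dt i k \<in> left_dent as \<longleftrightarrow> 1 \<le> k \<and> i + k + 1 \<le> int (entry as 1)"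
  unfolding left_dent_def cells_mem vertex_def mem_Collect_eq case_prod_conv east_le by auto

text \<open>All tiles covering a down-pointing triangle of a dent are forced, row by row, once the
  up-pointing triangles in the bottom row of the dent have been removed.\<close>

definition dent_of :: "region \<Rightarrow> region \<Rightarrow> bool" where
  "dent_of R G \<longleftrightarrow> G \<subseteq> R
    \<and> (\<forall>i k. Dt i k \<in> G \<longrightarrow> Ut i k \<in> G \<and> (\<forall>j\<in>{i, i + 1}. Ut j (k - 1) \<in> R \<longrightarrow> Ut j (k - 1) \<in> G))
    \<and> (\<forall>i k. 0 < k \<longrightarrow> Ut i k \<in> G \<longrightarrow> Dt i k \<in> G)"

lemma dent_of_Un: "dent_of R G \<Longrightarrow> dent_of R G' \<Longrightarrow> dent_of R (G \<union> G')"
  unfolding dent_of_def by blast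

lemma dent_of_UN: "(\<And>i. i \<in> J \<Longrightarrow> dent_of R (G i)) \<Longrightarrow> dent_of R (\<Union>i\<in>J. G i)"
  unfolding dent_of_def by blast

lemma dent_of_up_triangle:
  assumes "p + s \<le> W" "s \<le> n"
  shows "dent_of (rows W n 0) (up_triangle p s)"
proof -
  have "up_triangle p s \<subseteq> rows W n 0"
  proof
    fix t assume t: "t \<in> up_triangle p s"
    then have "t \<in> unit_triangles" by (auto simp: up_triangle_def cells_def)
    then show "t \<in> rows W n 0"
      by (cases rule: unit_triangle_cases)
        (use t assms in \<open>auto simp: up_triangle_mem Ut_rows Dt_rows\<close>)
  qed
  then show ?thesis by (auto simp: dent_of_def up_triangle_mem)
qed

lemma dent_of_left_dent:
  assumes "entry as 1 \<le> n"
  shows "dent_of (rows W n 0) (left_dent as \<inter> rows W n 0)"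
proof -
  have "Ut i k \<in> rows W n 0" if "Dt i k \<in> rows W n 0" "Dt i k \<in> left_dent as" for i k
    using that assms unfolding Ut_rows Dt_rows left_dent_mem by auto
  moreover have "Dt i k \<in> rows W n 0" if "0 < k" "Ut i k \<in> rows W n 0" for i k
    using that unfolding Ut_rows Dt_rows by auto
  ultimately show ?thesis by (auto simp: dent_of_def left_dent_mem)
qed

lemma M_dent:
  assumes G: "dent_of (rows W n 0) G" and S: "\<And>s. s \<in> S \<Longrightarrow> UP s 0 \<notin> G"
  shows "M (rows W n 0 - G - ups 0 S) = M (rows W n 0 - ups 0 ({e. UP e 0 \<in> G} \<union> S))"
proof -
  define R where "R = rows W n 0"
  define R' where "R' = R - ups 0 ({e. UP e 0 \<in> G} \<union> S)"
  define F where "F = {{Dt i k, Ut i k} | i k. Dt i k \<in> G}"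
  have TR: "G \<subseteq> R" using G by (simp add: dent_of_def R_def)
  have D: "Ut i k \<in> G" "j \<in> {i, i + 1} \<Longrightarrow> Ut j (k - 1) \<in> R \<Longrightarrow> Ut j (k - 1) \<in> G"
    if "Dt i k \<in> G" for i j k
    using G that unfolding dent_of_def R_def by blast+
  have U: "Dt i k \<in> G" if "0 < k" "Ut i k \<in> G" for i k
    using G that unfolding dent_of_def by blast
  have k1: "1 \<le> k" if "Dt i k \<in> G" for i k using TR that by (auto simp: R_def Dt_rows)
  have Ut0: "\<exists>e. Ut i 0 = UP e 0" if "Ut i 0 \<in> R" for i
  proof -
    have "0 \<le> i" using that by (simp add: R_def Ut_rows)
    then have "Ut i 0 = UP (nat i) 0" by (simp add: UP_def)
    then show ?thesis by blast
  qed
  have UPk: "Ut i k \<noteq> UP e 0" if "1 \<le> k" for i k e using that by (simp add: UP_def)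
  have DtUP: "Dt i k \<noteq> UP e 0" for i k e by (simp add: UP_def)
  have inR': "Dt i k \<in> R'" "Ut i k \<in> R'" if "Dt i k \<in> G" for i k
    using TR that D(1)[OF that] UPk[OF k1[OF that]] DtUP by (auto simp: R'_def)
  have "M R' = M (R' - \<Union>F)"
  proof (rule M_forced)
    show "finite R'" by (simp add: R'_def R_def)
    show "\<Union>F \<subseteq> R'" using inR' by (auto simp: F_def)
    show "F \<subseteq> lozenges"
    proof
      fix p assume "p \<in> F"
      then obtain i k where "p = {Ut i k, Dt i k}" by (auto simp: F_def insert_commute)
      then show "p \<in> lozenges" by (simp only: Ut_Dt_lozenge) simp
    qed
    show "p \<inter> q = {}" if pq: "p \<in> F" "q \<in> F" "p \<noteq> q" for p q
    proof -
      obtain i k i' k' where "p = {Dt i k, Ut i k}" "q = {Dt i' k', Ut i' k'}"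
        using pq(1,2) by (auto simp: F_def)
      then show ?thesis using pq(3) by auto
    qed
    fix P assume P: "P \<in> tilings R'"
    have "{Dt i (int k), Ut i (int k)} \<in> P" if "Dt i (int k) \<in> G" for i k
      using that
    proof (induction k arbitrary: i rule: less_induct)
      case (less k)
      have "Dt i (int k) \<in> \<Union>P" using inR'(1)[OF less.prems] tilingsD(1)[OF P] by simp
      then obtain p where p: "p \<in> P" "Dt i (int k) \<in> p" by blast
      then obtain s where s: "p = {s, Dt i (int k)}"
        using tilingsD(3)[OF P] by (auto elim!: lozengeE)
      have loz: "{s, Dt i (int k)} \<in> lozenges" using p(1) s tilingsD(3)[OF P] by auto
      have sR': "s \<in> R'" using p(1) s tilingsD(1)[OF P] by auto
      have "s \<in> unit_triangles" using loz by (simp add: lozenge_iff)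
      then obtain j l where sU: "s = Ut j l"
      proof (cases rule: unit_triangle_cases)
        case (2 j l)
        then show ?thesis using loz Dt_Dt_lozenge by simp
      qed blast
      have "j = i \<and> l = int k \<or> l = int k - 1 \<and> j \<in> {i, i + 1}"
        using loz unfolding sU Ut_Dt_lozenge by auto
      then show ?case
      proof
        assume "j = i \<and> l = int k"
        then show ?thesis using p(1) s sU by (simp add: insert_commute)
      next
        assume jl: "l = int k - 1 \<and> j \<in> {i, i + 1}"
        have "s \<in> R" using sR' by (simp add: R'_def)
        then have sT: "Ut j l \<in> G" using D(2)[OF less.prems, of j] jl by (simp add: sU)
        have False
        proof (cases "l = 0")
          case True
          then obtain e where "s = UP e 0" using Ut0[of j] \<open>s \<in> R\<close> sU by auto
          then show ?thesis using sT sR' sU by (auto simp: R'_def)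
        next
          case False
          then have l: "0 < l" using jl k1[OF less.prems] by linarith
          define k' where "k' = nat l"
          have k': "l = int k'" "k' < k" using l jl by (auto simp: k'_def)
          have "{Dt j (int k'), Ut j (int k')} \<in> P"
            using less.IH[OF k'(2), of j] U[OF l sT] k'(1) by simp
          moreover have "{Dt j (int k'), Ut j (int k')} \<inter> p \<noteq> {}" using s sU k'(1) by simp
          ultimately have "p = {Dt j (int k'), Ut j (int k')}"
            using tilingsD(2)[OF P p(1)] by blast
          then have "Dt i (int k) \<in> {Dt j (int k'), Ut j (int k')}" using p(2) by simp
          then show False using k'(2) by simp
        qed
        then show ?thesis ..
      qed
    qed
    then show "F \<subseteq> P"
    proof (intro subsetI)
      fix p assume *: "\<And>i k. Dt i (int k) \<in> G \<Longrightarrow> {Dt i (int k), Ut i (int k)} \<in> P" and "p \<in> F"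
      then obtain i k where p: "p = {Dt i k, Ut i k}" "Dt i k \<in> G" by (auto simp: F_def)
      then show "p \<in> P" using *[of i "nat k"] k1[OF p(2)] by simp
    qed
  qed
  also have "R' - \<Union>F = R - G - ups 0 S"
  proof (intro equalityI subsetI)
    fix t assume t: "t \<in> R' - \<Union>F"
    have "t \<notin> G"
    proof
      assume tT: "t \<in> G"
      then have "t \<in> unit_triangles" using TR rows_unit[of W n 0] unfolding R_def by blast
      then show False
      proof (cases rule: unit_triangle_cases)
        case (1 i k)
        show False
        proof (cases "0 < k")
          case True
          then have "Dt i k \<in> G" using U tT 1 by simp
          then show False using t 1 by (auto simp: F_def)
        next
          case False
          then have "k = 0" using tT TR 1 by (auto simp: R_def Ut_rows)
          then obtain e where "t = UP e 0" using Ut0[of i] tT TR 1 by auto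
          then show False using t tT by (auto simp: R'_def)
        qed
      next
        case (2 i k)
        then show False using t tT by (auto simp: F_def)
      qed
    qed
    then show "t \<in> R - G - ups 0 S" using t by (auto simp: R'_def)
  next
    fix t assume t: "t \<in> R - G - ups 0 S"
    then have "t \<notin> \<Union>F" using D(1) by (auto simp: F_def)
    moreover have "t \<in> R'" using t by (auto simp: R'_def)
    ultimately show "t \<in> R' - \<Union>F" by simp
  qed
  finally show ?thesis by (simp add: R'_def R_def)
qed

definition mirror :: "triangle \<Rightarrow> triangle" where
  "mirror t = (\<lambda>(u, k). (u, - k)) ` t"

lemma mirror_mirror [simp]: "mirror (mirror t) = t"
  by (simp add: mirror_def image_image case_prod_unfold)

lemma mirror_inj: "inj mirror"
  by (rule inj_on_inverseI[where g = mirror]) simp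

lemma mirror_Ut [simp]: "mirror (Ut i k) = Dt (i + k) (- k)"
proof -
  have v: "(\<lambda>(u, k). (u, - k)) (vertex (i, k)) = vertex (i + k, - k)" for i k
    by (simp add: vertex_def field_simps)
  have e: "i + 1 + k = i + k + 1" "i + (k + 1) = i + k + 1" "- (k + 1) = - k - 1" by simp_all
  show ?thesis unfolding mirror_def Ut_vertex Dt_vertex by (simp only: image_insert image_empty v e)
qed

lemma mirror_Dt [simp]: "mirror (Dt i k) = Ut (i + k) (- k)"
  by (metis add.right_neutral add.right_inverse add.assoc minus_minus mirror_Ut mirror_mirror)

lemma mirror_unit: "mirror t \<in> unit_triangles \<longleftrightarrow> t \<in> unit_triangles"
proof -
  have "mirror t \<in> unit_triangles" if "t \<in> unit_triangles" for t
    using that by (cases rule: unit_triangle_cases) simp_all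
  from this[of t] this[of "mirror t"] show ?thesis by auto
qed

lemma mirror_lozenge: "{mirror s, mirror t} \<in> lozenges \<longleftrightarrow> {s, t} \<in> lozenges"
proof -
  have "inj (\<lambda>(u, k). (u, - k) :: point)" by (auto simp: inj_def)
  then have "card (mirror s \<inter> mirror t) = card (s \<inter> t)"
    unfolding mirror_def by (metis card_image image_Int inj_on_subset subset_UNIV)
  then show ?thesis by (simp add: lozenge_iff mirror_unit)
qed

lemma M_mirror: "M (mirror ` R) = M R"
proof -
  have sub: "(\<lambda>P. (`) mirror ` P) ` tilings R \<subseteq> tilings (mirror ` R)" for R
  proof (rule image_subsetI)
    fix P assume P: "P \<in> tilings R"
    show "(`) mirror ` P \<in> tilings (mirror ` R)"
    proof (rule tilingsI)
      show "\<Union>((`) mirror ` P) = mirror ` R" using tilingsD(1)[OF P] by auto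
      show "(`) mirror ` P \<subseteq> lozenges"
      proof (rule image_subsetI)
        fix p assume "p \<in> P"
        then have "p \<in> lozenges" using tilingsD(3)[OF P] by blast
        moreover from this obtain s t where "p = {s, t}" by (rule lozengeE)
        ultimately show "mirror ` p \<in> lozenges" by (simp add: mirror_lozenge)
      qed
      fix p q assume "p \<in> (`) mirror ` P" "q \<in> (`) mirror ` P" "p \<noteq> q"
      then obtain p' q' where pq: "p = mirror ` p'" "q = mirror ` q'" "p' \<in> P" "q' \<in> P" "p' \<noteq> q'" by auto
      then have "p' \<inter> q' = {}" using tilingsD(2)[OF P] by blast
      then show "p \<inter> q = {}" unfolding pq(1,2) image_Int[OF mirror_inj, symmetric] by simp
    qed
  qed
  have inv: "mirror ` mirror ` X = X" for X by (simp add: image_image)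
  have "bij_betw (\<lambda>P. (`) mirror ` P) (tilings R) (tilings (mirror ` R))"
  proof (rule bij_betw_byWitness[where f' = "\<lambda>P. (`) mirror ` P"])
    show "\<forall>P\<in>tilings R. (`) mirror ` (`) mirror ` P = P"
      "\<forall>P\<in>tilings (mirror ` R). (`) mirror ` (`) mirror ` P = P" by (simp_all add: image_image)
    show "(\<lambda>P. (`) mirror ` P) ` tilings (mirror ` R) \<subseteq> tilings R" using sub[of "mirror ` R"] inv by simp
  qed (rule sub)
  then show ?thesis unfolding M_def by (rule bij_betw_same_card[symmetric])
qed

lemma mirror_image_mem: "t \<in> mirror ` R \<longleftrightarrow> mirror t \<in> R"
  by (metis image_iff mirror_mirror)

lemma mirror_cells: "mirror ` cells {(u, k). Pr u k} = cells {(u, k). Pr u (- k)}"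
proof (rule Set.set_eqI)
  fix t
  have "mirror t \<subseteq> {(u, k). Pr u k} \<longleftrightarrow> t \<subseteq> {(u, k). Pr u (- k)}" by (auto simp: mirror_def)
  then show "t \<in> mirror ` cells {(u, k). Pr u k} \<longleftrightarrow> t \<in> cells {(u, k). Pr u (- k)}"
    unfolding mirror_image_mem by (simp add: cells_def mirror_unit)
qed

lemma zigzag_minus [simp]: "zigzag (- k) = zigzag k"
  by (simp add: zigzag_def)

lemma down_triangle_mirror: "down_triangle p s = mirror ` up_triangle p s"
  unfolding up_triangle_def mirror_cells down_triangle_def by (rule arg_cong[where f = cells]) auto

lemma lower_cells:
  "cells {(u, k). - int (2 * n) \<le> k \<and> k \<le> 0 \<and> zigzag k \<le> u \<and> u \<le> real L - of_int k / 2
      \<and> u \<le> real L + real z + of_int k / 2}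
    = mirror ` (rows (L + z) n 0 - up_triangle L z)"
proof -
  have "rows (L + z) n 0 - up_triangle L z = cells {(u, k). - int (2 * n) \<le> - k \<and> - k \<le> 0 \<and> zigzag (- k) \<le> u
      \<and> u \<le> real L - of_int (- k) / 2 \<and> u \<le> real L + real z + of_int (- k) / 2}" (is "?R = cells ?X")
  proof (rule region_eqI[OF _ cells_unit])
    show "?R \<subseteq> unit_triangles" using rows_unit by blast
    have X: "?X = {(u, k). 0 \<le> k \<and> k \<le> int (2 * n) \<and> zigzag k \<le> u \<and> u \<le> real L + of_int k / 2
      \<and> u \<le> real (L + z) - of_int k / 2}" by auto
    fix i k
    show "Ut i k \<in> ?R \<longleftrightarrow> Ut i k \<in> cells ?X"
      unfolding X Diff_iff up_triangle_mem cells_mem Ut_rows vertex_def mem_Collect_eq case_prod_conv zigzag_le east_le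
      by (simp add: algebra_simps) linarith
    show "Dt i k \<in> ?R \<longleftrightarrow> Dt i k \<in> cells ?X"
      unfolding X Diff_iff up_triangle_mem cells_mem Dt_rows vertex_def mem_Collect_eq case_prod_conv zigzag_le east_le
      by (simp add: algebra_simps) linarith
  qed
  then show ?thesis by (simp only: mirror_cells minus_minus)
qed

definition cut :: "region \<Rightarrow> nat set" where
  "cut R = {e. UP e 0 \<in> R}"

lemma M_glue:
  assumes R: "R \<subseteq> rows W n 0" "R' \<subseteq> rows W' n' 0"
  shows "M (R \<union> mirror ` R') = (\<Sum>S\<in>Pow (cut R \<inter> cut R'). M (R - ups 0 S) * M (R' - ups 0 S))"
proof -
  define I where "I = cut R \<inter> cut R'"
  have pos: "(\<exists>i k. t = Ut i k \<and> 0 \<le> k) \<or> (\<exists>i k. t = Dt i k \<and> 1 \<le> k)" if "t \<in> rows W n 0" for t W n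
  proof -
    have "t \<in> unit_triangles" using that rows_unit by blast
    then show ?thesis by (cases rule: unit_triangle_cases) (use that in \<open>auto simp: Ut_rows Dt_rows\<close>)
  qed
  have fin: "finite R" "finite R'" 
    by (rule finite_subset[OF R(1)], simp) (rule finite_subset[OF R(2)], simp)
  have UP0: "UP e 0 = Ut (int e) 0" for e by (simp add: UP_def)
  have "M (R \<union> mirror ` R') = (\<Sum>S\<in>Pow I. M (R - ups 0 S) * M (mirror ` R' - (\<lambda>e. mirror (UP e 0)) ` S))"
  proof (rule M_split)
    show "R \<inter> mirror ` R' = {}"
    proof (rule equals0I)
      fix t assume "t \<in> R \<inter> mirror ` R'"
      then have t: "t \<in> rows W n 0" "mirror t \<in> rows W' n' 0" using R by (auto simp: mirror_image_mem)
      show False using pos[OF t(1)] pos[OF t(2)] by auto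
    qed
    show "finite I"
    proof (rule finite_subset)
      show "I \<subseteq> {..<W}" using R(1) by (auto simp: I_def cut_def)
    qed simp
    show "inj_on (\<lambda>e. UP e 0) I" "inj_on (\<lambda>e. mirror (UP e 0)) I"
      by (rule inj_onI; auto dest!: injD[OF mirror_inj])+
    show "ups 0 I \<subseteq> R" "(\<lambda>e. mirror (UP e 0)) ` I \<subseteq> mirror ` R'" by (auto simp: I_def cut_def)
    fix s t assume s: "s \<in> R" and "t \<in> mirror ` R'"
    then have t: "mirror t \<in> R'" by (simp add: mirror_image_mem)
    have "{s, t} \<in> lozenges \<longleftrightarrow> (\<exists>i. s = Ut i 0 \<and> t = Dt i 0)"
    proof -
      have s': "(\<exists>i k. s = Ut i k \<and> 0 \<le> k) \<or> (\<exists>i k. s = Dt i k \<and> 1 \<le> k)" using pos s R by blast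
      have "(\<exists>i k. mirror t = Ut i k \<and> 0 \<le> k) \<or> (\<exists>i k. mirror t = Dt i k \<and> 1 \<le> k)" using pos t R by blast
      then have t': "(\<exists>i k. t = Dt i k \<and> k \<le> 0) \<or> (\<exists>i k. t = Ut i k \<and> k \<le> - 1)"
      proof
        assume "\<exists>i k. mirror t = Ut i k \<and> 0 \<le> k"
        then obtain i k where "mirror t = Ut i k" "0 \<le> k" by blast
        then have "t = Dt (i + k) (- k)" "- k \<le> 0" using mirror_mirror[of t] by simp_all
        then show ?thesis by blast
      next
        assume "\<exists>i k. mirror t = Dt i k \<and> 1 \<le> k"
        then obtain i k where "mirror t = Dt i k" "1 \<le> k" by blast
        then have "t = Ut (i + k) (- k)" "- k \<le> - 1" using mirror_mirror[of t] by simp_all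
        then show ?thesis by blast
      qed
      have DU: "{Dt i k, Ut i' k'} = {Ut i' k', Dt i k}" for i k i' k' by blast
      from s' t' show ?thesis
        by (elim disjE exE conjE) (auto simp: Ut_Dt_lozenge Ut_Ut_lozenge Dt_Dt_lozenge DU)
    qed
    also have "\<dots> \<longleftrightarrow> (\<exists>e\<in>I. s = UP e 0 \<and> t = mirror (UP e 0))"
    proof
      assume "\<exists>i. s = Ut i 0 \<and> t = Dt i 0"
      then obtain i where i: "s = Ut i 0" "t = Dt i 0" by blast
      have "s \<in> rows W n 0" using s R by blast
      then have "0 \<le> i" by (simp add: i Ut_rows)
      then have "s = UP (nat i) 0" "t = mirror (UP (nat i) 0)" by (simp_all add: i UP0)
      moreover have "nat i \<in> I" using s t calculation by (simp add: I_def cut_def)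
      ultimately show "\<exists>e\<in>I. s = UP e 0 \<and> t = mirror (UP e 0)" by blast
    qed (auto simp: UP0)
    finally show "{s, t} \<in> lozenges \<longleftrightarrow> (\<exists>e\<in>I. s = UP e 0 \<and> t = mirror (UP e 0))" .
  qed (use fin in simp_all)
  also have "\<dots> = (\<Sum>S\<in>Pow I. M (R - ups 0 S) * M (R' - ups 0 S))"
  proof (rule sum.cong[OF refl])
    fix S
    have "mirror ` R' - (\<lambda>e. mirror (UP e 0)) ` S = mirror ` (R' - ups 0 S)"
      by (simp add: image_set_diff[OF mirror_inj] image_image)
    then show "M (R - ups 0 S) * M (mirror ` R' - (\<lambda>e. mirror (UP e 0)) ` S) = M (R - ups 0 S) * M (R' - ups 0 S)"
      by (simp add: M_mirror)
  qed
  finally show ?thesis by (simp add: I_def)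
qed

section \<open>The weight and its moments\<close>

abbreviation rfact :: "nat \<Rightarrow> real" where
  "rfact \<equiv> fact"

definition oddfact :: "nat \<Rightarrow> real" where
  "oddfact m = (\<Prod>i<m. 2 * real i + 1)"

lemma oddfact_Suc [simp]: "oddfact (Suc m) = (2 * real m + 1) * oddfact m"
  by (simp add: oddfact_def)

lemma oddfact_pos [simp]: "oddfact m > 0"
  unfolding oddfact_def by (intro prod_pos) auto

lemma oddfact_nonzero [simp]: "oddfact m \<noteq> 0"
  using oddfact_pos[of m] by linarith

lemma oddfact_add: "oddfact (m + n) = oddfact m * (\<Prod>r<n. 2 * (real m + real r) + 1)"
  by (induction n) simp_all

lemma rfact_add: "rfact (m + n) = rfact m * (\<Prod>r<n. real m + 1 + real r)"
  by (induction n) (simp_all add: algebra_simps)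

definition wt :: "nat \<Rightarrow> nat \<Rightarrow> nat \<Rightarrow> nat \<Rightarrow> real" where
  "wt a K N l = real l * rfact (l + a) * rfact (K - l) * rfact (K + l)
     / (rfact (l - a - 1) * rfact (N - l) * rfact (N + l))"

lemma wt_Suc_a:
  assumes "Suc a < l"
  shows "wt (Suc a) K N l = ((real l)\<^sup>2 - (real a + 1)\<^sup>2) * wt a K N l"
proof -
  obtain i where l: "l = a + 2 + i" using assms less_imp_Suc_add[of "Suc a" l] by auto
  have "l - a - 1 = Suc i" "l - Suc a - 1 = i" "l + Suc a = Suc (l + a)" by (simp_all add: l)
  moreover have "(real l)\<^sup>2 - (real a + 1)\<^sup>2 = real (Suc i) * real (Suc (l + a))"
    by (simp add: l power2_eq_square algebra_simps)
  ultimately show ?thesis by (simp add: wt_def mult.assoc mult.left_commute del: of_nat_Suc)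
qed

lemma wt_pred_N:
  assumes "l \<le> N"
  shows "wt a K N l = ((real N + 1)\<^sup>2 - (real l)\<^sup>2) * wt a K (Suc N) l"
proof -
  obtain i where N: "N = l + i" using assms le_Suc_ex by blast
  have "Suc N - l = Suc i" "N - l = i" "Suc N + l = Suc (N + l)" by (simp_all add: N)
  moreover have "(real N + 1)\<^sup>2 - (real l)\<^sup>2 = real (Suc i) * real (Suc (N + l))"
    by (simp add: N power2_eq_square algebra_simps)
  ultimately show ?thesis by (simp add: wt_def del: of_nat_Suc)
qed

lemma wt_Suc_K:
  assumes "l \<le> K"
  shows "wt a (Suc K) N l = ((real K + 1)\<^sup>2 - (real l)\<^sup>2) * wt a K N l"
proof -
  obtain i where K: "K = l + i" using assms le_Suc_ex by blast
  have "Suc K - l = Suc i" "K - l = i" "Suc K + l = Suc (K + l)" by (simp_all add: K)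
  moreover have "(real K + 1)\<^sup>2 - (real l)\<^sup>2 = real (Suc i) * real (Suc (K + l))"
    by (simp add: K power2_eq_square algebra_simps)
  ultimately show ?thesis by (simp add: wt_def del: of_nat_Suc)
qed

definition wsum :: "nat \<Rightarrow> nat \<Rightarrow> nat \<Rightarrow> real" where
  "wsum a K N = (\<Sum>l\<in>{a<..N}. wt a K N l)"

lemma wsum_rec:
  assumes "a \<le> N"
  shows "wsum (Suc a) K (Suc N) + wsum a K N = ((real N + 1)\<^sup>2 - (real a + 1)\<^sup>2) * wsum a K (Suc N)"
proof -
  have "wsum (Suc a) K (Suc N) = (\<Sum>l\<in>{Suc a<..Suc N}. ((real l)\<^sup>2 - (real a + 1)\<^sup>2) * wt a K (Suc N) l)"
    unfolding wsum_def by (intro sum.cong) (auto simp: wt_Suc_a)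
  also have "\<dots> = (\<Sum>l\<in>{a<..Suc N}. ((real l)\<^sup>2 - (real a + 1)\<^sup>2) * wt a K (Suc N) l)"
  proof (rule sum.mono_neutral_left)
    show "\<forall>l\<in>{a<..Suc N} - {Suc a<..Suc N}. ((real l)\<^sup>2 - (real a + 1)\<^sup>2) * wt a K (Suc N) l = 0"
    proof
      fix l assume "l \<in> {a<..Suc N} - {Suc a<..Suc N}"
      then have "l = Suc a" by auto
      then show "((real l)\<^sup>2 - (real a + 1)\<^sup>2) * wt a K (Suc N) l = 0" by (simp add: add.commute)
    qed
  qed auto
  finally have 1: "wsum (Suc a) K (Suc N) = \<dots>" .
  have "wsum a K N = (\<Sum>l\<in>{a<..N}. ((real N + 1)\<^sup>2 - (real l)\<^sup>2) * wt a K (Suc N) l)"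
    unfolding wsum_def by (intro sum.cong refl wt_pred_N) simp
  also have "\<dots> = (\<Sum>l\<in>{a<..Suc N}. ((real N + 1)\<^sup>2 - (real l)\<^sup>2) * wt a K (Suc N) l)"
  proof (rule sum.mono_neutral_left)
    show "\<forall>l\<in>{a<..Suc N} - {a<..N}. ((real N + 1)\<^sup>2 - (real l)\<^sup>2) * wt a K (Suc N) l = 0"
    proof
      fix l assume "l \<in> {a<..Suc N} - {a<..N}"
      then have "l = Suc N" by auto
      then show "((real N + 1)\<^sup>2 - (real l)\<^sup>2) * wt a K (Suc N) l = 0" by (simp add: add.commute)
    qed
  qed auto
  finally have 2: "wsum a K N = \<dots>" .
  show ?thesis
    unfolding 1 2 unfolding wsum_def sum_distrib_left sum.distrib[symmetric]
    by (intro sum.cong refl) (simp add: algebra_simps)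
qed

lemma wsum_eq:
  "wsum a (a + 1 + x + c) (a + 1 + x) = rfact c * rfact (2 * a + x + c + 2) * oddfact (a + x + c + 2) * oddfact (a + 1)
     / (2 * rfact x * oddfact (a + 1 + x) * oddfact (a + c + 2))"
proof (induction x arbitrary: a c)
  case 0
  have "{a<..a + 1 + 0} = {a + 1}" by auto
  then have "wsum a (a + 1 + 0 + c) (a + 1 + 0) = wt a (a + 1 + c) (a + 1) (a + 1)"
    by (simp add: wsum_def)
  also have "\<dots> = real (a + 1) * rfact (2 * a + 1) * rfact c * rfact (2 * a + c + 2) / rfact (2 * a + 2)"
    by (simp add: wt_def mult_2 del: fact_Suc) (simp add: algebra_simps)
  also have "rfact (2 * a + 2) = 2 * real (a + 1) * rfact (2 * a + 1)"
    by (simp add: algebra_simps)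
  also have "real (a + 1) * rfact (2 * a + 1) * rfact c * rfact (2 * a + c + 2) / (2 * real (a + 1) * rfact (2 * a + 1))
      = rfact c * rfact (2 * a + c + 2) / 2"
  proof -
    have "r * f * u * v / (2 * r * f) = u * v / 2" if "r \<noteq> 0" "f \<noteq> 0" for r f u v :: real
      using that by simp
    from this[of "real (a + 1)" "rfact (2 * a + 1)"] show ?thesis by (simp del: fact_Suc of_nat_add)
  qed
  finally show ?case by (simp add: field_simps del: fact_Suc oddfact_Suc)
next
  case (Suc x)
  define N where "N = a + 1 + x"
  define K where "K = a + 1 + Suc x + c"
  have 1: "wsum (Suc a) K (Suc N) = rfact c * rfact (2 * a + x + c + 4) * oddfact (a + x + c + 3) * oddfact (a + 2)
     / (2 * rfact x * oddfact (a + x + 2) * oddfact (a + c + 3))"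
    using Suc.IH[of "Suc a" c] by (simp add: N_def K_def numeral_eq_Suc del: fact_Suc oddfact_Suc)
  have 2: "wsum a K N = rfact (c + 1) * rfact (2 * a + x + c + 3) * oddfact (a + x + c + 3) * oddfact (a + 1)
     / (2 * rfact x * oddfact (a + x + 1) * oddfact (a + c + 3))"
    using Suc.IH[of a "Suc c"] by (simp add: N_def K_def numeral_eq_Suc del: fact_Suc oddfact_Suc)
  have nz: "(real N + 1)\<^sup>2 - (real a + 1)\<^sup>2 = (real x + 1) * (2 * real a + real x + 3)"
    by (simp add: N_def power2_eq_square algebra_simps)
  define A where "A = rfact c * rfact (2 * a + x + c + 3) * oddfact (a + x + c + 3) * oddfact (a + 1)
     / (2 * rfact x * oddfact (a + x + 1) * oddfact (a + c + 2))"
  define t where "t = 2 * real a + 2 * real c + 5"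
  define s where "s = 2 * real a + 2 * real x + 3"
  have t: "t > 0" and s: "s > 0" by (simp_all add: t_def s_def)
  have o: "oddfact (a + c + 3) = t * oddfact (a + c + 2)" "oddfact (a + x + 2) = s * oddfact (a + x + 1)"
    "oddfact (a + 2) = (2 * real a + 3) * oddfact (a + 1)"
    "rfact (c + 1) = (real c + 1) * rfact c"
    "rfact (2 * a + x + c + 4) = (2 * real a + real x + real c + 4) * rfact (2 * a + x + c + 3)"
    "rfact (Suc x) = (real x + 1) * rfact x"
    by (simp_all add: t_def s_def numeral_eq_Suc algebra_simps)
  have 1: "wsum (Suc a) K (Suc N) = A * ((2 * real a + real x + real c + 4) * (2 * real a + 3) / (s * t))"
    unfolding 1 o A_def using s t by (simp add: field_simps del: fact_Suc oddfact_Suc)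
  have 2: "wsum a K N = A * ((real c + 1) / t)"
    unfolding 2 o A_def using t by (simp add: field_simps del: fact_Suc oddfact_Suc)
  have "((real x + 1) * (2 * real a + real x + 3)) * wsum a K (Suc N)
      = A * ((2 * real a + real x + real c + 4) * (2 * real a + 3) / (s * t) + (real c + 1) / t)"
    using wsum_rec[of a N K] unfolding nz 1 2 by (simp add: N_def distrib_left)
  also have "(2 * real a + real x + real c + 4) * (2 * real a + 3) / (s * t) + (real c + 1) / t
      = (2 * real a + real x + 3) / s"
  proof -
    have "(2 * real a + real x + real c + 4) * (2 * real a + 3) + (real c + 1) * s = (2 * real a + real x + 3) * t"
      by (simp add: s_def t_def algebra_simps)
    moreover have "(2 * real a + real x + real c + 4) * (2 * real a + 3) / (s * t) + (real c + 1) / t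
        = ((2 * real a + real x + real c + 4) * (2 * real a + 3) + (real c + 1) * s) / (s * t)"
    proof -
      have "(real c + 1) / t = (real c + 1) * s / (s * t)" using s by simp
      then show ?thesis by (simp only: add_divide_distrib)
    qed
    ultimately show ?thesis using t by simp
  qed
  finally have e: "(real x + 1) * (2 * real a + real x + 3) * wsum a K (Suc N)
      = A * ((2 * real a + real x + 3) / s)" .
  have gen: "w = A / (s * p)" if "p \<noteq> 0" "d \<noteq> 0" "p * d * w = A * (d / s)" for p d w :: real
  proof -
    have "d * (p * w) = d * (A / s)" using that(3) by (simp add: ac_simps)
    then have "p * w = A / s" using mult_left_cancel[OF that(2)] by blast
    then show ?thesis using that(1) s by (simp add: field_simps)
  qed
  have "wsum a K (Suc N) = A / (s * (real x + 1))" by (rule gen[OF _ _ e]) simp_all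
  also have "\<dots> = rfact c * rfact (2 * a + Suc x + c + 2) * oddfact (a + Suc x + c + 2) * oddfact (a + 1)
     / (2 * rfact (Suc x) * oddfact (a + 1 + Suc x) * oddfact (a + c + 2))"
  proof -
    have "2 * a + Suc x + c + 2 = 2 * a + x + c + 3" "a + Suc x + c + 2 = a + x + c + 3"
      "a + 1 + Suc x = a + x + 2" by simp_all
    then show ?thesis unfolding A_def o(2,6) by (simp only: o(2,6)) (simp add: field_simps del: fact_Suc oddfact_Suc)
  qed
  finally show ?case by (simp only: K_def N_def add_Suc_right)
qed

lemma wt_prod_a:
  assumes "a < l"
  shows "wt a K N l * (\<Prod>r<i. (real l)\<^sup>2 - (real (a + r) + 1)\<^sup>2) = (if a + i < l then wt (a + i) K N l else 0)"
proof (induction i)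
  case (Suc i)
  show ?case
  proof (cases "a + i < l")
    case True
    then show ?thesis using Suc wt_Suc_a[of "a + i" l K N]
      by (cases "Suc (a + i) < l") (auto simp: mult.assoc[symmetric] mult.commute not_less dest!: le_antisym)
  qed (use Suc in \<open>simp add: mult.assoc[symmetric]\<close>)
qed (use assms in simp)

lemma wt_prod_K:
  assumes "l \<le> K"
  shows "wt a K N l * (\<Prod>r<j. (real l)\<^sup>2 - (real (K + r) + 1)\<^sup>2) = (-1) ^ j * wt a (K + j) N l"
proof (induction j)
  case (Suc j)
  have "wt a K N l * (\<Prod>r<Suc j. (real l)\<^sup>2 - (real (K + r) + 1)\<^sup>2)
      = (wt a K N l * (\<Prod>r<j. (real l)\<^sup>2 - (real (K + r) + 1)\<^sup>2)) * ((real l)\<^sup>2 - (real (K + j) + 1)\<^sup>2)"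
    by (simp only: prod.lessThan_Suc mult.assoc)
  also have "\<dots> = (-1) ^ Suc j * (((real (K + j) + 1)\<^sup>2 - (real l)\<^sup>2) * wt a (K + j) N l)"
    unfolding Suc.IH by (simp add: algebra_simps)
  also have "\<dots> = (-1) ^ Suc j * wt a (Suc (K + j)) N l"
    using assms by (subst wt_Suc_K) simp_all
  finally show ?case by simp
qed simp

lemma moment:
  assumes "N \<le> K"
  shows "(\<Sum>l\<in>{a<..N}. wt a K N l * (\<Prod>r<i. (real l)\<^sup>2 - (real (a + r) + 1)\<^sup>2)
      * (\<Prod>r<j. (real l)\<^sup>2 - (real (K + r) + 1)\<^sup>2)) = (-1) ^ j * wsum (a + i) (K + j) N"
proof -
  have "(\<Sum>l\<in>{a<..N}. wt a K N l * (\<Prod>r<i. (real l)\<^sup>2 - (real (a + r) + 1)\<^sup>2)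
      * (\<Prod>r<j. (real l)\<^sup>2 - (real (K + r) + 1)\<^sup>2))
    = (\<Sum>l\<in>{a<..N}. if a + i < l then (-1) ^ j * wt (a + i) (K + j) N l else 0)"
  proof (rule sum.cong[OF refl])
    fix l assume "l \<in> {a<..N}"
    then have l: "a < l" "l \<le> K" using assms by auto
    show "wt a K N l * (\<Prod>r<i. (real l)\<^sup>2 - (real (a + r) + 1)\<^sup>2)
      * (\<Prod>r<j. (real l)\<^sup>2 - (real (K + r) + 1)\<^sup>2) = (if a + i < l then (-1) ^ j * wt (a + i) (K + j) N l else 0)"
      unfolding wt_prod_a[OF l(1)] using wt_prod_K[OF l(2), of "a + i" N j] by auto
  qed
  also have "\<dots> = (\<Sum>l\<in>{a + i<..N}. (-1) ^ j * wt (a + i) (K + j) N l)"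
    by (intro sum.mono_neutral_cong_right) auto
  finally show ?thesis by (simp add: wsum_def sum_distrib_left)
qed

section \<open>The Hankel determinant\<close>

lemma alternating_sum_affine:
  fixes \<alpha> \<beta> :: "nat \<Rightarrow> real"
  assumes "d < n"
  shows "(\<Sum>k\<le>n. (-1) ^ k * real (n choose k) * (\<Prod>r<d. \<alpha> r * real k + \<beta> r)) = 0"
  using assms
proof (induction d arbitrary: n \<beta>)
  case 0
  then show ?case using choose_alternating_sum[of n, where 'a = real] by simp
next
  case (Suc d)
  then obtain m where n: "n = Suc m" by (cases n) auto
  define g where "g k = (\<Prod>r<d. \<alpha> r * real k + \<beta> r)" for k
  have "(\<Sum>k\<le>n. (-1) ^ k * real (n choose k) * (\<Prod>r<Suc d. \<alpha> r * real k + \<beta> r))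
     = \<alpha> d * (\<Sum>k\<le>n. (-1) ^ k * (real k * real (n choose k)) * g k)
       + \<beta> d * (\<Sum>k\<le>n. (-1) ^ k * real (n choose k) * g k)"
    unfolding sum_distrib_left sum.distrib[symmetric]
    by (intro sum.cong refl) (simp add: g_def algebra_simps)
  also have "(\<Sum>k\<le>n. (-1) ^ k * real (n choose k) * g k) = 0"
    using Suc.IH[of n \<beta>] Suc.prems by (simp add: g_def)
  also have "(\<Sum>k\<le>n. (-1) ^ k * (real k * real (n choose k)) * g k)
     = (\<Sum>k\<le>m. (-1) ^ Suc k * (real (Suc k) * real (Suc m choose Suc k)) * g (Suc k))"
    unfolding n by (subst sum.atMost_Suc_shift) simp
  also have "\<dots> = (\<Sum>k\<le>m. - real (Suc m) * ((-1) ^ k * real (m choose k) * g (Suc k)))"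
  proof (rule sum.cong[OF refl])
    fix k
    have eq: "real (Suc k) * real (Suc m choose Suc k) = real (Suc m) * real (m choose k)"
      by (metis Suc_times_binomial_eq of_nat_mult mult.commute)
    show "(-1) ^ Suc k * (real (Suc k) * real (Suc m choose Suc k)) * g (Suc k)
      = - real (Suc m) * ((-1) ^ k * real (m choose k) * g (Suc k))" unfolding eq by (simp del: of_nat_Suc)
  qed
  also have "\<dots> = - real (Suc m) * (\<Sum>k\<le>m. (-1) ^ k * real (m choose k) * g (Suc k))"
    by (simp only: sum_distrib_left)
  also have "(\<Sum>k\<le>m. (-1) ^ k * real (m choose k) * g (Suc k)) = 0"
  proof -
    have "g (Suc k) = (\<Prod>r<d. \<alpha> r * real k + (\<alpha> r + \<beta> r))" for k
      unfolding g_def by (intro prod.cong refl) (simp add: algebra_simps)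
    then show ?thesis using Suc.IH[of m "\<lambda>r. \<alpha> r + \<beta> r"] Suc.prems n by simp
  qed
  finally show ?case by simp
qed

lemma alternating_sum_divided:
  fixes \<beta> :: "nat \<Rightarrow> real"
  assumes "d \<le> n" "c > 0"
  shows "(\<Sum>k\<le>n. (-1) ^ k * real (n choose k) * (\<Prod>r<d. real k + \<beta> r) / (real k + c))
    = (\<Prod>r<d. \<beta> r - c) * (\<Sum>k\<le>n. (-1) ^ k * real (n choose k) / (real k + c))"
  using assms(1)
proof (induction d)
  case (Suc d)
  define g where "g k = (-1) ^ k * real (n choose k) * (\<Prod>r<d. real k + \<beta> r)" for k :: nat
  have "(\<Sum>k\<le>n. (-1) ^ k * real (n choose k) * (\<Prod>r<Suc d. real k + \<beta> r) / (real k + c))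
      = (\<Sum>k\<le>n. g k + (\<beta> d - c) * (g k / (real k + c)))"
  proof (rule sum.cong[OF refl])
    fix k
    have "real k + c \<noteq> 0" using assms(2) by (simp add: add_nonneg_eq_0_iff)
    then have "g k * (real k + \<beta> d) / (real k + c) = g k + (\<beta> d - c) * (g k / (real k + c))"
      by (simp add: field_simps)
    then show "(-1) ^ k * real (n choose k) * (\<Prod>r<Suc d. real k + \<beta> r) / (real k + c)
      = g k + (\<beta> d - c) * (g k / (real k + c))" by (simp add: g_def mult.assoc)
  qed
  also have "\<dots> = (\<Sum>k\<le>n. g k) + (\<beta> d - c) * (\<Sum>k\<le>n. g k / (real k + c))"
    by (simp add: sum.distrib sum_distrib_left)
  also have "(\<Sum>k\<le>n. g k) = 0"
    using alternating_sum_affine[of d n "\<lambda>_. 1" \<beta>] Suc.prems by (simp add: g_def)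
  finally show ?case using Suc by (simp add: g_def)
qed simp

lemma hankel_det:
  shows "\<exists>C. \<forall>N\<ge>y. det (mat y y (\<lambda>(i, j). rfact (N + q + i + j) / oddfact (q + 1 + i + j)))
    = C * (\<Prod>n<y. rfact (N + q + n) * oddfact N / oddfact (N - n))"
proof -
  define t where "t N n k = (-1) ^ k * real (n choose k) * oddfact (q + k + n) / rfact (N + q + k)" for N n k
  define v where "v n = (\<Sum>k\<le>n. (-1) ^ k * real (n choose k) / (real k + (real q + real n + 1 / 2))) / 2 ^ (n + 1)" for n
  define C where "C = (\<Prod>n<y. v n / ((-1) ^ n * oddfact (q + 2 * n)))"
  have "det (mat y y (\<lambda>(i, j). rfact (N + q + i + j) / oddfact (q + 1 + i + j)))
      = C * (\<Prod>n<y. rfact (N + q + n) * oddfact N / oddfact (N - n))" if N: "y \<le> N" for N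
  proof -
    define E where "E = mat y y (\<lambda>(i, j). rfact (N + q + i + j) / oddfact (q + 1 + i + j))"
    define U where "U = mat y y (\<lambda>(n, k). t N n k)"
    have car: "E \<in> carrier_mat y y" "U \<in> carrier_mat y y" by (simp_all add: E_def U_def)
    have UE: "(U * E) $$ (n, j) = (\<Sum>k\<le>n. (-1) ^ k * real (n choose k) * (\<Prod>r<j. real k + (real (N + q) + 1 + real r))
        * (oddfact (q + k + n) / oddfact (q + 1 + k + j)))"
      if nj: "n < y" "j < y" for n j
    proof -
      have "(U * E) $$ (n, j) = (\<Sum>k = 0..<y. t N n k * (rfact (N + q + k + j) / oddfact (q + 1 + k + j)))"
        using nj by (simp add: U_def E_def scalar_prod_def)
      also have "\<dots> = (\<Sum>k\<le>n. t N n k * (rfact (N + q + k + j) / oddfact (q + 1 + k + j)))"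
        using nj by (intro sum.mono_neutral_right) (auto simp: t_def binomial_eq_0)
      also have "\<dots> = (\<Sum>k\<le>n. (-1) ^ k * real (n choose k) * (\<Prod>r<j. real k + (real (N + q) + 1 + real r))
        * (oddfact (q + k + n) / oddfact (q + 1 + k + j)))"
      proof (rule sum.cong[OF refl])
        fix k
        have "rfact (N + q + k + j) = rfact (N + q + k) * (\<Prod>r<j. real k + (real (N + q) + 1 + real r))"
          unfolding rfact_add[of "N + q + k" j] by (simp add: algebra_simps)
        then show "t N n k * (rfact (N + q + k + j) / oddfact (q + 1 + k + j))
          = (-1) ^ k * real (n choose k) * (\<Prod>r<j. real k + (real (N + q) + 1 + real r))
            * (oddfact (q + k + n) / oddfact (q + 1 + k + j))" by (simp add: t_def)
      qed
      finally show ?thesis .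
    qed
    have low: "(U * E) $$ (n, j) = 0" if nj: "n < y" "j < n" for n j
    proof -
      define m where "m = n - 1 - j"
      define \<alpha> where "\<alpha> r = (if r < j then 1 else 2 :: real)" for r
      define \<beta> where "\<beta> r = (if r < j then real (N + q) + 1 + real r else 2 * (real (q + 1 + j) + real (r - j)) + 1)" for r
      have split: "(\<Prod>r<j. real k + (real (N + q) + 1 + real r)) * (oddfact (q + k + n) / oddfact (q + 1 + k + j))
          = (\<Prod>r<j + m. \<alpha> r * real k + \<beta> r)" for k
      proof -
        have "q + k + n = (q + 1 + k + j) + m" using nj by (simp add: m_def)
        then have "oddfact (q + k + n) / oddfact (q + 1 + k + j)
            = (\<Prod>r<m. 2 * (real (q + 1 + k + j) + real r) + 1)" by (simp only: oddfact_add) simp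
        also have "\<dots> = (\<Prod>r = j..<j + m. \<alpha> r * real k + \<beta> r)"
          by (rule prod.reindex_bij_witness[of _ "\<lambda>r. r - j" "\<lambda>r. r + j"])
             (auto simp: \<alpha>_def \<beta>_def algebra_simps)
        finally have 2: "oddfact (q + k + n) / oddfact (q + 1 + k + j) = \<dots>" .
        have 1: "(\<Prod>r<j. real k + (real (N + q) + 1 + real r)) = (\<Prod>r<j. \<alpha> r * real k + \<beta> r)"
          by (intro prod.cong refl) (simp add: \<alpha>_def \<beta>_def)
        show ?thesis unfolding 1 2 unfolding lessThan_atLeast0 by (rule prod.atLeastLessThan_concat) simp_all
      qed
      have "j < y" using nj by simp
      then have "(U * E) $$ (n, j) = (\<Sum>k\<le>n. (-1) ^ k * real (n choose k) * (\<Prod>r<j + m. \<alpha> r * real k + \<beta> r))"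
        unfolding UE[OF nj(1) \<open>j < y\<close>] by (intro sum.cong refl) (simp only: mult.assoc split)
      also have "\<dots> = 0" by (rule alternating_sum_affine) (use nj in \<open>simp add: m_def\<close>)
      finally show ?thesis .
    qed
    have dia: "(U * E) $$ (n, n) = v n * (oddfact N / oddfact (N - n))" if n: "n < y" for n
    proof -
      define c where "c = real q + real n + 1 / 2"
      have c: "c > 0" by (simp add: c_def)
      have dv: "oddfact (q + k + n) / oddfact (q + 1 + k + n) = 1 / (2 * (real k + c))" for k
      proof -
        have "oddfact (q + 1 + k + n) = 2 * (real k + c) * oddfact (q + k + n)"
          using oddfact_Suc[of "q + k + n"] by (simp add: c_def algebra_simps)
        then show ?thesis by simp
      qed
      have "(U * E) $$ (n, n) = (\<Sum>k\<le>n. (-1) ^ k * real (n choose k)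
          * (\<Prod>r<n. real k + (real (N + q) + 1 + real r)) / (real k + c) / 2)"
        unfolding UE[OF n n] dv by (intro sum.cong refl) simp
      also have "\<dots> = (\<Sum>k\<le>n. (-1) ^ k * real (n choose k)
          * (\<Prod>r<n. real k + (real (N + q) + 1 + real r)) / (real k + c)) / 2"
        by (simp only: sum_divide_distrib)
      also have "\<dots> = (\<Prod>r<n. real (N + q) + 1 + real r - c) * (\<Sum>k\<le>n. (-1) ^ k * real (n choose k) / (real k + c)) / 2"
        by (subst alternating_sum_divided[OF order_refl c]) simp
      also have "(\<Prod>r<n. real (N + q) + 1 + real r - c) = (\<Prod>r<n. (2 * (real (N - n) + real r) + 1) / 2)"
        using n N by (intro prod.cong refl) (simp add: c_def of_nat_diff field_simps)
      also have "\<dots> = (\<Prod>r<n. 2 * (real (N - n) + real r) + 1) / 2 ^ n"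
        by (simp add: prod_dividef)
      also have "(\<Prod>r<n. 2 * (real (N - n) + real r) + 1) = oddfact N / oddfact (N - n)"
        using oddfact_add[of "N - n" n] n N by simp
      finally show ?thesis by (simp add: v_def c_def ac_simps)
    qed
    have "det (U * E) = (\<Prod>n<y. v n * (oddfact N / oddfact (N - n)))"
    proof -
      have "upper_triangular (U * E)" using low car by (auto simp: upper_triangular_def)
      then have "det (U * E) = prod_list (diag_mat (U * E))"
        by (rule det_upper_triangular) (use car in auto)
      also have "diag_mat (U * E) = map (\<lambda>n. v n * (oddfact N / oddfact (N - n))) [0..<y]"
        using dia car by (auto simp: diag_mat_def)
      finally show ?thesis
        using prod.distinct_set_conv_list[of "[0..<y]" "\<lambda>n. v n * (oddfact N / oddfact (N - n))"]
        by (simp add: lessThan_atLeast0)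
    qed
    moreover have "det U = (\<Prod>n<y. (-1) ^ n * oddfact (q + 2 * n) / rfact (N + q + n))"
    proof -
      have "det U = prod_list (diag_mat U)"
        by (rule det_lower_triangular[OF _ car(2)]) (simp add: U_def t_def binomial_eq_0)
      also have "diag_mat U = map (\<lambda>n. (-1) ^ n * oddfact (q + 2 * n) / rfact (N + q + n)) [0..<y]"
        by (auto simp: diag_mat_def U_def t_def mult_2 add.assoc)
      finally show ?thesis
        using prod.distinct_set_conv_list[of "[0..<y]" "\<lambda>n. (-1) ^ n * oddfact (q + 2 * n) / rfact (N + q + n)"]
        by (simp add: lessThan_atLeast0)
    qed
    ultimately have e: "(\<Prod>n<y. (-1) ^ n * oddfact (q + 2 * n) / rfact (N + q + n)) * det E
        = (\<Prod>n<y. v n * (oddfact N / oddfact (N - n)))"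
      using det_mult[OF car(2,1)] by simp
    have nz: "(\<Prod>n<y. (-1) ^ n * oddfact (q + 2 * n) / rfact (N + q + n)) \<noteq> 0"
      by (simp add: prod_zero_iff)
    have "C * (\<Prod>n<y. rfact (N + q + n) * oddfact N / oddfact (N - n))
        * (\<Prod>n<y. (-1) ^ n * oddfact (q + 2 * n) / rfact (N + q + n))
        = (\<Prod>n<y. v n * (oddfact N / oddfact (N - n)))"
      unfolding C_def prod.distrib[symmetric] by (intro prod.cong refl) (simp add: field_simps)
    then have "det E * (\<Prod>n<y. (-1) ^ n * oddfact (q + 2 * n) / rfact (N + q + n))
      = C * (\<Prod>n<y. rfact (N + q + n) * oddfact N / oddfact (N - n))
        * (\<Prod>n<y. (-1) ^ n * oddfact (q + 2 * n) / rfact (N + q + n))"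
      using e by (simp only: mult.commute)
    then have "det E = C * (\<Prod>n<y. rfact (N + q + n) * oddfact N / oddfact (N - n))"
      using mult_right_cancel[OF nz] by blast
    then show ?thesis by (simp only: E_def)
  qed
  then show ?thesis by blast
qed

section \<open>Vandermonde products\<close>

abbreviation sq :: "nat \<Rightarrow> real" where
  "sq x \<equiv> (real x + 1)\<^sup>2"

lemma sq_diff: "sq x - sq y = (real x - real y) * (real x + real y + 2)"
  by (simp add: power2_eq_square algebra_simps)

lemma sq_less: "x < y \<Longrightarrow> sq x < sq y"
  by (intro power_strict_mono) auto

lemma vdm_insert:
  assumes "finite X" "e \<notin> X"
  shows "vdm sq (insert e X) = vdm sq X * (\<Prod>x\<in>X. \<bar>sq e - sq x\<bar>)"
proof -
  have 1: "(\<Prod>y\<in>{y \<in> insert e X. y < x}. sq x - sq y)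
      = (if e < x then sq x - sq e else 1) * (\<Prod>y\<in>{y \<in> X. y < x}. sq x - sq y)" for x
  proof (cases "e < x")
    case True
    then have "{y \<in> insert e X. y < x} = insert e {y \<in> X. y < x}" by auto
    then show ?thesis using True assms by simp
  next
    case False
    then have "{y \<in> insert e X. y < x} = {y \<in> X. y < x}" by auto
    then show ?thesis using False by simp
  qed
  have 2: "(\<Prod>y\<in>{y \<in> X. y < e}. sq e - sq y) = (\<Prod>x\<in>X. if x < e then sq e - sq x else 1)"
    using assms(1) by (simp add: prod.inter_filter)
  have "vdm sq (insert e X) = (\<Prod>y\<in>{y \<in> X. y < e}. sq e - sq y)
      * (\<Prod>x\<in>X. (if e < x then sq x - sq e else 1) * (\<Prod>y\<in>{y \<in> X. y < x}. sq x - sq y))"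
    unfolding vdm_def 1 using assms by simp
  also have "\<dots> = vdm sq X * (\<Prod>x\<in>X. (if x < e then sq e - sq x else 1) * (if e < x then sq x - sq e else 1))"
    unfolding 2 by (simp only: prod.distrib vdm_def ac_simps)
  also have "(\<Prod>x\<in>X. (if x < e then sq e - sq x else 1) * (if e < x then sq x - sq e else 1))
      = (\<Prod>x\<in>X. \<bar>sq e - sq x\<bar>)"
  proof (rule prod.cong[OF refl])
    fix x assume "x \<in> X"
    then consider "x < e" | "e < x" using assms(2) by (metis linorder_neqE_nat)
    then show "(if x < e then sq e - sq x else 1) * (if e < x then sq x - sq e else 1) = \<bar>sq e - sq x\<bar>"
    proof cases
      case 1 then show ?thesis using sq_less[OF 1] by simp
    next
      case 2 then show ?thesis using sq_less[OF 2] by simp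
    qed
  qed
  finally show ?thesis .
qed

lemma vdm_Un:
  assumes "finite X" "finite Y" "X \<inter> Y = {}"
  shows "vdm sq (X \<union> Y) = vdm sq X * vdm sq Y * (\<Prod>y\<in>Y. \<Prod>x\<in>X. \<bar>sq y - sq x\<bar>)"
  using assms(2,3)
proof (induction Y rule: finite_induct)
  case empty then show ?case by (simp add: vdm_def)
next
  case (insert e Y)
  have "vdm sq (X \<union> insert e Y) = vdm sq (X \<union> Y) * (\<Prod>x\<in>X \<union> Y. \<bar>sq e - sq x\<bar>)"
    using insert assms(1) by (simp add: vdm_insert)
  also have "(\<Prod>x\<in>X \<union> Y. \<bar>sq e - sq x\<bar>) = (\<Prod>x\<in>X. \<bar>sq e - sq x\<bar>) * (\<Prod>x\<in>Y. \<bar>sq e - sq x\<bar>)"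
    using insert assms(1) by (intro prod.union_disjoint) auto
  finally show ?case using insert by (simp add: vdm_insert)
qed

lemma vdm_pos: "vdm sq X > 0"
  unfolding vdm_def by (intro prod_pos) (auto simp: sq_less)

lemma weyl_pos: "weyl X > 0"
  unfolding weyl_def by (intro mult_pos_pos prod_pos vdm_pos) auto

lemma weyl_Un:
  assumes "finite X" "finite Y" "X \<inter> Y = {}"
  shows "weyl (X \<union> Y) = weyl X * weyl Y * (\<Prod>y\<in>Y. \<Prod>x\<in>X. \<bar>sq y - sq x\<bar>)"
  using assms by (simp add: weyl_def vdm_Un prod.union_disjoint)

definition zw :: "nat \<Rightarrow> nat \<Rightarrow> nat \<Rightarrow> nat \<Rightarrow> real" where
  "zw a c N s = sq s * (\<Prod>d\<in>{..<a} \<union> {N..<N + c}. \<bar>sq s - sq d\<bar>)"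

definition zsum :: "nat \<Rightarrow> nat \<Rightarrow> nat \<Rightarrow> nat \<Rightarrow> real" where
  "zsum a c N y = (\<Sum>S | S \<subseteq> {a..<N} \<and> card S = y. (\<Prod>s\<in>S. zw a c N s) * (vdm sq S)\<^sup>2)"

lemma weyl_pair:
  assumes fin: "finite A" "finite B" "finite S" and dj: "A \<inter> S = {}" "B \<inter> S = {}" "A \<inter> B = {}"
    and AB: "A \<union> B = {..<a} \<union> {N..<N + c}"
  shows "weyl (A \<union> S) * weyl (B \<union> S) = weyl A * weyl B * ((\<Prod>s\<in>S. zw a c N s) * (vdm sq S)\<^sup>2)"
proof -
  have "(\<Prod>s\<in>S. \<Prod>x\<in>A. \<bar>sq s - sq x\<bar>) * (\<Prod>s\<in>S. \<Prod>x\<in>B. \<bar>sq s - sq x\<bar>)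
      = (\<Prod>s\<in>S. \<Prod>x\<in>A \<union> B. \<bar>sq s - sq x\<bar>)"
    using fin dj by (simp only: prod.distrib[symmetric] prod.union_disjoint)
  moreover have "weyl S * weyl S = (\<Prod>s\<in>S. sq s) * (vdm sq S)\<^sup>2"
    by (simp add: weyl_def power2_eq_square prod.distrib)
  ultimately have "weyl A * weyl B * (weyl S * weyl S) * ((\<Prod>s\<in>S. \<Prod>x\<in>A. \<bar>sq s - sq x\<bar>)
      * (\<Prod>s\<in>S. \<Prod>x\<in>B. \<bar>sq s - sq x\<bar>)) = weyl A * weyl B * ((\<Prod>s\<in>S. zw a c N s) * (vdm sq S)\<^sup>2)"
    by (simp add: zw_def AB prod.distrib)
  then show ?thesis using fin dj by (simp add: weyl_Un ac_simps)
qed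

lemma prod_sq_below:
  "rfact (l - 1 - a) * rfact l * (\<Prod>d<a. (real l)\<^sup>2 - sq d) = rfact (l - 1) * rfact (l + a)" if "a < l"
  using that
proof (induction a)
  case (Suc a)
  have "l - 1 - a = Suc (l - 1 - Suc a)" using Suc.prems by simp
  then have f: "rfact (l - 1 - a) = (real l - 1 - real a) * rfact (l - 1 - Suc a)"
    using Suc.prems by (simp add: of_nat_diff)
  have "rfact (l - 1 - Suc a) * rfact l * (\<Prod>d<Suc a. (real l)\<^sup>2 - sq d)
      = (rfact (l - 1 - a) * rfact l * (\<Prod>d<a. (real l)\<^sup>2 - sq d)) * (real l + 1 + real a)"
    unfolding f by (simp add: power2_eq_square algebra_simps)
  also have "\<dots> = rfact (l - 1) * rfact (l + Suc a)"
    using Suc by (simp add: algebra_simps)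
  finally show ?case .
qed simp

lemma prod_sq_above:
  "rfact (N - l) * rfact (N + l) * (\<Prod>d<c. sq (N + d) - (real l)\<^sup>2) = rfact (N + c - l) * rfact (N + c + l)"
  if "l \<le> N"
proof (induction c)
  case (Suc c)
  have "N + Suc c - l = Suc (N + c - l)" using that by simp
  then have f: "rfact (N + Suc c - l) = (real N + real c + 1 - real l) * rfact (N + c - l)"
    using that by (simp add: of_nat_diff algebra_simps)
  have "rfact (N - l) * rfact (N + l) * (\<Prod>d<Suc c. sq (N + d) - (real l)\<^sup>2)
      = (rfact (N + c - l) * rfact (N + c + l)) * (sq (N + c) - (real l)\<^sup>2)"
    unfolding Suc.IH[symmetric] by simp
  also have "\<dots> = rfact (N + Suc c - l) * rfact (N + Suc c + l)"
    unfolding f by (simp add: power2_eq_square algebra_simps)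
  finally show ?case .
qed simp

lemma zw_eq:
  assumes s: "a \<le> s" "s < N"
  shows "zw a c N s = wt a (N + c) N (Suc s)"
proof -
  have "(\<Prod>d\<in>{..<a} \<union> {N..<N + c}. \<bar>sq s - sq d\<bar>)
      = (\<Prod>d<a. \<bar>sq s - sq d\<bar>) * (\<Prod>d\<in>{N..<N + c}. \<bar>sq s - sq d\<bar>)"
    using s by (intro prod.union_disjoint) auto
  also have "(\<Prod>d<a. \<bar>sq s - sq d\<bar>) = (\<Prod>d<a. (real (Suc s))\<^sup>2 - sq d)"
  proof (rule prod.cong[OF refl])
    fix d assume "d \<in> {..<a}"
    then show "\<bar>sq s - sq d\<bar> = (real (Suc s))\<^sup>2 - sq d" using sq_less[of d s] s by (simp add: add.commute)
  qed
  also have "(\<Prod>d\<in>{N..<N + c}. \<bar>sq s - sq d\<bar>) = (\<Prod>d<c. \<bar>sq s - sq (N + d)\<bar>)"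
    by (rule prod.reindex_bij_witness[of _ "\<lambda>d. N + d" "\<lambda>d. d - N"]) auto
  also have "\<dots> = (\<Prod>d<c. sq (N + d) - (real (Suc s))\<^sup>2)"
  proof (rule prod.cong[OF refl])
    fix d
    show "\<bar>sq s - sq (N + d)\<bar> = sq (N + d) - (real (Suc s))\<^sup>2"
      using sq_less[of s "N + d"] s by (simp add: add.commute)
  qed
  finally have z: "zw a c N s = sq s * ((\<Prod>d<a. (real (Suc s))\<^sup>2 - sq d) * (\<Prod>d<c. sq (N + d) - (real (Suc s))\<^sup>2))"
    by (simp add: zw_def)
  have 1: "rfact (Suc s - a - 1) * (real s + 1) * (\<Prod>d<a. (real (Suc s))\<^sup>2 - sq d) = rfact (Suc s + a)"
  proof -
    have "rfact s * (rfact (Suc s - a - 1) * (real s + 1) * (\<Prod>d<a. (real (Suc s))\<^sup>2 - sq d))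
        = rfact s * rfact (Suc s + a)"
      using prod_sq_below[of a "Suc s"] s by (simp add: algebra_simps)
    then show ?thesis using mult_left_cancel[of "rfact s"] by simp
  qed
  have 2: "rfact (N - Suc s) * rfact (N + Suc s) * (\<Prod>d<c. sq (N + d) - (real (Suc s))\<^sup>2)
      = rfact (N + c - Suc s) * rfact (N + c + Suc s)"
    using prod_sq_above[of "Suc s" N c] s by simp
  have gen: "s1 ^ 2 * (P * R) = s1 * F * G * G' / (f * g * g')"
    if "f * s1 * P = F" "g * g' * R = G * G'" "f \<noteq> 0" "g \<noteq> 0" "g' \<noteq> 0" for s1 P R F G G' f g g' :: real
  proof -
    have "s1 ^ 2 * (P * R) * (f * g * g') = s1 * (f * s1 * P) * (g * g' * R)"
      by (simp add: power2_eq_square ac_simps)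
    also have "\<dots> = s1 * F * G * G'" unfolding that(1,2) by (simp only: mult.assoc)
    finally show ?thesis using that(3-5) by (simp add: eq_divide_eq)
  qed
  have "real (Suc s) = real s + 1" by simp
  then show ?thesis
    unfolding z wt_def using gen[OF 1 2] by (simp del: fact_Suc)
qed

section \<open>Evaluation of the sum over the crossing positions\<close>

definition zprod :: "nat \<Rightarrow> nat \<Rightarrow> nat \<Rightarrow> nat \<Rightarrow> real" where
  "zprod a c N y = (\<Prod>n<y. rfact (N + (a + c + 1) + n) * oddfact (N + c + n + 1)
     / (rfact (N - a - 1 - n) * oddfact (N - n)))"

lemma zprod_pos: "zprod a c N y > 0"
  unfolding zprod_def by (intro prod_pos divide_pos_pos mult_pos_pos) auto

lemma zsum_zprod: "\<exists>C. \<forall>N\<ge>a + y. zsum a c N y = C * zprod a c N y"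
proof -
  define q where "q = a + c + 1"
  obtain C where C: "\<And>N. y \<le> N \<Longrightarrow> det (mat y y (\<lambda>(i, j). rfact (N + q + i + j) / oddfact (q + 1 + i + j)))
    = C * (\<Prod>n<y. rfact (N + q + n) * oddfact N / oddfact (N - n))"
    using hankel_det[of y q] by blast
  define C' where "C' = C * (\<Prod>n<y. oddfact (a + n + 1) * (-1) ^ n * rfact (c + n) / 2)"
  have "zsum a c N y = C' * zprod a c N y" if N: "a + y \<le> N" for N
  proof -
    define A where "A i = oddfact (a + i + 1) / rfact (N - a - 1 - i)" for i
    define B where "B j = (-1) ^ j * rfact (c + j) * oddfact (N + c + j + 1) / (2 * oddfact N)" for j
    have "zsum a c N y = det (mat y y (\<lambda>(i, j). \<Sum>s\<in>{a..<N}. zw a c N s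
        * (\<Prod>r<i. sq s - (real (a + r) + 1)\<^sup>2) * (\<Prod>r<j. sq s - (real (N + c + r) + 1)\<^sup>2)))"
      unfolding zsum_def by (rule sum_vdm_square) simp
    also have "\<dots> = det (mat y y (\<lambda>(i, j). A i * B j * (rfact (N + q + i + j) / oddfact (q + 1 + i + j))))"
    proof (rule det_cong)
      fix i j assume ij: "i < y" "j < y"
      define x where "x = N - a - 1 - i"
      have Nx: "N = a + i + 1 + x" using ij N by (simp add: x_def)
      have "(\<Sum>s\<in>{a..<N}. zw a c N s
        * (\<Prod>r<i. sq s - (real (a + r) + 1)\<^sup>2) * (\<Prod>r<j. sq s - (real (N + c + r) + 1)\<^sup>2))
        = (\<Sum>l\<in>{a<..N}. wt a (N + c) N l
        * (\<Prod>r<i. (real l)\<^sup>2 - (real (a + r) + 1)\<^sup>2) * (\<Prod>r<j. (real l)\<^sup>2 - (real (N + c + r) + 1)\<^sup>2))"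
      proof (rule sum.reindex_bij_witness[of _ "\<lambda>l. l - 1" Suc])
        fix s assume "s \<in> {a..<N}"
        then have "zw a c N s = wt a (N + c) N (Suc s)" by (intro zw_eq) auto
        moreover have "real (Suc s) = real s + 1" by simp
        ultimately show "wt a (N + c) N (Suc s) * (\<Prod>r<i. (real (Suc s))\<^sup>2 - (real (a + r) + 1)\<^sup>2)
            * (\<Prod>r<j. (real (Suc s))\<^sup>2 - (real (N + c + r) + 1)\<^sup>2)
          = zw a c N s * (\<Prod>r<i. sq s - (real (a + r) + 1)\<^sup>2) * (\<Prod>r<j. sq s - (real (N + c + r) + 1)\<^sup>2)"
          by (simp only:)
      qed auto
      also have "\<dots> = (-1) ^ j * wsum (a + i) (N + c + j) N" by (rule moment) simp
      also have "wsum (a + i) (N + c + j) N = wsum (a + i) (a + i + 1 + x + (c + j)) (a + i + 1 + x)"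
        unfolding Nx by (simp only: add.assoc)
      also have "\<dots> = rfact (c + j) * rfact (2 * (a + i) + x + (c + j) + 2) * oddfact (a + i + x + (c + j) + 2)
          * oddfact (a + i + 1) / (2 * rfact x * oddfact (a + i + 1 + x) * oddfact (a + i + (c + j) + 2))"
        by (rule wsum_eq)
      also have "2 * (a + i) + x + (c + j) + 2 = N + q + i + j" by (simp add: Nx q_def)
      also have "a + i + x + (c + j) + 2 = N + c + j + 1" by (simp add: Nx)
      also have "a + i + (c + j) + 2 = q + 1 + i + j" by (simp add: q_def)
      also have "a + i + 1 + x = N" by (simp only: Nx)
      finally show "(\<Sum>s\<in>{a..<N}. zw a c N s
        * (\<Prod>r<i. sq s - (real (a + r) + 1)\<^sup>2) * (\<Prod>r<j. sq s - (real (N + c + r) + 1)\<^sup>2))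
        = A i * B j * (rfact (N + q + i + j) / oddfact (q + 1 + i + j))"
        unfolding A_def B_def x_def[symmetric] by (simp add: ac_simps del: oddfact_Suc fact_Suc)
    qed
    also have "\<dots> = (\<Prod>i<y. A i) * (\<Prod>j<y. B j) * (C * (\<Prod>n<y. rfact (N + q + n) * oddfact N / oddfact (N - n)))"
      using N by (subst det_scale, subst C) (simp_all add: lessThan_atLeast0)
    also have "\<dots> = C * ((\<Prod>i<y. A i) * (\<Prod>j<y. B j) * (\<Prod>n<y. rfact (N + q + n) * oddfact N / oddfact (N - n)))"
      by (simp only: ac_simps)
    also have "\<dots> = C * (\<Prod>n<y. A n * B n * (rfact (N + q + n) * oddfact N / oddfact (N - n)))"
      by (simp only: prod.distrib)
    also have "(\<Prod>n<y. A n * B n * (rfact (N + q + n) * oddfact N / oddfact (N - n)))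
      = (\<Prod>n<y. (oddfact (a + n + 1) * (-1) ^ n * rfact (c + n) / 2) * (rfact (N + q + n) * oddfact (N + c + n + 1)
       / (rfact (N - a - 1 - n) * oddfact (N - n))))"
      by (intro prod.cong refl) (simp add: A_def B_def ac_simps del: oddfact_Suc fact_Suc)
    finally show ?thesis by (simp only: C'_def zprod_def q_def prod.distrib mult.assoc)
  qed
  then show ?thesis by blast
qed

lemma zsum_shift: "zsum a c (a + x + y) y = zsum a c (a + y) y * (zprod a c (a + x + y) y / zprod a c (a + y) y)"
proof -
  obtain C where C: "\<And>N. a + y \<le> N \<Longrightarrow> zsum a c N y = C * zprod a c N y" using zsum_zprod by blast
  have "zprod a c (a + y) y \<noteq> 0" using zprod_pos[of a c "a + y" y] by linarith
  then show ?thesis using C[of "a + x + y"] C[of "a + y"] by simp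
qed

lemma pochhammer_rfact: "pochhammer (real m + 1) k = rfact (m + k) / rfact m"
  by (simp add: rfact_add pochhammer_prod lessThan_atLeast0)

lemma skip_pochhammer_oddfact: "skip_pochhammer (2 * real m + 1) k = oddfact (m + k) / oddfact m"
proof -
  have "skip_pochhammer (2 * real m + 1) k = (\<Prod>r<k. 2 * (real m + real r) + 1)"
    unfolding skip_pochhammer_def by (intro prod.cong refl) simp
  then show ?thesis by (simp add: oddfact_add)
qed

lemma T_V_zprod:
  "T (real x + 1) (2 * a + b + 2 * y + z) y * V (2 * real x + 2 * real a + 3) (b + 2 * y + z - 1) y
    = zprod a (b + z) (a + x + y) y"
proof -
  have "T (real x + 1) (2 * a + b + 2 * y + z) y * V (2 * real x + 2 * real a + 3) (b + 2 * y + z - 1) y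
    = (\<Prod>i<y. pochhammer (real x + 1 + real i) (2 * a + b + 2 * y + z - 2 * i)
        * skip_pochhammer (2 * real x + 2 * real a + 3 + 2 * real i) (b + 2 * y + z - 1 - 2 * i))"
    by (simp add: T_def V_def prod.distrib)
  also have "\<dots> = (\<Prod>i<y. rfact (a + x + y + (a + (b + z) + 1) + (y - Suc i)) * oddfact (a + x + y + (b + z) + (y - Suc i) + 1)
     / (rfact (a + x + y - a - 1 - (y - Suc i)) * oddfact (a + x + y - (y - Suc i))))"
  proof (rule prod.cong[OF refl])
    fix i assume "i \<in> {..<y}"
    then obtain j where y: "y = Suc (i + j)" using less_imp_Suc_add by auto
    have 1: "pochhammer (real x + 1 + real i) (2 * a + b + 2 * y + z - 2 * i)
      = rfact (x + i + (2 * a + b + 2 * y + z - 2 * i)) / rfact (x + i)"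
      using pochhammer_rfact[of "x + i" "2 * a + b + 2 * y + z - 2 * i"] by (simp add: add.commute add.left_commute)
    have 2: "skip_pochhammer (2 * real x + 2 * real a + 3 + 2 * real i) (b + 2 * y + z - 1 - 2 * i)
      = oddfact (x + a + 1 + i + (b + 2 * y + z - 1 - 2 * i)) / oddfact (x + a + 1 + i)"
      using skip_pochhammer_oddfact[of "x + a + 1 + i" "b + 2 * y + z - 1 - 2 * i"]
      by (simp add: algebra_simps del: oddfact_Suc)
    have e: "x + i + (2 * a + b + 2 * y + z - 2 * i) = a + x + y + (a + (b + z) + 1) + (y - Suc i)"
      "x + a + 1 + i + (b + 2 * y + z - 1 - 2 * i) = a + x + y + (b + z) + (y - Suc i) + 1"
      "x + i = a + x + y - a - 1 - (y - Suc i)" "x + a + 1 + i = a + x + y - (y - Suc i)"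
      by (simp_all add: y)
    show "pochhammer (real x + 1 + real i) (2 * a + b + 2 * y + z - 2 * i)
        * skip_pochhammer (2 * real x + 2 * real a + 3 + 2 * real i) (b + 2 * y + z - 1 - 2 * i)
      = rfact (a + x + y + (a + (b + z) + 1) + (y - Suc i)) * oddfact (a + x + y + (b + z) + (y - Suc i) + 1)
     / (rfact (a + x + y - a - 1 - (y - Suc i)) * oddfact (a + x + y - (y - Suc i)))"
      unfolding 1 2 e(1,2) unfolding e(3,4) by simp
  qed
  also have "\<dots> = zprod a (b + z) (a + x + y) y"
    unfolding zprod_def by (rule prod.nat_diff_reindex)
  finally show ?thesis .
qed

lemma H_add: "H (m + n) = H m * (\<Prod>i<n. rfact (m + i))"
  by (induction n) (simp_all add: H_def)

lemma H_pos: "H n > 0"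
  unfolding H_def by (intro prod_pos) simp

lemma vdm_interval:
  "(vdm sq {a..<a + y})\<^sup>2 * (\<Prod>i<y. real (a + 1 + i) * rfact (2 * a + 1 + i)
      / (rfact i * rfact (y - 1 - i) * rfact (2 * a + y + 1 + i))) = 1 / 2 ^ y"
proof (induction y)
  case 0 show ?case by (simp add: vdm_def)
next
  case (Suc y)
  define P where "P = (\<Prod>i<y. real (y - i) * (2 * real a + real y + real i + 2))"
  define r where "r y i = real (a + 1 + i) * rfact (2 * a + 1 + i)
      / (rfact i * rfact (y - 1 - i) * rfact (2 * a + y + 1 + i))" for y i
  have "{a..<a + Suc y} = insert (a + y) {a..<a + y}" by auto
  then have "vdm sq {a..<a + Suc y} = vdm sq {a..<a + y} * (\<Prod>x\<in>{a..<a + y}. \<bar>sq (a + y) - sq x\<bar>)"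
    by (simp add: vdm_insert)
  also have "(\<Prod>x\<in>{a..<a + y}. \<bar>sq (a + y) - sq x\<bar>) = P"
    unfolding P_def
  proof (rule prod.reindex_bij_witness[of _ "\<lambda>i. a + i" "\<lambda>x. x - a"])
    fix x assume x: "x \<in> {a..<a + y}"
    then have "\<bar>sq (a + y) - sq x\<bar> = sq (a + y) - sq x" using sq_less[of x "a + y"] by simp
    then show "real (y - (x - a)) * (2 * real a + real y + real (x - a) + 2) = \<bar>sq (a + y) - sq x\<bar>"
      using x unfolding sq_diff by (simp add: of_nat_diff algebra_simps)
  qed auto
  finally have V: "vdm sq {a..<a + Suc y} = vdm sq {a..<a + y} * P" .
  have r_Suc: "r y i = r (Suc y) i * (real (y - i) * (2 * real a + real y + real i + 2))" if "i < y" for i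
  proof -
    obtain j where y: "y = Suc (i + j)" using less_imp_Suc_add[OF \<open>i < y\<close>] by blast
    have e1: "rfact (Suc y - 1 - i) = real (y - i) * rfact (y - 1 - i)" by (simp add: y)
    have e2: "rfact (2 * a + Suc y + 1 + i) = (2 * real a + real y + real i + 2) * rfact (2 * a + y + 1 + i)"
      by (simp add: algebra_simps)
    have nz: "real (y - i) \<noteq> 0" "2 * real a + real y + real i + 2 \<noteq> 0"
      using \<open>i < y\<close> by (simp, linarith)
    have gen: "A / (f * g * h) = A / (f * (p * g) * (q * h)) * (p * q)" if "p \<noteq> 0" "q \<noteq> 0" for A f g h p q :: real
      using that by simp
    show ?thesis unfolding r_def e1 e2 by (rule gen[OF nz])
  qed
  have Rp: "(\<Prod>i<y. r y i) = (\<Prod>i<y. r (Suc y) i) * P"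
    unfolding P_def prod.distrib[symmetric] by (intro prod.cong refl r_Suc) simp
  have Pr: "P * r (Suc y) y = 1 / 2"
  proof -
    have 1: "(\<Prod>i<y. real (y - i)) = rfact y"
    proof -
      have "(\<Prod>i<y. real (y - i)) = (\<Prod>i<y. real (Suc (y - Suc i)))"
      proof (rule prod.cong[OF refl])
        fix i assume "i \<in> {..<y}"
        then have "y - i = Suc (y - Suc i)" by simp
        then show "real (y - i) = real (Suc (y - Suc i))" by (rule arg_cong)
      qed
      also have "\<dots> = (\<Prod>i<y. real (Suc i))" by (rule prod.nat_diff_reindex)
      also have "\<dots> = rfact y" unfolding fact_prod_Suc lessThan_atLeast0 of_nat_prod ..
      finally show ?thesis .
    qed
    have 2: "rfact (2 * a + y + 1) * (\<Prod>i<y. 2 * real a + real y + real i + 2) = rfact (2 * a + 2 * y + 1)"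
      using rfact_add[of "2 * a + y + 1" y] by (simp add: algebra_simps mult_2 del: fact_Suc)
    have 3: "rfact (2 * a + Suc y + 1 + y) = 2 * real (a + 1 + y) * rfact (2 * a + 2 * y + 1)"
    proof -
      have "2 * a + Suc y + 1 + y = Suc (2 * a + 2 * y + 1)" "real (Suc (2 * a + 2 * y + 1)) = 2 * real (a + 1 + y)"
        by simp_all
      then show ?thesis by (simp only: fact_Suc)
    qed
    have gen: "(f * Q) * (k * g / (f * 1 * (2 * k * h))) = 1 / 2"
      if "g * Q = h" "f \<noteq> 0" "k \<noteq> 0" "h \<noteq> 0" for f Q k g h :: real
    proof -
      have "(f * Q) * (k * g / (f * 1 * (2 * k * h))) = f * k * (g * Q) / (f * k * (2 * h))"
        by (simp add: ac_simps)
      then show ?thesis unfolding that(1) using that(2-4) by simp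
    qed
    have P: "P = rfact y * (\<Prod>i<y. 2 * real a + real y + real i + 2)" unfolding P_def prod.distrib 1 ..
    have e: "Suc y - 1 - y = 0" "2 * a + 1 + y = 2 * a + y + 1" by simp_all
    have r: "r (Suc y) y = real (a + 1 + y) * rfact (2 * a + y + 1)
        / (rfact y * 1 * (2 * real (a + 1 + y) * rfact (2 * a + 2 * y + 1)))"
      unfolding r_def 3 e by (simp only: fact_0)
    show ?thesis unfolding P r by (rule gen[OF 2]) simp_all
  qed
  have "(vdm sq {a..<a + Suc y})\<^sup>2 * (\<Prod>i<Suc y. r (Suc y) i)
      = (vdm sq {a..<a + y})\<^sup>2 * ((\<Prod>i<y. r (Suc y) i) * P) * (P * r (Suc y) y)"
    unfolding V by (simp add: power2_eq_square ac_simps)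
  also have "\<dots> = 1 / 2 ^ y * (1 / 2)"
  proof -
    have "(vdm sq {a..<a + y})\<^sup>2 * (\<Prod>i<y. r y i) = 1 / 2 ^ y" using Suc.IH by (simp only: r_def)
    then show ?thesis by (simp only: Rp[symmetric] Pr)
  qed
  finally show ?case by (simp add: r_def)
qed

lemma zsum_base:
  "zsum a c (a + y) y = 1 / 2 ^ y * (H (2 * a + c + 2 * y + 1) * H (c + y) / (H (2 * a + c + y + 1) * H c))"
proof -
  have "{S. S \<subseteq> {a..<a + y} \<and> card S = y} = {{a..<a + y}}"
    using card_subset_eq[of "{a..<a + y}"] by auto
  then have "zsum a c (a + y) y = (\<Prod>s\<in>{a..<a + y}. zw a c (a + y) s) * (vdm sq {a..<a + y})\<^sup>2"
    by (simp add: zsum_def)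
  also have "(\<Prod>s\<in>{a..<a + y}. zw a c (a + y) s) = (\<Prod>i<y. wt a (a + y + c) (a + y) (a + 1 + i))"
  proof (rule prod.reindex_bij_witness[of _ "\<lambda>i. a + i" "\<lambda>s. s - a"])
    fix s assume "s \<in> {a..<a + y}"
    then show "wt a (a + y + c) (a + y) (a + 1 + (s - a)) = zw a c (a + y) s"
      using zw_eq[of a s "a + y" c] by simp
  qed auto
  also have "\<dots> = (\<Prod>i<y. real (a + 1 + i) * rfact (2 * a + 1 + i)
      / (rfact i * rfact (y - 1 - i) * rfact (2 * a + y + 1 + i))
      * (rfact (c + (y - Suc i)) * rfact (2 * a + c + y + 1 + i)))"
  proof (rule prod.cong[OF refl])
    fix i assume "i \<in> {..<y}"
    then have e: "a + 1 + i + a = 2 * a + 1 + i" "a + y + c - (a + 1 + i) = c + (y - Suc i)"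
      "a + y + c + (a + 1 + i) = 2 * a + c + y + 1 + i" "a + 1 + i - a - 1 = i"
      "a + y - (a + 1 + i) = y - 1 - i" "a + y + (a + 1 + i) = 2 * a + y + 1 + i" by auto
    show "wt a (a + y + c) (a + y) (a + 1 + i) = real (a + 1 + i) * rfact (2 * a + 1 + i)
      / (rfact i * rfact (y - 1 - i) * rfact (2 * a + y + 1 + i))
      * (rfact (c + (y - Suc i)) * rfact (2 * a + c + y + 1 + i))"
      unfolding wt_def e by (simp del: fact_Suc of_nat_add)
  qed
  also have "\<dots> = (\<Prod>i<y. real (a + 1 + i) * rfact (2 * a + 1 + i)
      / (rfact i * rfact (y - 1 - i) * rfact (2 * a + y + 1 + i)))
      * ((\<Prod>i<y. rfact (c + (y - Suc i))) * (\<Prod>i<y. rfact (2 * a + c + y + 1 + i)))"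
    by (simp only: prod.distrib)
  also have "(\<Prod>i<y. rfact (c + (y - Suc i))) = H (c + y) / H c"
    using prod.nat_diff_reindex[of "\<lambda>i. rfact (c + i)" y] H_pos[of c] by (simp add: H_add)
  also have "(\<Prod>i<y. rfact (2 * a + c + y + 1 + i)) = H (2 * a + c + 2 * y + 1) / H (2 * a + c + y + 1)"
    using H_add[of "2 * a + c + y + 1" y] H_pos[of "2 * a + c + y + 1"]
    by (simp add: mult_2[of y] algebra_simps del: fact_Suc)
  finally have "zsum a c (a + y) y = ((vdm sq {a..<a + y})\<^sup>2 * (\<Prod>i<y. real (a + 1 + i) * rfact (2 * a + 1 + i)
      / (rfact i * rfact (y - 1 - i) * rfact (2 * a + y + 1 + i))))
      * (H (c + y) / H c * (H (2 * a + c + 2 * y + 1) / H (2 * a + c + y + 1)))"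
    by (simp only: ac_simps)
  then show ?thesis unfolding vdm_interval by (simp add: ac_simps)
qed

section \<open>Positions of the dents\<close>

definition blocks :: "nat list \<Rightarrow> nat set \<Rightarrow> nat set" where
  "blocks t J = (\<Union>i\<in>J. {psum t (i - 1)..<psum t i})"

lemma psum_0 [simp]: "psum t 0 = 0"
  by (simp add: psum_def)

lemma psum_Suc: "psum t (Suc k) = psum t k + entry t (Suc k)"
  by (simp add: psum_def)

lemma psum_step: "1 \<le> i \<Longrightarrow> psum t i = psum t (i - 1) + entry t i"
  using psum_Suc[of t "i - 1"] by simp

lemma psum_mono: "i \<le> j \<Longrightarrow> psum t i \<le> psum t j"
  unfolding psum_def by (intro sum_mono2) auto

lemma psum_take: "psum t k = sum_list (take k t)"
proof (induction k)
  case (Suc k)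
  show ?case
  proof (cases "k < length t")
    case True
    then show ?thesis using Suc by (simp add: psum_Suc take_Suc_conv_app_nth entry_def)
  next
    case False
    then show ?thesis using Suc by (simp add: psum_Suc entry_def)
  qed
qed simp

lemma psum_full: "length t \<le> k \<Longrightarrow> psum t k = sum_list t"
  by (simp add: psum_take)

lemma psum_le: "psum t k \<le> sum_list t"
  using psum_mono[of k "max k (length t)" t] psum_full[of t "max k (length t)"] by simp

lemma osum_esum: "osum t + esum t = sum_list t"
proof -
  have e: "{i \<in> {1..length t}. odd i} \<union> {i \<in> {1..length t}. even i} = {1..length t}" by auto
  have "osum t + esum t = (\<Sum>i\<in>{i \<in> {1..length t}. odd i} \<union> {i \<in> {1..length t}. even i}. entry t i)"
    unfolding osum_def esum_def by (rule sum.union_disjoint[symmetric]) auto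
  then have "psum t (length t) = osum t + esum t" unfolding e psum_def by simp
  then show ?thesis by (simp add: psum_full)
qed

lemma blocks_disjoint:
  assumes "0 \<notin> J" "0 \<notin> J'" "J \<inter> J' = {}"
  shows "blocks t J \<inter> blocks t J' = {}"
proof (rule equals0I)
  fix v assume "v \<in> blocks t J \<inter> blocks t J'"
  then obtain i j where ij: "i \<in> J" "j \<in> J'" "psum t (i - 1) \<le> v" "v < psum t i"
    "psum t (j - 1) \<le> v" "v < psum t j" by (auto simp: blocks_def)
  then have "i \<noteq> j" "0 < i" "0 < j" using assms by (auto intro: gr0I)
  then consider "i \<le> j - 1" | "j \<le> i - 1" by linarith
  then show False
  proof cases
    case 1 then show ?thesis using psum_mono[OF 1, of t] ij by simp
  next
    case 2 then show ?thesis using psum_mono[OF 2, of t] ij by simp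
  qed
qed

lemma blocks_all: "blocks t {1..k} = {..<psum t k}"
proof (induction k)
  case 0 show ?case by (simp add: blocks_def)
next
  case (Suc k)
  have "blocks t {1..Suc k} = blocks t {1..k} \<union> {psum t k..<psum t (Suc k)}"
    by (simp add: blocks_def atLeastAtMostSuc_conv Un_commute)
  moreover have "{..<p} \<union> {p..<q} = {..<q}" if "p \<le> q" for p q :: nat using that by auto
  ultimately show ?case using Suc psum_mono[of k "Suc k" t] by simp
qed

lemma blocks_subset: "J \<subseteq> {1..k} \<Longrightarrow> blocks t J \<subseteq> {..<psum t k}"
  unfolding blocks_all[symmetric] by (auto simp: blocks_def)

lemma card_blocks:
  assumes "finite J" "0 \<notin> J"
  shows "card (blocks t J) = (\<Sum>i\<in>J. entry t i)"
proof -
  have "card (blocks t J) = (\<Sum>i\<in>J. card {psum t (i - 1)..<psum t i})"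
    unfolding blocks_def
  proof (rule card_UN_disjoint[OF assms(1)])
    show "\<forall>i\<in>J. \<forall>j\<in>J. i \<noteq> j \<longrightarrow> {psum t (i - 1)..<psum t i} \<inter> {psum t (j - 1)..<psum t j} = {}"
    proof (intro ballI impI)
      fix i j assume "i \<in> J" "j \<in> J" "i \<noteq> j"
      moreover from this have "0 < i" "0 < j" using assms(2) by (metis gr0I)+
      ultimately have "blocks t {i} \<inter> blocks t {j} = {}" by (intro blocks_disjoint) auto
      then show "{psum t (i - 1)..<psum t i} \<inter> {psum t (j - 1)..<psum t j} = {}" by (simp add: blocks_def)
    qed
  qed simp
  also have "\<dots> = (\<Sum>i\<in>J. entry t i)"
  proof (rule sum.cong[OF refl])
    fix i assume "i \<in> J"
    then have "1 \<le> i" using assms(2) by (cases i) auto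
    then show "card {psum t (i - 1)..<psum t i} = entry t i" using psum_step[of i t] by simp
  qed
  finally show ?thesis .
qed

definition odds :: "nat list \<Rightarrow> nat set" where
  "odds t = {i. i \<in> {1..length t} \<and> odd i}"

definition evens :: "nat list \<Rightarrow> nat set" where
  "evens t = {i. i \<in> {1..length t} \<and> even i}"

lemma odds_evens_mem [simp]:
  "i \<in> odds t \<longleftrightarrow> 1 \<le> i \<and> i \<le> length t \<and> odd i"
  "i \<in> evens t \<longleftrightarrow> 1 \<le> i \<and> i \<le> length t \<and> even i"
  by (simp_all add: odds_def evens_def)

lemma finite_odds_evens [simp]: "finite (odds t)" "finite (evens t)"
  by (simp_all add: odds_def evens_def)

lemma odds_evens_subset: "odds t \<subseteq> {1..length t}" "evens t \<subseteq> {1..length t}"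
  by auto

lemma osum_odds: "osum t = (\<Sum>i\<in>odds t. entry t i)"
  by (simp only: osum_def odds_def)

lemma esum_evens: "esum t = (\<Sum>i\<in>evens t. entry t i)"
  by (simp only: esum_def evens_def)

lemma card_odds: "card (blocks t (odds t)) = osum t"
  unfolding osum_odds by (rule card_blocks) simp_all

lemma card_evens: "card (blocks t (evens t)) = esum t"
  unfolding esum_evens by (rule card_blocks) simp_all

lemma blocks_Un: "blocks t (J \<union> J') = blocks t J \<union> blocks t J'"
  by (simp add: blocks_def)

lemma blocks_odds_evens: "blocks t (odds t) \<union> blocks t (evens t) = {..<sum_list t}"
proof -
  have "odds t \<union> evens t = {1..length t}" by auto
  then show ?thesis using blocks_all[of t "length t"] blocks_Un[of t "odds t" "evens t"] by (simp add: psum_full)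
qed

lemma blocks_odds_evens_disjoint: "blocks t (odds t) \<inter> blocks t (evens t) = {}"
  by (rule blocks_disjoint) auto

lemma blocks_bounded: "J \<subseteq> {1..length t} \<Longrightarrow> blocks t J \<subseteq> {..<sum_list t}"
  using blocks_subset[of J "length t" t] by (simp add: psum_full)

lemma entry_le_osum: "odd i \<Longrightarrow> entry t i \<le> osum t"
proof (cases "i \<in> odds t")
  case True then show ?thesis unfolding osum_odds by (intro member_le_sum) auto
qed (auto simp: entry_def)

lemma entry_le_esum: "even i \<Longrightarrow> entry t i \<le> esum t"
proof (cases "i \<in> evens t")
  case True then show ?thesis unfolding esum_evens by (intro member_le_sum) auto
qed (auto simp: entry_def)

definition reverse :: "nat \<Rightarrow> nat \<Rightarrow> nat" where
  "reverse L v = L - Suc v"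

lemma reverse_inj: "inj_on (reverse L) {..<L}"
  by (auto simp: inj_on_def reverse_def)

lemma reverse_image: "reverse L ` {p..<q} = {L - q..<L - p}" if "q \<le> L"
proof (intro equalityI subsetI)
  fix w assume "w \<in> {L - q..<L - p}"
  then have "w = reverse L (L - Suc w)" "L - Suc w \<in> {p..<q}" using that by (auto simp: reverse_def)
  then show "w \<in> reverse L ` {p..<q}" by blast
qed (use that in \<open>auto simp: reverse_def\<close>)

lemma reverse_blocks:
  assumes "sum_list t \<le> L"
  shows "reverse L ` blocks t J = (\<Union>j\<in>J. {L - psum t j..<L - psum t (j - 1)})"
proof -
  have "reverse L ` {psum t (j - 1)..<psum t j} = {L - psum t j..<L - psum t (j - 1)}" for j
    using psum_le[of t j] assms by (intro reverse_image) simp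
  then show ?thesis by (simp add: blocks_def image_UN)
qed

lemma card_reverse_blocks:
  assumes "sum_list t \<le> L" "J \<subseteq> {1..length t}"
  shows "card (reverse L ` blocks t J) = card (blocks t J)"
proof (rule card_image)
  show "inj_on (reverse L) (blocks t J)"
    by (rule inj_on_subset[OF reverse_inj]) (use blocks_bounded[OF assms(2)] assms(1) in auto)
qed

lemma cut_up_triangle: "cut (up_triangle p s) = {p..<p + s}"
  by (auto simp: cut_def UP_def up_triangle_mem)

lemma cut_UN: "cut (\<Union>i\<in>J. f i) = (\<Union>i\<in>J. cut (f i))"
  by (auto simp: cut_def)

lemma cut_Un: "cut (R \<union> R') = cut R \<union> cut R'"
  by (auto simp: cut_def)

lemma cut_blocks: "0 \<notin> J \<Longrightarrow> cut (\<Union>i\<in>J. up_triangle (psum t (i - 1)) (entry t i)) = blocks t J"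
  unfolding cut_UN cut_up_triangle blocks_def
proof (rule SUP_cong[OF refl])
  fix i assume "0 \<notin> J" "i \<in> J"
  then have "1 \<le> i" by (cases i) auto
  then show "{psum t (i - 1)..<psum t (i - 1) + entry t i} = {psum t (i - 1)..<psum t i}"
    by (simp only: psum_step)
qed

lemma cut_reverse_blocks:
  assumes "0 \<notin> J" "sum_list t \<le> L"
  shows "cut (\<Union>j\<in>J. up_triangle (L - psum t j) (entry t j)) = reverse L ` blocks t J"
  unfolding cut_UN cut_up_triangle reverse_blocks[OF assms(2)]
proof (rule SUP_cong[OF refl])
  fix j assume "j \<in> J"
  then have "1 \<le> j" using assms(1) by (cases j) auto
  then show "{L - psum t j..<L - psum t j + entry t j} = {L - psum t j..<L - psum t (j - 1)}"
    using psum_step[of j t] psum_le[of t j] assms(2) by simp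
qed

lemma Q_eq: "real (Q t) = weyl (blocks t (evens t)) / H2 (2 * esum t + 1)"
proof -
  define G where "G = (\<Union>i\<in>evens t. up_triangle (psum t (i - 1)) (entry t i))"
  have "(\<Union>i\<in>{1..length t div 2}. up_triangle (psum t (2 * i - 1)) (entry t (2 * i))) = G"
  proof -
    have "evens t = (\<lambda>i. 2 * i) ` {1..length t div 2}" by (auto elim!: evenE)
    then show ?thesis by (simp add: G_def)
  qed
  then have "quartered_hexagon t = rows (osum t + esum t) (esum t) 0 - G"
    unfolding quartered_hexagon_def quarter_cells by simp
  moreover have "dent_of (rows (osum t + esum t) (esum t) 0) G"
    unfolding G_def
  proof (intro dent_of_UN dent_of_up_triangle)
    fix i assume i: "i \<in> evens t"
    then have "psum t (i - 1) + entry t i = psum t i" using psum_step[of i t] by simp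
    then show "psum t (i - 1) + entry t i \<le> osum t + esum t" using psum_le[of t i] by (simp add: osum_esum)
    show "entry t i \<le> esum t" using entry_le_esum i by simp
  qed
  then have "M (rows (osum t + esum t) (esum t) 0 - G - ups 0 {})
      = M (rows (osum t + esum t) (esum t) 0 - ups 0 (cut G \<union> {}))"
    unfolding cut_def by (rule M_dent) simp
  moreover have "cut G = blocks t (evens t)" unfolding G_def by (rule cut_blocks) simp
  moreover have "blocks t (evens t) \<subseteq> {..<osum t + esum t}"
    unfolding osum_esum by (rule blocks_bounded[OF odds_evens_subset(2)])
  ultimately show ?thesis using M_rows_dented[OF _ card_evens] by (simp add: Q_def)
qed

lemma psum_entries: "sum_list (map (entry t) [1..<Suc k]) = psum t k"
  by (induction k) (simp_all add: psum_Suc)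

lemma psum_entries_rev: "sum_list (map (entry t) (rev [1..<Suc k])) = psum t k"
  using psum_entries[of t k] by (simp add: rev_map[symmetric])

lemma take_upt': "k \<le> p \<Longrightarrow> take k (map f [1..<Suc p]) = map f [1..<Suc k]"
  by (simp add: take_map take_upt del: upt_Suc)

text \<open>The dents of the quartered hexagons with parameters \<open>t\<^sup>+\<close> and \<open>t\<^sup>-\<close>; the list \<open>pre\<close> is
  \<open>[0]\<close> for the former and empty for the latter, and \<open>post\<close> is empty or \<open>[z]\<close>.\<close>

lemma psum_composed:
  fixes as bs pre post :: "nat list" and x y ga gb p q :: nat
  assumes pre: "sum_list pre = 0" and p: "psum as p + ga = sum_list as" and q: "psum bs q + gb = sum_list bs"
  defines "t \<equiv> pre @ map (entry as) [1..<Suc p] @ [ga + x + y + gb] @ map (entry bs) (rev [1..<Suc q]) @ post"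
  shows "k \<le> p \<Longrightarrow> psum t (length pre + k) = psum as k"
    and "j \<le> q \<Longrightarrow> psum t (length pre + p + 1 + j) = x + y + sum_list as + sum_list bs - psum bs (q - j)"
    and "psum t (length t) = x + y + sum_list as + sum_list bs + sum_list post"
proof -
  show "psum t (length pre + k) = psum as k" if "k \<le> p"
  proof -
    have "sum_list (take (length pre + k) t) = sum_list pre + sum_list (take k (map (entry as) [1..<Suc p]))"
      using that by (simp add: t_def del: upt_Suc)
    then show ?thesis
      unfolding psum_take[symmetric] take_upt'[OF that] psum_entries pre by simp
  qed
  have tk: "psum t (length pre + p + 1 + j)
      = psum as p + (ga + x + y + gb) + sum_list (take j (map (entry bs) (rev [1..<Suc q])))" if "j \<le> q" for j
  proof -
    have "sum_list (take (length pre + p + 1 + j) t) = sum_list pre + sum_list (map (entry as) [1..<Suc p])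
        + (ga + x + y + gb) + sum_list (take j (map (entry bs) (rev [1..<Suc q])))"
      using that by (simp add: t_def del: upt_Suc)
    then show ?thesis unfolding psum_take[symmetric] psum_entries pre by simp
  qed
  have tr: "sum_list (take j (map (entry bs) (rev [1..<Suc q]))) + psum bs (q - j) = psum bs q" if "j \<le> q" for j
  proof -
    have "sum_list (map (entry bs) (rev [1..<Suc q])) = sum_list (take j (map (entry bs) (rev [1..<Suc q])))
        + sum_list (drop j (map (entry bs) (rev [1..<Suc q])))"
      by (simp only: sum_list_append[symmetric] append_take_drop_id)
    moreover have "drop j (map (entry bs) (rev [1..<Suc q])) = map (entry bs) (rev [1..<Suc (q - j)])"
      using that by (simp add: drop_map drop_rev Suc_diff_le del: upt_Suc)
    ultimately show ?thesis by (simp only: psum_entries_rev)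
  qed
  show "psum t (length pre + p + 1 + j) = x + y + sum_list as + sum_list bs - psum bs (q - j)" if "j \<le> q"
    using tk[OF that] tr[OF that] p q psum_le[of bs "q - j"] by linarith
  have "psum t (length t) = sum_list t" by (rule psum_full) simp
  also have "\<dots> = psum as p + (ga + x + y + gb) + psum bs q + sum_list post"
    unfolding t_def using pre psum_entries[of as p] psum_entries_rev[of bs q] by (simp del: upt_Suc)
  finally show "psum t (length t) = x + y + sum_list as + sum_list bs + sum_list post" using p q by linarith
qed

lemma blocks_composed:
  fixes as bs pre post :: "nat list" and x y ga gb p q :: nat
  assumes pre: "sum_list pre = 0" and p: "psum as p + ga = sum_list as" and q: "psum bs q + gb = sum_list bs"
    and par: "even (length pre + p)" and post: "length post \<le> 1" "post \<noteq> [] \<longleftrightarrow> even q"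
    and pre1: "length pre \<le> 1"
  defines "t \<equiv> pre @ map (entry as) [1..<Suc p] @ [ga + x + y + gb] @ map (entry bs) (rev [1..<Suc q]) @ post"
  defines "L \<equiv> x + y + sum_list as + sum_list bs"
  shows "blocks t (evens t) = blocks as {i \<in> {1..p}. even i \<longleftrightarrow> even p}
      \<union> reverse L ` blocks bs {j \<in> {1..q}. even j \<longleftrightarrow> even q} \<union> {L..<L + sum_list post}" (is "?l = ?r")
proof -
  define d where "d = length pre"
  note ps = psum_composed[OF pre p q, where x = x and y = y and post = post, folded t_def L_def d_def]
  have len: "length t = d + p + 1 + q + length post" by (simp add: t_def d_def)
  have bL: "sum_list bs \<le> L" by (simp add: L_def)
  have D: "v \<in> ?r" if v: "v \<in> ?l" for v
  proof -
    obtain i where i: "1 \<le> i" "i \<le> length t" "even i" "psum t (i - 1) \<le> v" "v < psum t i"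
      using v by (auto simp: blocks_def)
    consider "i \<le> d" | k where "i = d + k" "1 \<le> k" "k \<le> p" | "i = d + p + 1"
      | j where "i = d + p + 1 + j" "1 \<le> j" "j \<le> q" | "i = d + p + 1 + q + 1" "length post = 1"
    proof -
      assume a: "i \<le> d \<Longrightarrow> thesis" "\<And>k. i = d + k \<Longrightarrow> 1 \<le> k \<Longrightarrow> k \<le> p \<Longrightarrow> thesis" "i = d + p + 1 \<Longrightarrow> thesis"
        "\<And>j. i = d + p + 1 + j \<Longrightarrow> 1 \<le> j \<Longrightarrow> j \<le> q \<Longrightarrow> thesis" "i = d + p + 1 + q + 1 \<Longrightarrow> length post = 1 \<Longrightarrow> thesis"
      show thesis
        using a(1) a(2)[of "i - d"] a(3) a(4)[of "i - (d + p + 1)"] a(5) i(2) post(1) len by linarith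
    qed
    then show ?thesis
    proof cases
      case 1
      then have "psum t i \<le> psum t (d + 0)" by (intro psum_mono) simp
      then show ?thesis using i ps(1)[of 0] by simp
    next
      case (2 k)
      then have "i - 1 = d + (k - 1)" by simp
      then have "psum as (k - 1) \<le> v" "v < psum as k" using i(4,5) ps(1)[of k] ps(1)[of "k - 1"] 2 by simp_all
      moreover have "even k \<longleftrightarrow> even p" using i(3) par 2(1) by (auto simp: d_def)
      ultimately show ?thesis using 2 by (auto simp: blocks_def)
    next
      case 3 then show ?thesis using i(3) par by (simp add: d_def)
    next
      case (4 j)
      then have "i - 1 = d + p + 1 + (j - 1)" by simp
      then have "L - psum bs (q - (j - 1)) \<le> v" "v < L - psum bs (q - j)"
        using i(4,5) ps(2)[of j] ps(2)[of "j - 1"] 4 by simp_all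
      moreover have "q - (j - 1) = q - j + 1" using 4 by simp
      moreover have "even (q - j + 1) \<longleftrightarrow> even q" using i(3) par 4 by (auto simp: d_def)
      moreover have "q - j + 1 \<in> {1..q}" using 4 by simp
      ultimately have "v \<in> reverse L ` blocks bs {j \<in> {1..q}. even j \<longleftrightarrow> even q}"
        unfolding reverse_blocks[OF bL] by (intro UN_I[of "q - j + 1"]) simp_all
      then show ?thesis by blast
    next
      case 5
      then have "i - 1 = d + p + 1 + q" "i = length t" by (simp_all add: len)
      then have "L \<le> v" "v < L + sum_list post" using i(4,5) ps(2)[of q] ps(3) by simp_all
      then show ?thesis by simp
    qed
  qed
  have 1: "v \<in> ?l" if v: "v \<in> blocks as {i \<in> {1..p}. even i \<longleftrightarrow> even p}" for v
  proof -
    obtain k where k: "1 \<le> k" "k \<le> p" "even k \<longleftrightarrow> even p" "psum as (k - 1) \<le> v" "v < psum as k"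
      using v by (auto simp: blocks_def)
    have e: "d + k - 1 = d + (k - 1)" using k by simp
    have "d + k \<in> evens t" using k par by (auto simp: len d_def)
    moreover have "psum t (d + k - 1) \<le> v" "v < psum t (d + k)"
      using k ps(1)[of k] ps(1)[of "k - 1"] unfolding e by simp_all
    ultimately show ?thesis unfolding blocks_def by (intro UN_I[of "d + k"]) simp_all
  qed
  have 2: "v \<in> ?l" if v: "v \<in> reverse L ` blocks bs {j \<in> {1..q}. even j \<longleftrightarrow> even q}" for v
  proof -
    obtain h where h: "1 \<le> h" "h \<le> q" "even h \<longleftrightarrow> even q" "L - psum bs h \<le> v" "v < L - psum bs (h - 1)"
      using v unfolding reverse_blocks[OF bL] by auto
    define j where "j = q + 1 - h"
    have j: "1 \<le> j" "j \<le> q" "q - (j - 1) = h" "q - j = h - 1" using h by (auto simp: j_def)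
    have e: "d + p + 1 + j - 1 = d + p + 1 + (j - 1)" using j by simp
    have "odd j" using h(2,3) by (auto simp: j_def)
    then have "d + p + 1 + j \<in> evens t" using j par by (auto simp: len d_def)
    moreover have "psum t (d + p + 1 + j - 1) \<le> v" "v < psum t (d + p + 1 + j)"
      using h j ps(2)[of j] ps(2)[of "j - 1"] unfolding e by simp_all
    ultimately show ?thesis unfolding blocks_def by (intro UN_I[of "d + p + 1 + j"]) simp_all
  qed
  have 3: "v \<in> ?l" if "v \<in> {L..<L + sum_list post}" for v
  proof -
    have "post \<noteq> []" using that by auto
    then have l: "length post = 1" "even q" using post by (cases post, auto)
    have e: "length t - 1 = d + p + 1 + q" using l by (simp add: len)
    have "length t \<in> evens t" using l par by (simp add: len d_def)
    moreover have "psum t (length t - 1) \<le> v" "v < psum t (length t)"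
      using that ps(2)[of q] ps(3) unfolding e by simp_all
    ultimately show ?thesis unfolding blocks_def by (intro UN_I[of "length t"]) simp_all
  qed
  from D 1 2 3 show ?thesis by blast
qed

lemma blocks_extend:
  assumes "\<And>i. i \<in> J \<Longrightarrow> i \<notin> J' \<Longrightarrow> 1 \<le> i \<Longrightarrow> entry t i = 0" "J' \<subseteq> J" "0 \<notin> J"
  shows "blocks t J = blocks t J'"
proof (intro equalityI subsetI)
  fix v assume "v \<in> blocks t J"
  then obtain i where i: "i \<in> J" "psum t (i - 1) \<le> v" "v < psum t i" by (auto simp: blocks_def)
  have "i \<noteq> 0" using i(1) assms(3) by metis
  then have "1 \<le> i" by simp
  then have "entry t i \<noteq> 0" using i(2,3) psum_step[of i t] by linarith
  then have "i \<in> J'" using assms(1)[of i] i(1) \<open>1 \<le> i\<close> by (cases "i \<in> J'") simp_all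
  then show "v \<in> blocks t J'" using i by (auto simp: blocks_def)
qed (use assms(2) in \<open>auto simp: blocks_def\<close>)

definition upper_dents :: "nat \<Rightarrow> nat list \<Rightarrow> nat list \<Rightarrow> nat set" where
  "upper_dents L as bs = blocks as (odds as) \<union> reverse L ` blocks bs (odds bs)"

definition lower_dents :: "nat \<Rightarrow> nat \<Rightarrow> nat list \<Rightarrow> nat list \<Rightarrow> nat set" where
  "lower_dents z L as bs = blocks as (evens as) \<union> reverse L ` blocks bs (evens bs) \<union> {L..<L + z}"

lemma psum_beyond: "length t \<le> Suc k \<Longrightarrow> psum t k + entry t (Suc k) = sum_list t"
  using psum_full[of t "Suc k"] by (simp add: psum_Suc)

lemma blocks_parity:
  assumes "length t \<le> Suc p"
  shows "blocks t {i \<in> {1..p}. even i \<longleftrightarrow> even p} = blocks t (if even p then evens t else odds t)"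
proof (rule blocks_extend)
  show "(if even p then evens t else odds t) \<subseteq> {i \<in> {1..p}. even i \<longleftrightarrow> even p}"
  proof
    fix i assume i: "i \<in> (if even p then evens t else odds t)"
    then have "even i \<longleftrightarrow> even p" by (auto split: if_splits)
    moreover from this have "i \<noteq> Suc p" by auto
    ultimately show "i \<in> {i \<in> {1..p}. even i \<longleftrightarrow> even p}" using i assms by (auto split: if_splits)
  qed
qed (auto simp: entry_def split: if_splits)

lemma blocks_tplus:
  "blocks (tplus x y as bs) (evens (tplus x y as bs)) = upper_dents (x + y + sum_list as + sum_list bs) as bs"
proof -
  define p where "p = 2 * ((len as + 1) div 2) - 1"
  define q where "q = 2 * ((len bs + 1) div 2) - 1"
  have l: "1 \<le> len as" "1 \<le> len bs" "length as \<le> len as" "length bs \<le> len bs" by (auto simp: len_def)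
  have p: "2 * ((len as + 1) div 2) = Suc p" "odd p" "length as \<le> Suc p"
    using l by (auto simp: p_def)
  have q: "2 * ((len bs + 1) div 2) = Suc q" "odd q" "length bs \<le> Suc q"
    using l by (auto simp: q_def)
  have t: "tplus x y as bs = [0] @ map (entry as) [1..<Suc p] @ [entry as (Suc p) + x + y + entry bs (Suc q)]
      @ map (entry bs) (rev [1..<Suc q]) @ []"
    unfolding tplus_def Let_def p(1) q(1) by (simp del: upt_Suc)
  show ?thesis
    unfolding t
    by (subst blocks_composed[OF _ psum_beyond[OF p(3)] psum_beyond[OF q(3)]])
       (use p(2) q(2) blocks_parity[OF p(3)] blocks_parity[OF q(3)] in \<open>simp_all add: upper_dents_def\<close>)
qed

lemma blocks_tminus:
  "blocks (tminus x y z as bs) (evens (tminus x y z as bs)) = lower_dents z (x + y + sum_list as + sum_list bs) as bs"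
proof -
  define p where "p = 2 * (len as div 2)"
  define q where "q = 2 * (len bs div 2)"
  have l: "length as \<le> len as" "length bs \<le> len bs" by (auto simp: len_def)
  have p: "even p" "length as \<le> Suc p" using l by (auto simp: p_def)
  have q: "even q" "length bs \<le> Suc q" using l by (auto simp: q_def)
  have t: "tminus x y z as bs = [] @ map (entry as) [1..<Suc p] @ [entry as (Suc p) + x + y + entry bs (Suc q)]
      @ map (entry bs) (rev [1..<Suc q]) @ [z]"
    by (simp add: tminus_def Let_def p_def q_def del: upt_Suc)
  show ?thesis
    unfolding t
    by (subst blocks_composed[OF _ psum_beyond[OF p(2)] psum_beyond[OF q(2)]])
       (use p(1) q(1) blocks_parity[OF p(2)] blocks_parity[OF q(2)] in \<open>simp_all add: lower_dents_def\<close>)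
qed

lemma dents_structure:
  assumes L: "L = x + y + sum_list as + sum_list bs"
  shows "upper_dents L as bs \<subseteq> {..<L}" "lower_dents z L as bs \<subseteq> {..<L + z}"
    and "upper_dents L as bs \<inter> lower_dents z L as bs = {}"
    and "upper_dents L as bs \<union> lower_dents z L as bs = {..<sum_list as} \<union> {sum_list as + x + y..<sum_list as + x + y + (sum_list bs + z)}"
    and "card (upper_dents L as bs) = osum as + osum bs"
    and "card (lower_dents z L as bs) = esum as + esum bs + z"
proof -
  have bL: "sum_list bs \<le> L" by (simp add: L)
  define A1 A2 where "A1 = blocks as (odds as)" and "A2 = blocks as (evens as)"
  define B1 B2 where "B1 = reverse L ` blocks bs (odds bs)" and "B2 = reverse L ` blocks bs (evens bs)"
  have A: "A1 \<union> A2 = {..<sum_list as}" "A1 \<inter> A2 = {}"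
    using blocks_odds_evens[of as] blocks_odds_evens_disjoint[of as] by (simp_all add: A1_def A2_def)
  have "B1 \<union> B2 = reverse L ` {0..<sum_list bs}"
    unfolding B1_def B2_def image_Un[symmetric] blocks_odds_evens by (simp add: lessThan_atLeast0)
  also have "\<dots> = {L - sum_list bs..<L}" using reverse_image[OF bL, of 0] by simp
  finally have B: "B1 \<union> B2 = {L - sum_list bs..<L}" .
  have sub: "blocks bs (odds bs) \<subseteq> {..<L}" "blocks bs (evens bs) \<subseteq> {..<L}"
    using blocks_bounded[OF odds_evens_subset(1), of bs] blocks_bounded[OF odds_evens_subset(2), of bs] bL
    by (auto dest: order_less_le_trans)
  have "B1 \<inter> B2 = reverse L ` (blocks bs (odds bs) \<inter> blocks bs (evens bs))"
    unfolding B1_def B2_def by (rule inj_on_image_Int[OF reverse_inj sub, symmetric])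
  then have B': "B1 \<inter> B2 = {}" by (simp add: blocks_odds_evens_disjoint)
  have u: "upper_dents L as bs = A1 \<union> B1" and l: "lower_dents z L as bs = A2 \<union> B2 \<union> {L..<L + z}"
    by (simp_all add: upper_dents_def lower_dents_def A1_def A2_def B1_def B2_def)
  have bounds: "A1 \<subseteq> {..<sum_list as}" "A2 \<subseteq> {..<sum_list as}" "B1 \<subseteq> {L - sum_list bs..<L}" "B2 \<subseteq> {L - sum_list bs..<L}"
    using A(1) B by auto
  have aL: "sum_list as \<le> L - sum_list bs" "L - sum_list bs \<le> L" by (simp_all add: L)
  have aL': "{..<sum_list as} \<subseteq> {..<L}" "{..<sum_list as} \<inter> {L - sum_list bs..<L} = {}"
    "{..<sum_list as} \<inter> {L..<L + z} = {}" "{L - sum_list bs..<L} \<inter> {L..<L + z} = {}"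
    using aL by auto
  have BL: "{L - sum_list bs..<L} \<subseteq> {..<L}" by auto
  note s = subset_trans[OF bounds(1) aL'(1)] subset_trans[OF bounds(2) aL'(1)]
    subset_trans[OF bounds(3) BL] subset_trans[OF bounds(4) BL]
  show "upper_dents L as bs \<subseteq> {..<L}" unfolding u by (intro Un_least s)
  have "{..<L} \<subseteq> {..<L + z}" by simp
  then show "lower_dents z L as bs \<subseteq> {..<L + z}"
    unfolding l by (intro Un_least subset_trans[OF s(2)] subset_trans[OF s(4)]) auto
  have d: "A1 \<inter> B1 = {}" "A2 \<inter> B2 = {}" "A1 \<inter> B2 = {}" "A2 \<inter> B1 = {}"
    using aL'(2) bounds by (meson disjoint_iff subsetD)+
  have d': "X \<inter> {L..<L + z} = {}" if "X \<subseteq> {..<L}" for X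
    using that by (auto simp: disjoint_iff)
  show "upper_dents L as bs \<inter> lower_dents z L as bs = {}"
    unfolding u l Int_Un_distrib Int_Un_distrib2 using A(2) B' d(3,4) d'[OF s(1)] d'[OF s(3)] by (simp add: Int_commute)
  have "upper_dents L as bs \<union> lower_dents z L as bs = (A1 \<union> A2) \<union> ((B1 \<union> B2) \<union> {L..<L + z})"
    unfolding u l by blast
  also have "\<dots> = {..<sum_list as} \<union> {L - sum_list bs..<L + z}" unfolding A B using aL(2) by auto
  also have "\<dots> = {..<sum_list as} \<union> {sum_list as + x + y..<sum_list as + x + y + (sum_list bs + z)}"
    by (simp add: L add.commute add.left_commute)
  finally show "upper_dents L as bs \<union> lower_dents z L as bs = \<dots>" .
  have f: "finite A1" "finite A2" "finite B1" "finite B2"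
    using bounds by (auto intro: finite_subset)
  have c: "card A1 = osum as" "card A2 = esum as" "card B1 = osum bs" "card B2 = esum bs"
    using card_reverse_blocks[OF bL odds_evens_subset(1)] card_reverse_blocks[OF bL odds_evens_subset(2)]
    by (simp_all add: A1_def A2_def B1_def B2_def card_odds card_evens)
  have d3: "(A2 \<union> B2) \<inter> {L..<L + z} = {}" by (rule d'[OF Un_least[OF s(2,4)]])
  show "card (upper_dents L as bs) = osum as + osum bs"
    unfolding u card_Un_disjoint[OF f(1,3) d(1)] c ..
  have "card (A2 \<union> B2 \<union> {L..<L + z}) = card (A2 \<union> B2) + card {L..<L + z}"
    by (rule card_Un_disjoint[OF _ _ d3]) (use f in simp_all)
  also have "card (A2 \<union> B2) = card A2 + card B2" by (rule card_Un_disjoint[OF f(2,4) d(2)])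
  finally show "card (lower_dents z L as bs) = esum as + esum bs + z" by (simp add: l c)
qed

lemma esum_tplus: "esum (tplus x y as bs) = osum as + osum bs"
  using card_evens[of "tplus x y as bs"] dents_structure(5)[OF refl, of x y as bs] by (simp add: blocks_tplus)

lemma esum_tminus: "esum (tminus x y z as bs) = esum as + esum bs + z"
  using card_evens[of "tminus x y z as bs"] dents_structure(6)[OF refl, of z x y as bs] by (simp add: blocks_tminus)

section \<open>The halved hexagon\<close>

lemma mirror_image_Diff: "mirror ` (R - R') = mirror ` R - mirror ` R'"
  by (rule image_set_diff[OF mirror_inj])

definition upper_half :: "region" where
  "upper_half = {t. (\<exists>i k. t = Ut i k \<and> 0 \<le> k) \<or> (\<exists>i k. t = Dt i k \<and> 1 \<le> k)}"

lemma upper_halfI: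
  assumes "R \<subseteq> unit_triangles" "\<And>i k. Ut i k \<in> R \<Longrightarrow> 0 \<le> k" "\<And>i k. Dt i k \<in> R \<Longrightarrow> 1 \<le> k"
  shows "R \<subseteq> upper_half"
proof
  fix t assume t: "t \<in> R"
  then have "t \<in> unit_triangles" using assms(1) by blast
  then show "t \<in> upper_half"
    by (cases rule: unit_triangle_cases) (use t assms(2,3) in \<open>auto simp: upper_half_def\<close>)
qed

lemma upper_half_subsets:
  "rows W n 0 \<subseteq> upper_half" "up_triangle p s \<subseteq> upper_half" "left_dent as \<subseteq> upper_half"
proof -
  show "rows W n 0 \<subseteq> upper_half" by (rule upper_halfI[OF rows_unit]) (auto simp: Ut_rows Dt_rows)
  show "up_triangle p s \<subseteq> upper_half"
    by (rule upper_halfI) (auto simp: up_triangle_mem, auto simp: up_triangle_def cells_def)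
  show "left_dent as \<subseteq> upper_half"
    by (rule upper_halfI) (auto simp: left_dent_mem, auto simp: left_dent_def cells_def)
qed

lemma mirror_upper_half: "mirror ` upper_half \<inter> upper_half = {}"
proof (rule equals0I)
  fix t assume "t \<in> mirror ` upper_half \<inter> upper_half"
  then have "t \<in> upper_half" "mirror t \<in> upper_half" by (auto simp: mirror_image_mem)
  then show False by (auto simp: upper_half_def)
qed

definition upper_gap :: "nat \<Rightarrow> nat \<Rightarrow> nat list \<Rightarrow> nat list \<Rightarrow> region" where
  "upper_gap L n as bs = (left_dent as \<inter> rows L n 0)
     \<union> (\<Union>i\<in>odds as - {1}. up_triangle (psum as (i - 1)) (entry as i))
     \<union> (\<Union>j\<in>odds bs. up_triangle (L - psum bs j) (entry bs j))"

definition lower_gap :: "nat \<Rightarrow> nat \<Rightarrow> nat list \<Rightarrow> nat list \<Rightarrow> region" where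
  "lower_gap z L as bs = up_triangle L z
     \<union> (\<Union>i\<in>evens as. up_triangle (psum as (i - 1)) (entry as i))
     \<union> (\<Union>j\<in>evens bs. up_triangle (L - psum bs j) (entry bs j))"

lemma H1_region_eq:
  fixes x y z :: nat and as bs :: "nat list"
  defines "L \<equiv> x + y + sum_list as + sum_list bs"
  defines "n \<equiv> y + osum as + osum bs" and "n' \<equiv> y + z + esum as + esum bs"
  shows "H1_region x y z as bs
    = (rows L n 0 - upper_gap L n as bs) \<union> mirror ` (rows (L + z) n' 0 - lower_gap z L as bs)"
proof -
  have L: "base_length x y as bs = L" by (simp add: base_length_def L_def)
  have up: "upper_part x y as bs = rows L n 0"
    unfolding upper_part_def upper_height_def L n_def[symmetric] by (rule quarter_cells)
  have low: "lower_part x y z as bs = mirror ` (rows (L + z) n' 0 - up_triangle L z)"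
    unfolding lower_part_def lower_height_def L n'_def[symmetric] by (rule lower_cells)
  define Ao where "Ao = (\<Union>i\<in>odds as - {1}. up_triangle (psum as (i - 1)) (entry as i))"
  define Ae where "Ae = (\<Union>i\<in>evens as. up_triangle (psum as (i - 1)) (entry as i))"
  define Bo where "Bo = (\<Union>j\<in>odds bs. up_triangle (L - psum bs j) (entry bs j))"
  define Be where "Be = (\<Union>j\<in>evens bs. up_triangle (L - psum bs j) (entry bs j))"
  have a: "a_dents as = mirror ` Ae \<union> Ao"
  proof -
    have "{2..length as} = evens as \<union> (odds as - {1})"
    proof (intro equalityI subsetI)
      fix i assume "i \<in> evens as \<union> (odds as - {1})"
      then have "1 \<le> i" "i \<noteq> 1" "i \<le> length as" by auto
      then show "i \<in> {2..length as}" by simp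
    qed auto
    then show ?thesis
      unfolding a_dents_def Ae_def Ao_def image_UN by (simp add: UN_Un down_triangle_mirror)
  qed
  have b: "b_dents x y as bs = Bo \<union> mirror ` Be"
  proof -
    have "{1..length bs} = odds bs \<union> evens bs" by auto
    then show ?thesis
      unfolding b_dents_def Be_def Bo_def image_UN L by (simp add: UN_Un down_triangle_mirror)
  qed
  have sub: "rows L n 0 \<subseteq> upper_half" "rows (L + z) n' 0 - up_triangle L z \<subseteq> upper_half"
    "left_dent as \<subseteq> upper_half" "Ao \<subseteq> upper_half" "Ae \<subseteq> upper_half" "Bo \<subseteq> upper_half" "Be \<subseteq> upper_half"
    using upper_half_subsets unfolding Ao_def Ae_def Bo_def Be_def by blast+
  have alg: "(U \<union> mirror ` V) - (D \<union> (mirror ` E \<union> D') \<union> (D'' \<union> mirror ` E'))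
      = (U - (D \<inter> U \<union> D' \<union> D'')) \<union> (mirror ` V - mirror ` (E \<union> E'))"
    if "U \<subseteq> upper_half" "V \<subseteq> upper_half" "D \<subseteq> upper_half" "D' \<subseteq> upper_half" "E \<subseteq> upper_half"
      "D'' \<subseteq> upper_half" "E' \<subseteq> upper_half" for U V D D' D'' E E'
  proof -
    have "mirror ` V \<inter> (D \<union> D' \<union> D'') = {}" "U \<inter> mirror ` (E \<union> E') = {}"
      using that mirror_upper_half by blast+
    then show ?thesis by blast
  qed
  have "H1_region x y z as bs = (rows L n 0 - (left_dent as \<inter> rows L n 0 \<union> Ao \<union> Bo))
      \<union> (mirror ` (rows (L + z) n' 0 - up_triangle L z) - mirror ` (Ae \<union> Be))"
    unfolding H1_region_def up low a b by (rule alg) (use sub in simp_all)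
  also have "mirror ` (rows (L + z) n' 0 - up_triangle L z) - mirror ` (Ae \<union> Be)
      = mirror ` (rows (L + z) n' 0 - (up_triangle L z \<union> Ae \<union> Be))"
    unfolding mirror_image_Diff[symmetric] by (rule arg_cong[where f = "image mirror"]) blast
  finally show ?thesis
    by (simp only: upper_gap_def lower_gap_def Ao_def Ae_def Bo_def Be_def)
qed

lemma upper_gap_dent:
  fixes L y as bs
  assumes "sum_list as + sum_list bs \<le> L"
  defines "n \<equiv> y + osum as + osum bs"
  shows "dent_of (rows L n 0) (upper_gap L n as bs)" "cut (upper_gap L n as bs) = upper_dents L as bs"
proof -
  have 1: "psum as (i - 1) + entry as i \<le> L" if "1 \<le> i" for i
    using psum_step[OF that, of as] psum_le[of as i] assms(1) by simp
  have 2: "L - psum bs j + entry bs j \<le> L" if "1 \<le> j" for j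
    using psum_step[OF that, of bs] psum_le[of bs j] assms(1) by simp
  have a1: "entry as 1 \<le> osum as" by (rule entry_le_osum) simp
  show "dent_of (rows L n 0) (upper_gap L n as bs)"
    unfolding upper_gap_def
  proof (intro dent_of_Un dent_of_UN dent_of_up_triangle dent_of_left_dent)
    fix i assume "i \<in> odds as - {1}"
    then show "psum as (i - 1) + entry as i \<le> L" "entry as i \<le> n"
      using 1[of i] entry_le_osum[of i as] by (auto simp: n_def)
  next
    fix j assume "j \<in> odds bs"
    then show "L - psum bs j + entry bs j \<le> L" "entry bs j \<le> n"
      using 2[of j] entry_le_osum[of j bs] by (auto simp: n_def)
  qed (use a1 in \<open>simp add: n_def\<close>)
  have p1: "psum as (Suc 0) = entry as (Suc 0)" using psum_Suc[of as 0] by simp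
  have "cut (left_dent as \<inter> rows L n 0) = {..<entry as 1}"
  proof (intro equalityI subsetI)
    fix e assume "e \<in> {..<entry as 1}"
    then show "e \<in> cut (left_dent as \<inter> rows L n 0)"
      using a1 psum_le[of as 1] assms(1) by (auto simp: cut_def UP_def left_dent_mem Ut_rows p1 n_def)
  qed (auto simp: cut_def UP_def left_dent_mem)
  moreover have "cut (\<Union>i\<in>odds as - {1}. up_triangle (psum as (i - 1)) (entry as i)) = blocks as (odds as - {1})"
    by (rule cut_blocks) simp
  moreover have "cut (\<Union>j\<in>odds bs. up_triangle (L - psum bs j) (entry bs j)) = reverse L ` blocks bs (odds bs)"
    by (rule cut_reverse_blocks) (use assms(1) in simp_all)
  moreover have "{..<entry as 1} \<union> blocks as (odds as - {1}) = blocks as (odds as)"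
  proof (cases "length as = 0")
    case True
    then show ?thesis by (simp add: entry_def blocks_def)
  next
    case False
    then have "1 \<in> odds as" by (simp add: Suc_le_eq)
    then have "odds as = {1} \<union> (odds as - {1})" by auto
    then have "blocks as (odds as) = blocks as {1} \<union> blocks as (odds as - {1})"
      using blocks_Un[of as "{1}" "odds as - {1}"] by simp
    moreover have "blocks as {1} = {..<entry as 1}" by (auto simp: blocks_def p1)
    ultimately show ?thesis by simp
  qed
  ultimately show "cut (upper_gap L n as bs) = upper_dents L as bs"
    by (simp add: upper_gap_def cut_Un upper_dents_def)
qed

lemma lower_gap_dent:
  fixes L y z as bs
  assumes "sum_list as + sum_list bs \<le> L"
  defines "n \<equiv> y + z + esum as + esum bs"
  shows "dent_of (rows (L + z) n 0) (lower_gap z L as bs)" "cut (lower_gap z L as bs) = lower_dents z L as bs"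
proof -
  have 1: "psum as (i - 1) + entry as i \<le> L + z" if "1 \<le> i" for i
    using psum_step[OF that, of as] psum_le[of as i] assms(1) by simp
  have 2: "L - psum bs j + entry bs j \<le> L + z" if "1 \<le> j" for j
    using psum_step[OF that, of bs] psum_le[of bs j] assms(1) by simp
  show "dent_of (rows (L + z) n 0) (lower_gap z L as bs)"
    unfolding lower_gap_def
  proof (intro dent_of_Un dent_of_UN dent_of_up_triangle)
    fix i assume "i \<in> evens as"
    then show "psum as (i - 1) + entry as i \<le> L + z" "entry as i \<le> n"
      using 1[of i] entry_le_esum[of i as] by (auto simp: n_def)
  next
    fix j assume "j \<in> evens bs"
    then show "L - psum bs j + entry bs j \<le> L + z" "entry bs j \<le> n"
      using 2[of j] entry_le_esum[of j bs] by (auto simp: n_def)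
  qed (simp_all add: n_def)
  have "cut (\<Union>i\<in>evens as. up_triangle (psum as (i - 1)) (entry as i)) = blocks as (evens as)"
    by (rule cut_blocks) simp
  moreover have "cut (\<Union>j\<in>evens bs. up_triangle (L - psum bs j) (entry bs j)) = reverse L ` blocks bs (evens bs)"
    by (rule cut_reverse_blocks) (use assms(1) in simp_all)
  ultimately show "cut (lower_gap z L as bs) = lower_dents z L as bs"
    by (simp only: lower_gap_def cut_Un lower_dents_def cut_up_triangle) blast
qed

lemma M_H1_region:
  fixes x y z :: nat and as bs :: "nat list"
  defines "L \<equiv> x + y + sum_list as + sum_list bs"
  shows "real (M (H1_region x y z as bs))
    = weyl (upper_dents L as bs) * weyl (lower_dents z L as bs)
      * zsum (sum_list as) (sum_list bs + z) (sum_list as + x + y) y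
      / (H2 (2 * (y + osum as + osum bs) + 1) * H2 (2 * (y + z + esum as + esum bs) + 1))"
proof -
  define n n' where "n = y + osum as + osum bs" and "n' = y + z + esum as + esum bs"
  define A B where "A = upper_dents L as bs" and "B = lower_dents z L as bs"
  define mid where "mid = {sum_list as..<sum_list as + x + y}"
  define R where "R = rows L n 0 - upper_gap L n as bs"
  define R' where "R' = rows (L + z) n' 0 - lower_gap z L as bs"
  have sL: "sum_list as + sum_list bs \<le> L" by (simp add: L_def)
  note ug = upper_gap_dent[OF sL, of y, folded n_def A_def]
  note lg = lower_gap_dent(1)[OF sL, where z = z and y = y, folded n'_def]
    lower_gap_dent(2)[OF sL, where z = z, folded B_def]
  note st = dents_structure[OF L_def[THEN meta_eq_to_obj_eq], folded A_def B_def]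
  have fin: "finite A" "finite B"
    by (rule finite_subset[OF st(1)], simp) (rule finite_subset[OF st(2)[of z, folded B_def]], simp)
  have nL: "n \<le> L" "n' \<le> L + z"
    using osum_esum[of as] osum_esum[of bs] by (simp_all add: n_def n'_def L_def)
  have cutR: "cut R = (if 0 < n then {..<L} - A else {})"
    using ug(2) by (auto simp: R_def cut_def)
  have cutR': "cut R' = (if 0 < n' then {..<L + z} - B else {})"
    using lg(2) by (auto simp: R'_def cut_def)
  have "(A \<union> B) \<inter> mid = {}" unfolding st(4)[of z, folded B_def] mid_def by auto
  then have dj: "A \<inter> S = {}" "B \<inter> S = {}" if "S \<subseteq> mid" for S
    using that by blast+
  define f where "f S = M (rows L n 0 - ups 0 (A \<union> S)) * M (rows (L + z) n' 0 - ups 0 (B \<union> S))" for S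
  have "M (H1_region x y z as bs) = M (R \<union> mirror ` R')"
    unfolding R_def R'_def n_def n'_def L_def by (simp only: H1_region_eq)
  also have "\<dots> = (\<Sum>S\<in>Pow (cut R \<inter> cut R'). M (R - ups 0 S) * M (R' - ups 0 S))"
    by (rule M_glue[of _ L n _ "L + z" n']) (auto simp: R_def R'_def)
  also have "\<dots> = (\<Sum>S\<in>Pow (cut R \<inter> cut R'). f S)"
  proof (rule sum.cong[OF refl])
    fix S assume S: "S \<in> Pow (cut R \<inter> cut R')"
    have "M (R - ups 0 S) = M (rows L n 0 - ups 0 (A \<union> S))"
      unfolding R_def ug(2)[symmetric] unfolding cut_def
      by (rule M_dent[OF ug(1)]) (use S in \<open>auto simp: cut_def R_def\<close>)
    moreover have "M (R' - ups 0 S) = M (rows (L + z) n' 0 - ups 0 (B \<union> S))"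
      unfolding R'_def lg(2)[symmetric] unfolding cut_def
      by (rule M_dent[OF lg(1)]) (use S in \<open>auto simp: cut_def R'_def\<close>)
    ultimately show "M (R - ups 0 S) * M (R' - ups 0 S) = f S" by (simp add: f_def)
  qed
  also have "\<dots> = (\<Sum>S | S \<subseteq> mid \<and> card S = y. f S)"
  proof (cases "0 < n \<and> 0 < n'")
    case True
    have "cut R \<inter> cut R' = {..<L} - (A \<union> B)" using True unfolding cutR cutR' by auto
    also have "\<dots> = mid" unfolding st(4)[of z, folded B_def] mid_def by (auto simp: L_def)
    finally have I: "cut R \<inter> cut R' = mid" .
    show ?thesis
      unfolding I
    proof (rule sum.mono_neutral_right)
      show "\<forall>S\<in>Pow mid - {S. S \<subseteq> mid \<and> card S = y}. f S = 0"
      proof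
        fix S assume "S \<in> Pow mid - {S. S \<subseteq> mid \<and> card S = y}"
        then have S: "S \<subseteq> mid" "card S \<noteq> y" by auto
        have "finite S" using S(1) by (rule finite_subset) (simp add: mid_def)
        then have "card (A \<union> S) = card A + card S" using fin dj[OF S(1)] by (intro card_Un_disjoint)
        then have "card (A \<union> S) \<noteq> n" using S(2) st(5) by (simp add: n_def)
        moreover have "A \<union> S \<subseteq> {..<L}" using st(1) S(1) by (auto simp: mid_def L_def)
        ultimately have "M (rows L n 0 - ups 0 (A \<union> S)) = 0" using M_rows_unbalanced True nL by blast
        then show "f S = 0" by (simp add: f_def)
      qed
    qed (auto simp: mid_def)
  next
    case False
    then have "y = 0" by (auto simp: n_def n'_def)
    have "S \<subseteq> mid \<and> card S = y \<longleftrightarrow> S = {}" for S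
      using finite_subset[of S mid] \<open>y = 0\<close> by (auto simp: mid_def)
    moreover have "cut R \<inter> cut R' = {}" using False unfolding cutR cutR' by auto
    ultimately show ?thesis by simp
  qed
  finally have "real (M (H1_region x y z as bs)) = (\<Sum>S | S \<subseteq> mid \<and> card S = y. real (f S))"
    by simp
  also have "\<dots> = (\<Sum>S | S \<subseteq> mid \<and> card S = y. weyl A * weyl B
      * ((\<Prod>s\<in>S. zw (sum_list as) (sum_list bs + z) (sum_list as + x + y) s) * (vdm sq S)\<^sup>2)
      / (H2 (2 * n + 1) * H2 (2 * n' + 1)))"
  proof (rule sum.cong[OF refl])
    fix S assume "S \<in> {S. S \<subseteq> mid \<and> card S = y}"
    then have S: "S \<subseteq> mid" "card S = y" by auto
    have fS: "finite S" using S(1) by (rule finite_subset) (simp add: mid_def)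
    have "card (A \<union> S) = card A + card S" using fin fS dj[OF S(1)] by (intro card_Un_disjoint)
    then have cA: "card (A \<union> S) = n" using S(2) st(5) by (simp add: n_def)
    have "card (B \<union> S) = card B + card S" using fin fS dj[OF S(1)] by (intro card_Un_disjoint)
    then have cB: "card (B \<union> S) = n'" using S(2) st(6)[of z, folded B_def] by (simp add: n'_def)
    have "A \<union> S \<subseteq> {..<L}" "B \<union> S \<subseteq> {..<L + z}"
      using st(1) st(2)[of z, folded B_def] S(1) by (auto simp: mid_def L_def)
    then have "real (f S) = weyl (A \<union> S) * weyl (B \<union> S) / (H2 (2 * n + 1) * H2 (2 * n' + 1))"
      using M_rows_dented[OF _ cA] M_rows_dented[OF _ cB] by (simp add: f_def)
    then show "real (f S) = weyl A * weyl B
      * ((\<Prod>s\<in>S. zw (sum_list as) (sum_list bs + z) (sum_list as + x + y) s) * (vdm sq S)\<^sup>2)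
      / (H2 (2 * n + 1) * H2 (2 * n' + 1))"
      using weyl_pair[OF fin fS dj[OF S(1)] st(3)[of z, folded B_def] st(4)[of z, folded B_def]] by simp
  qed
  finally show ?thesis
    by (simp only: zsum_def mid_def sum_distrib_left sum_divide_distrib A_def B_def n_def n'_def)
qed

lemma zsum_none: "zsum a c N 0 = 1"
proof -
  have "S \<subseteq> {a..<N} \<and> card S = 0 \<longleftrightarrow> S = {}" for S using finite_subset[of S "{a..<N}"] by auto
  then show ?thesis by (simp add: zsum_def vdm_def)
qed

theorem theorem2p4:
  fixes x y z :: nat and as bs :: "nat list"
  shows
    "let a = sum_list as; b = sum_list bs;
         o\<^sub>a = osum as; e\<^sub>a = esum as; o\<^sub>b = osum bs; e\<^sub>b = esum bs;
         TV = (T (real x + 1) (2*a + b + 2*y + z) y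
                 * V (2 * real x + 2 * real a + 3) (b + 2*y + z - 1) y)
              / (T 1 (2*a + b + 2*y + z) y * V (2 * real a + 3) (b + 2*y + z - 1) y)
     in M (H1_region y 0 z as bs) \<noteq> 0
      \<and> real (M (H1_region x y z as bs))
          = real (M (H1_region (x + y) 0 z as bs)) * real (M (H1_region 0 y z as bs))
              / real (M (H1_region y 0 z as bs)) * TV
      \<and> real (M (H1_region (x + y) 0 z as bs)) * real (M (H1_region 0 y z as bs))
              / real (M (H1_region y 0 z as bs)) * TV
          = 1 / 2 ^ y * real (Q (tplus x y as bs)) * real (Q (tminus x y z as bs))
            * (H2 (2*o\<^sub>a + 2*o\<^sub>b + 1) * H2 (2*e\<^sub>a + 2*e\<^sub>b + 2*z + 1)
               / (H2 (2*o\<^sub>a + 2*o\<^sub>b + 2*y + 1) * H2 (2*e\<^sub>a + 2*e\<^sub>b + 2*y + 2*z + 1)))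
            * (H (2*a + b + 2*y + z + 1) * H (b + y + z)
               / (H (2*a + b + y + z + 1) * H (b + z)))
            * TV"
proof -
  define a b where "a = sum_list as" and "b = sum_list bs"
  define h1 where "h1 k = H2 (2 * (k + osum as + osum bs) + 1)" for k
  define h2 where "h2 k = H2 (2 * (k + z + esum as + esum bs) + 1)" for k
  define w where "w L = weyl (upper_dents L as bs) * weyl (lower_dents z L as bs)" for L
  define TV where "TV = (T (real x + 1) (2*a + b + 2*y + z) y
      * V (2 * real x + 2 * real a + 3) (b + 2*y + z - 1) y)
    / (T 1 (2*a + b + 2*y + z) y * V (2 * real a + 3) (b + 2*y + z - 1) y)"
  define Z where "Z = 1 / 2 ^ y * (H (2*a + b + 2*y + z + 1) * H (b + y + z) / (H (2*a + b + y + z + 1) * H (b + z)))"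
  have h: "h1 k > 0" "h2 k > 0" for k by (simp_all add: h1_def h2_def H2_pos)
  have w: "w L > 0" for L by (simp add: w_def weyl_pos)
  have M: "real (M (H1_region x y z as bs)) = w (x + y + a + b) * zsum a (b + z) (a + x + y) y / (h1 y * h2 y)" for x y
    unfolding M_H1_region w_def h1_def h2_def a_def b_def ..
  have Zb: "zsum a (b + z) (a + y) y = Z"
    unfolding zsum_base Z_def by (simp add: ac_simps)
  have "TV = zprod a (b + z) (a + x + y) y / zprod a (b + z) (a + y) y"
    using T_V_zprod[of x a b y z] T_V_zprod[of 0 a b y z] by (simp add: TV_def)
  then have Zx: "zsum a (b + z) (a + x + y) y = Z * TV" by (simp add: zsum_shift Zb)
  have M1: "real (M (H1_region (x + y) 0 z as bs)) = w (x + y + a + b) / (h1 0 * h2 0)"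
    unfolding M by (simp add: zsum_none add.assoc)
  have M2: "real (M (H1_region 0 y z as bs)) = w (y + a + b) * Z / (h1 y * h2 y)"
    unfolding M by (simp add: Zb)
  have M3: "real (M (H1_region y 0 z as bs)) = w (y + a + b) / (h1 0 * h2 0)"
    unfolding M by (simp add: zsum_none)
  have Q12: "real (Q (tplus x y as bs)) * real (Q (tminus x y z as bs)) = w (x + y + a + b) / (h1 0 * h2 0)"
    unfolding Q_eq blocks_tplus blocks_tminus esum_tplus esum_tminus
    by (simp add: w_def h1_def h2_def a_def b_def ac_simps)
  have nz: "M (H1_region y 0 z as bs) \<noteq> 0"
  proof -
    have "real (M (H1_region y 0 z as bs)) > 0" unfolding M3 using w h by (intro divide_pos_pos mult_pos_pos)
    then show ?thesis by simp
  qed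
  have mid: "real (M (H1_region (x + y) 0 z as bs)) * real (M (H1_region 0 y z as bs)) / real (M (H1_region y 0 z as bs))
      = w (x + y + a + b) * Z / (h1 y * h2 y)"
    unfolding M1 M2 M3 using w[of "y + a + b"] h[of 0] h[of y] by simp
  have 1: "real (M (H1_region x y z as bs))
      = real (M (H1_region (x + y) 0 z as bs)) * real (M (H1_region 0 y z as bs))
        / real (M (H1_region y 0 z as bs)) * TV"
    unfolding mid using M[of x y] by (simp add: Zx)
  have e: "H2 (2 * osum as + 2 * osum bs + 1) = h1 0" "H2 (2 * osum as + 2 * osum bs + 2 * y + 1) = h1 y"
    "H2 (2 * esum as + 2 * esum bs + 2 * z + 1) = h2 0" "H2 (2 * esum as + 2 * esum bs + 2 * y + 2 * z + 1) = h2 y"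
    by (simp_all add: h1_def h2_def algebra_simps)
  have "1 / 2 ^ y * real (Q (tplus x y as bs)) * real (Q (tminus x y z as bs))
      * (h1 0 * h2 0 / (h1 y * h2 y))
      * (H (2*a + b + 2*y + z + 1) * H (b + y + z) / (H (2*a + b + y + z + 1) * H (b + z)))
      = (real (Q (tplus x y as bs)) * real (Q (tminus x y z as bs))) * (h1 0 * h2 0 / (h1 y * h2 y)) * Z"
    by (simp only: Z_def ac_simps)
  also have "\<dots> = w (x + y + a + b) * Z / (h1 y * h2 y)"
    unfolding Q12 using h[of 0] by simp
  finally have 2: "1 / 2 ^ y * real (Q (tplus x y as bs)) * real (Q (tminus x y z as bs))
      * (h1 0 * h2 0 / (h1 y * h2 y))
      * (H (2*a + b + 2*y + z + 1) * H (b + y + z) / (H (2*a + b + y + z + 1) * H (b + z)))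
      = w (x + y + a + b) * Z / (h1 y * h2 y)" .
  show ?thesis
    unfolding Let_def a_def[symmetric] b_def[symmetric] TV_def[symmetric] e
  proof (intro conjI)
    show "M (H1_region y 0 z as bs) \<noteq> 0" by (rule nz)
    show "real (M (H1_region x y z as bs))
      = real (M (H1_region (x + y) 0 z as bs)) * real (M (H1_region 0 y z as bs))
        / real (M (H1_region y 0 z as bs)) * TV" by (rule 1)
  qed (simp only: mid 2)
qed

end
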